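(* Let $m\ge 1$ be an integer, let $p,q\in\{1,2,\dots,2m-1\}$, let $c$ be a coefficient on $I=[-1,1]$ having $x=0$ as its single zero, of right order $p$ and left order $q$ (as specified in the context), and let $L_0^{pq}$ be the minimal closed symmetric operator in $L_2(I)$ generated by $l_{2m}[y]=(-1)^m(c\,y^{(m)})^{(m)}$. Then the common value $n_{pq}$ of the deficiency numbers of $L_0^{pq}$ is $$ n_{pq}=\begin{cases} 4m-\max\{p,q\}, & \text{if } p,q\in\{m+1,m+2,\dots,2m-1\},\\ 2m+\min\{p,q\}, & \text{if } p,q\in\{1,2,\dots,m\},\\ 3m+p-q, & \text{if } p\in\{1,2,\dots,m\},\ q\in\{m+1,m+2,\dots,2m-1\}. \end{cases} $$
   Context: Let $I=[-1,1]$ and let $m\ge1$ be an integer. The coefficient. Let $p,q\in\{1,\dots,2m-1\}$. The function $c:I\to\mathbb R$ has a single zero on $I$, at $x=0$, and has the form $$c(x)=\begin{cases}x^p a(x), & x\in[0,1],\\ (-x)^q b(x), & x\in[-1,0],\end{cases}$$ where $a,b$ are real-valued functions on $I$ represented by power series $a(z)=a_0+\sum_{j\ge1}a_jz^j$, $a_0\neq0$, and $b(z)=b_0+\sum_{j\ge1}b_jz^j$, $b_0\ne0$, convergent for $|z|<1$. Since $0$ is the only zero of $c$ on $I$, $a$ does not vanish (and has constant sign) on $[0,1]$, and $b$ does not vanish (and has constant sign) on $[-1,0]$. The signs of $a$ and $b$ are otherwise unrestricted. One says that $0$ is a zero of $c$ of right order $p$ and left order $q$. The operator. Consider the differential expression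 $l_{2m}[y](x)=(-1)^m\bigl(c(x)y^{(m)}\bigr)^{(m)}(x)$, $x\in I$. Let $D_0'$ be the set of all infinitely differentiable functions $y$ on $I$ vanishing identically outside some segment $[\alpha,\beta]$ with $-1<\alpha<\beta<1$ (the segment may depend on $y$), and let $L_0'$ be the operator in $L_2(I)$ with domain $D_0'$ acting by $L_0'y=l_{2m}[y]$. The operator $L_0'$ is taken as a densely defined symmetric operator in $L_2(I)$; its closure is denoted $L_0^{pq}$ and is called the minimal closed symmetric operator generated by $l_{2m}$ in $L_2(I)$. Deficiency numbers. For non-real $\lambda$, the deficiency number is $\dim\ker\bigl((L_0^{pq})^*-\lambda\bigr)$; it is constant in $\lambda$ on each of the upper and lower open half-planes. Since $L_0^{pq}$ is a real operator (it commutes with complex conjugation), its two deficiency numbers are equal; $n_{pq}$ denotes their common value. *)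

theory Defs
  imports "HOL-Analysis.Analysis"
begin

section \<open>The complex Hilbert space of square integrable functions on the interval from -1 to 1\<close>

abbreviation I_measure :: "real measure"
  where "I_measure \<equiv> lebesgue_on {-1..1}"

definition square_integrable :: "(real \<Rightarrow> complex) \<Rightarrow> bool"
  where "square_integrable f \<longleftrightarrow>
    f \<in> borel_measurable I_measure \<and> integrable I_measure (\<lambda>x. (norm (f x))\<^sup>2)"

lemma square_integrable_measurable [measurable_dest]:
  "square_integrable f \<Longrightarrow> f \<in> borel_measurable I_measure"
  by (simp add: square_integrable_def)

lemma square_integrable_zero: "square_integrable (\<lambda>_. 0)"
  by (simp add: square_integrable_def)

lemma square_integrable_scale:
  assumes "square_integrable f"
  shows "square_integrable (\<lambda>x. c * f x)"
  using assms by (auto simp: square_integrable_def norm_mult power_mult_distrib)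

lemma square_integrable_add:
  assumes f: "square_integrable f" and g: "square_integrable g"
  shows "square_integrable (\<lambda>x. f x + g x)"
proof -
  note [measurable] = square_integrable_measurable[OF f] square_integrable_measurable[OF g]
  have le: "(norm (f x + g x))\<^sup>2 \<le> 2 * (norm (f x))\<^sup>2 + 2 * (norm (g x))\<^sup>2" for x
  proof -
    have "(norm (f x + g x))\<^sup>2 \<le> (norm (f x) + norm (g x))\<^sup>2"
      by (intro power_mono norm_triangle_ineq) auto
    also have "\<dots> \<le> 2 * (norm (f x))\<^sup>2 + 2 * (norm (g x))\<^sup>2"
      using sum_squares_bound[of "norm (f x)" "norm (g x)"] by (simp add: power2_sum)
    finally show ?thesis .
  qed
  have "integrable I_measure (\<lambda>x. (norm (f x + g x))\<^sup>2)"
  proof (rule Bochner_Integration.integrable_bound)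
    show "integrable I_measure (\<lambda>x. 2 * (norm (f x))\<^sup>2 + 2 * (norm (g x))\<^sup>2)"
      using f g by (auto simp: square_integrable_def)
    show "AE x in I_measure. norm ((norm (f x + g x))\<^sup>2)
        \<le> norm (2 * (norm (f x))\<^sup>2 + 2 * (norm (g x))\<^sup>2)"
      using le by (auto intro!: AE_I2)
  qed measurable
  then show ?thesis
    by (simp add: square_integrable_def)
qed

lemma square_integrable_integrable_mult:
  assumes f: "square_integrable f" and g: "square_integrable g"
  shows "integrable I_measure (\<lambda>x. f x * cnj (g x))"
proof -
  note [measurable] = square_integrable_measurable[OF f] square_integrable_measurable[OF g]
  have le: "norm (f x) * norm (g x) \<le> (norm (f x))\<^sup>2 + (norm (g x))\<^sup>2" for x
  proof -
    have "2 * (norm (f x) * norm (g x)) \<le> (norm (f x))\<^sup>2 + (norm (g x))\<^sup>2"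
      using sum_squares_bound[of "norm (f x)" "norm (g x)"] by (simp add: mult.assoc)
    moreover have "0 \<le> norm (f x) * norm (g x)" by simp
    ultimately show ?thesis by linarith
  qed
  have [measurable]: "(\<lambda>x. cnj (g x)) \<in> borel_measurable I_measure"
    by (intro borel_measurable_continuous_on[where f = cnj] continuous_intros) measurable
  show ?thesis
  proof (rule Bochner_Integration.integrable_bound)
    show "integrable I_measure (\<lambda>x. (norm (f x))\<^sup>2 + (norm (g x))\<^sup>2)"
      using f g by (auto simp: square_integrable_def)
    show "AE x in I_measure. norm (f x * cnj (g x)) \<le> norm ((norm (f x))\<^sup>2 + (norm (g x))\<^sup>2)"
      using le by (auto intro!: AE_I2 simp: norm_mult)
  qed measurable
qed

text \<open>\<open>L2_of f\<close> is the class of \<open>f\<close> modulo equality almost everywhere; it is meaningful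
  for square integrable \<open>f\<close> only.\<close>

quotient_type L2I = "real \<Rightarrow> complex" / partial:
  "\<lambda>f g. square_integrable f \<and> square_integrable g \<and> (AE x in I_measure. f x = g x)"
  morphisms L2_rep L2_of
proof (rule part_equivpI)
  show "\<exists>f. square_integrable f \<and> square_integrable f \<and> (AE x in I_measure. f x = f x)"
    using square_integrable_zero by auto
  show "symp (\<lambda>f g. square_integrable f \<and> square_integrable g \<and> (AE x in I_measure. f x = g x))"
    by (auto intro!: sympI elim: AE_mp)
  show "transp (\<lambda>f g. square_integrable f \<and> square_integrable g \<and> (AE x in I_measure. f x = g x))"
    by (intro transpI conjI) (auto elim: AE_mp)
qed

lift_definition cinner :: "L2I \<Rightarrow> L2I \<Rightarrow> complex"
  is "\<lambda>f g. \<integral>x. f x * cnj (g x) \<partial>I_measure"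
proof -
  fix f f' g g'
  assume f: "square_integrable f \<and> square_integrable f' \<and> (AE x in I_measure. f x = f' x)"
    and g: "square_integrable g \<and> square_integrable g' \<and> (AE x in I_measure. g x = g' x)"
  have *: "AE x in I_measure. f x * cnj (g x) = f' x * cnj (g' x)"
    using conjunct2[OF conjunct2[OF f]] conjunct2[OF conjunct2[OF g]] by eventually_elim simp
  show "(\<integral>x. f x * cnj (g x) \<partial>I_measure) = (\<integral>x. f' x * cnj (g' x) \<partial>I_measure)"
    using f g by (intro integral_cong_AE[OF _ _ *])
      (auto intro!: borel_measurable_integrable square_integrable_integrable_mult)
qed

lift_definition scaleC :: "complex \<Rightarrow> L2I \<Rightarrow> L2I"
  is "\<lambda>c f x. c * f x"
  by (auto intro: square_integrable_scale elim: AE_mp)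

instantiation L2I :: real_inner
begin

lift_definition zero_L2I :: L2I is "\<lambda>_. 0"
  by (simp add: square_integrable_zero)

lift_definition plus_L2I :: "L2I \<Rightarrow> L2I \<Rightarrow> L2I" is "\<lambda>f g x. f x + g x"
  subgoal premises prems for f f' g g'
    using prems AE_conjI[of "\<lambda>x. f x = f' x" I_measure "\<lambda>x. g x = g' x"]
    by (auto intro: square_integrable_add elim: AE_mp)
  done

definition uminus_L2I :: "L2I \<Rightarrow> L2I" where "uminus_L2I u = scaleC (-1) u"

definition minus_L2I :: "L2I \<Rightarrow> L2I \<Rightarrow> L2I" where "minus_L2I u v = u + - v"

definition scaleR_L2I :: "real \<Rightarrow> L2I \<Rightarrow> L2I" where "scaleR_L2I r = scaleC (of_real r)"

definition inner_L2I :: "L2I \<Rightarrow> L2I \<Rightarrow> real" where "inner_L2I u v = Re (cinner u v)"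

definition norm_L2I :: "L2I \<Rightarrow> real" where "norm_L2I u = sqrt (inner u u)"

definition sgn_L2I :: "L2I \<Rightarrow> L2I" where "sgn_L2I u = inverse (norm u) *\<^sub>R u"

definition dist_L2I :: "L2I \<Rightarrow> L2I \<Rightarrow> real" where "dist_L2I u v = norm (u - v)"

definition uniformity_L2I :: "(L2I \<times> L2I) filter"
  where "uniformity_L2I = (INF e\<in>{0<..}. principal {(u, v). dist u v < e})"

definition open_L2I :: "L2I set \<Rightarrow> bool"
  where "open_L2I U \<longleftrightarrow> (\<forall>u\<in>U. \<forall>\<^sub>F (u', v) in uniformity. u' = u \<longrightarrow> v \<in> U)"

instance
proof
  fix u v w :: L2I and r s :: real
  have scale_add: "scaleC c (u + v) = scaleC c u + scaleC c v" for c and u v :: L2I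
    by transfer (auto simp: algebra_simps intro!: square_integrable_scale square_integrable_add)
  have add_scale: "scaleC (c + d) u = scaleC c u + scaleC d u" for c d and u :: L2I
    by transfer (auto simp: algebra_simps intro!: square_integrable_scale square_integrable_add)
  show "u + v + w = u + (v + w)"
    by transfer (auto simp: algebra_simps intro!: square_integrable_add)
  show "u + v = v + u"
    by transfer (auto simp: algebra_simps intro!: square_integrable_add)
  show "0 + u = u"
    by transfer auto
  show "- u + u = 0"
    unfolding uminus_L2I_def by transfer (auto intro: square_integrable_zero
      simp: square_integrable_def)
  show "u - v = u + - v"
    by (rule minus_L2I_def)
  show "r *\<^sub>R (u + v) = r *\<^sub>R u + r *\<^sub>R v"
    unfolding scaleR_L2I_def by (rule scale_add)
  show "(r + s) *\<^sub>R u = r *\<^sub>R u + s *\<^sub>R u"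
    unfolding scaleR_L2I_def of_real_add by (rule add_scale)
  show "r *\<^sub>R s *\<^sub>R u = (r * s) *\<^sub>R u"
    unfolding scaleR_L2I_def of_real_mult
    by transfer (auto simp: mult.assoc intro!: square_integrable_scale)
  show "1 *\<^sub>R u = u"
    unfolding scaleR_L2I_def by transfer auto
  show "sgn u = inverse (norm u) *\<^sub>R u"
    by (rule sgn_L2I_def)
  show "dist u v = norm (u - v)"
    by (rule dist_L2I_def)
  show "uniformity = (INF e\<in>{0<..}. principal {(u :: L2I, v). dist u v < e})"
    by (rule uniformity_L2I_def)
  show "open U \<longleftrightarrow> (\<forall>u\<in>U. \<forall>\<^sub>F (u', v) in uniformity. u' = u \<longrightarrow> v \<in> U)" for U :: "L2I set"
    by (rule open_L2I_def)
  show "inner u v = inner v u"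
  proof -
    have "cinner v u = cnj (cinner u v)"
      by transfer (subst Bochner_Integration.integral_cnj[symmetric], simp add: mult.commute)
    then show ?thesis by (simp add: inner_L2I_def)
  qed
  show "inner (u + v) w = inner u w + inner v w"
    unfolding inner_L2I_def
    by transfer (simp add: ring_distribs square_integrable_integrable_mult)
  show "inner (r *\<^sub>R u) v = r * inner u v"
    unfolding inner_L2I_def scaleR_L2I_def
    by transfer (simp add: mult.assoc)
  have sq: "inner u u = (\<integral>x. (norm (L2_rep u x))\<^sup>2 \<partial>I_measure)" for u :: L2I
  proof -
    have "cinner u u = (\<integral>x. complex_of_real ((norm (L2_rep u x))\<^sup>2) \<partial>I_measure)"
      unfolding cinner.rep_eq
      by (intro Bochner_Integration.integral_cong refl) (simp add: complex_norm_square[symmetric])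
    then show ?thesis
      unfolding inner_L2I_def by (metis Re_complex_of_real integral_complex_of_real)
  qed
  show "0 \<le> inner u u"
    unfolding sq by (rule integral_nonneg_AE) simp
  have rep: "square_integrable (L2_rep u)"
    using Quotient3_rep_reflp[OF Quotient3_L2I] by blast
  show "inner u u = 0 \<longleftrightarrow> u = 0"
  proof -
    have "inner u u = 0 \<longleftrightarrow> (AE x in I_measure. (norm (L2_rep u x))\<^sup>2 = 0)"
      unfolding sq using rep
      by (intro integral_nonneg_eq_0_iff_AE) (auto simp: square_integrable_def)
    also have "\<dots> \<longleftrightarrow> (AE x in I_measure. L2_rep u x = 0)"
      by simp
    also have "\<dots> \<longleftrightarrow> u = 0"
    proof
      assume "AE x in I_measure. L2_rep u x = 0"
      then have "L2_of (L2_rep u) = L2_of (\<lambda>_. 0)"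
        using Quotient3_rel_abs[OF Quotient3_L2I] rep square_integrable_zero by blast
      then show "u = 0"
        by (simp add: Quotient3_abs_rep[OF Quotient3_L2I] zero_L2I.abs_eq zero_L2I_def)
    next
      assume "u = 0"
      then have "u = L2_of (\<lambda>_. 0)"
        by (simp add: zero_L2I_def)
      then show "AE x in I_measure. L2_rep u x = 0"
        using Quotient3_rep_abs[OF Quotient3_L2I, of "\<lambda>_. 0"] square_integrable_zero by auto
    qed
    finally show ?thesis .
  qed
  show "norm u = sqrt (inner u u)"
    by (rule norm_L2I_def)
qed

end

interpretation L2: vector_space scaleC
proof
  fix c d :: complex and u v :: L2I
  show "scaleC c (u + v) = scaleC c u + scaleC c v"
    by transfer (auto simp: algebra_simps intro!: square_integrable_scale square_integrable_add)
  show "scaleC (c + d) u = scaleC c u + scaleC d u"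
    by transfer (auto simp: algebra_simps intro!: square_integrable_scale square_integrable_add)
  show "scaleC c (scaleC d u) = scaleC (c * d) u"
    by transfer (auto simp: mult.assoc intro!: square_integrable_scale)
  show "scaleC 1 u = u"
    by transfer auto
qed


section \<open>Operators, adjoints and deficiency numbers\<close>

text \<open>Operators are identified with their graphs; the closure of an operator is the topological
  closure of its graph in the product space. For a densely defined operator, the set \<open>adjoint T\<close>
  is the graph of the Hilbert space adjoint.\<close>

definition adjoint :: "(L2I \<times> L2I) set \<Rightarrow> (L2I \<times> L2I) set"
  where "adjoint T = {(z, w). \<forall>(u, v)\<in>T. cinner v z = cinner u w}"

definition deficiency_number :: "(L2I \<times> L2I) set \<Rightarrow> complex \<Rightarrow> nat"
  where "deficiency_number T \<mu> = L2.dim {z. (z, scaleC \<mu> z) \<in> adjoint T}"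


section \<open>The degenerate differential operator\<close>

text \<open>Outside the interval the values of \<open>c\<close> are irrelevant. The power series represent \<open>a\<close> and
  \<open>b\<close> on the open unit interval only; continuity excludes unrelated values, or a degeneration of
  \<open>c\<close>, at the endpoints 1 and -1. By Abel's limit theorem it is automatic if the series also
  represent \<open>a\<close> at 1 and \<open>b\<close> at -1.\<close>

definition coefficient :: "nat \<Rightarrow> nat \<Rightarrow> (real \<Rightarrow> real) \<Rightarrow> bool"
  where "coefficient p q c \<longleftrightarrow>
    (\<forall>x\<in>{-1..1}. c x = 0 \<longleftrightarrow> x = 0) \<and>
    (\<exists>(a :: real \<Rightarrow> real) (b :: real \<Rightarrow> real) (\<alpha> :: nat \<Rightarrow> real) (\<beta> :: nat \<Rightarrow> real).
      \<alpha> 0 \<noteq> 0 \<and> \<beta> 0 \<noteq> 0 \<and>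
      (\<forall>x. \<bar>x\<bar> < 1 \<longrightarrow> (\<lambda>j. \<alpha> j * x ^ j) sums a x) \<and>
      (\<forall>x. \<bar>x\<bar> < 1 \<longrightarrow> (\<lambda>j. \<beta> j * x ^ j) sums b x) \<and>
      continuous_on {0..1} a \<and> continuous_on {-1..0} b \<and>
      (\<forall>x\<in>{0..1}. c x = x ^ p * a x) \<and>
      (\<forall>x\<in>{-1..0}. c x = (- x) ^ q * b x))"

definition nth_deriv :: "nat \<Rightarrow> (real \<Rightarrow> complex) \<Rightarrow> real \<Rightarrow> complex"
  where "nth_deriv k = ((\<lambda>f x. vector_derivative f (at x)) ^^ k)"

text \<open>Functions on the interval that vanish near both endpoints are extended by zero.\<close>

definition test_functions :: "(real \<Rightarrow> complex) set"
  where "test_functions =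
    {y. (\<forall>k x. nth_deriv k y differentiable at x) \<and>
        (\<exists>\<alpha> \<beta>. -1 < \<alpha> \<and> \<alpha> < \<beta> \<and> \<beta> < 1 \<and> (\<forall>x. x \<notin> {\<alpha>..\<beta>} \<longrightarrow> y x = 0))}"

text \<open>If \<open>c\<close> is not smooth at 0, then the outer derivatives need not exist at the single point 0,
  where the value below is irrelevant. Away from 0 they exist and are bounded, since both pieces
  of \<open>c\<close> are analytic up to 0; so the expression is square integrable.\<close>

definition diff_expr :: "nat \<Rightarrow> (real \<Rightarrow> real) \<Rightarrow> (real \<Rightarrow> complex) \<Rightarrow> real \<Rightarrow> complex"
  where "diff_expr m c y x =
    (-1) ^ m * nth_deriv m (\<lambda>t. complex_of_real (c t) * nth_deriv m y t) x"

definition preminimal_operator :: "nat \<Rightarrow> (real \<Rightarrow> real) \<Rightarrow> (L2I \<times> L2I) set"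
  where "preminimal_operator m c = {(L2_of y, L2_of (diff_expr m c y)) |y. y \<in> test_functions}"

definition minimal_operator :: "nat \<Rightarrow> (real \<Rightarrow> real) \<Rightarrow> (L2I \<times> L2I) set"
  where "minimal_operator m c = closure (preminimal_operator m c)"

end

theory Submission
  imports Defs
begin

text \<open>
  An element of the kernel of the adjoint minus \<open>\<mu>\<close> solves the equation classically on both sides of 0.
  On one side, of order \<open>p\<close>, write \<open>z\<^sup>(\<^sup>m\<^sup>) = V / c\<close>, where the \<open>m\<close>-th derivative of \<open>V\<close> is a multiple of \<open>z\<close>.
  Let \<open>P j\<close> be the initial values of the derivatives of \<open>V\<close> at 0, and \<open>Q k\<close> those of \<open>z\<close>, replaced by
  values at an interior point for \<open>k \<ge> m - p\<close>. Integrability of \<open>z\<close> forces \<open>P j = 0\<close> for \<open>j < p - m\<close>, and for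
  all other data there is exactly one solution, by a contraction argument in a weighted space.

  The two sides are coupled by Green's identity for test functions \<open>y\<close> across 0. The derivatives of \<open>y\<close> at 0 of
  order below \<open>m\<close> force the values \<open>P j\<close> of both sides to agree up to sign. Those of order \<open>m + s\<close> enter through
  the jumps of the derivatives of \<open>c * y\<^sup>(\<^sup>m\<^sup>)\<close>, which the pointwise differential expression ignores; they give
  a triangular system of \<open>m - min p q\<close> independent conditions on \<open>Q\<close> if \<open>min p q < m\<close>, and none otherwise. This leaves
  \<open>3 * m - max 0 (max p q - m) - max 0 (m - min p q)\<close> free parameters.
\<close>

section \<open>Derivative sequences and test functions\<close>

text \<open>An element of the kernel is at first only a square integrable function satisfying an
  integral identity, whereas the count needs its values and quasi-derivatives at 0, where the
  leading coefficient degenerates. The exponent -1/4 reconciles the two. Once \<open>P j = 0\<close>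
  for \<open>j < p - m\<close>, the function \<open>V 0\<close> is O(x^(p - m)) (truncated
  subtraction), so the \<open>m\<close>-th derivative of a solution is O(x^(- min m p)) and
  \<open>m\<close> integrations produce at worst a logarithm; x^(-1/4) dominates it and is still
  square integrable. Conversely, a nonzero \<open>P j\<close> with \<open>j < p - m\<close> creates
  a pole that is not even integrable, so this growth class loses no solution.

  The two pieces of \<open>c\<close> are unrelated at 0, so c times y^(m) need not have a common jet
  there. Each piece is therefore continued smoothly across 0 by its own power series; its product
  with y^(m) is a genuine test function, whose jet at 0 is the one-sided jet wanted. The left half
  is reflected to the right, so one locale serves both sides. The endpoints 1 and -1 contribute no
  conditions, because test functions vanish near them.\<close>

definition derivs :: "(nat \<Rightarrow> real \<Rightarrow> complex) \<Rightarrow> real set \<Rightarrow> bool"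
  where "derivs D S \<longleftrightarrow> (\<forall>k. \<forall>x\<in>S. (D k has_vector_derivative D (Suc k) x) (at x))"

lemma derivsD: "derivs D S \<Longrightarrow> x \<in> S \<Longrightarrow> (D k has_vector_derivative D (Suc k) x) (at x)"
  by (simp add: derivs_def)

lemma derivs_subset: "derivs D S \<Longrightarrow> T \<subseteq> S \<Longrightarrow> derivs D T"
  by (auto simp: derivs_def)

lemma derivs_shift: "derivs D S \<Longrightarrow> derivs (\<lambda>k. D (k + j)) S"
  by (simp add: derivs_def)

lemma derivs_continuous_on: "derivs D S \<Longrightarrow> continuous_on S (D k)"
  by (meson continuous_at_imp_continuous_on derivsD has_vector_derivative_continuous)

lemma derivs_cong_open:
  assumes "derivs D S" "open S" "\<And>k x. x \<in> S \<Longrightarrow> E k x = D k x"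
  shows "derivs E S"
  unfolding derivs_def
proof (intro allI ballI)
  fix k x assume x: "x \<in> S"
  show "(E k has_vector_derivative E (Suc k) x) (at x)"
    using has_vector_derivative_transform_within_open[OF derivsD[OF assms(1) x] assms(2) x, where g="E k"]
      assms(3) x by simp
qed

lemma derivs_Un: "derivs D S \<Longrightarrow> derivs D T \<Longrightarrow> derivs D (S \<union> T)"
  by (auto simp: derivs_def)

lemma derivs_zero: "derivs (\<lambda>k x. 0) S"
  by (auto simp: derivs_def)

lemma derivs_add: "derivs F S \<Longrightarrow> derivs G S \<Longrightarrow> derivs (\<lambda>k x. F k x + G k x) S"
  by (auto simp: derivs_def intro!: derivative_intros)

lemma derivs_scale: "derivs F S \<Longrightarrow> derivs (\<lambda>k x. c * F k x) S"
  by (auto simp: derivs_def intro!: derivative_eq_intros)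

lemma derivs_affine:
  assumes "derivs D T" "\<And>x. x \<in> S \<Longrightarrow> r * x + s \<in> T"
  shows "derivs (\<lambda>k x. of_real r ^ k * D k (r * x + s)) S"
  unfolding derivs_def
proof (intro allI ballI)
  fix k x assume x: "x \<in> S"
  have 1: "((\<lambda>x. r * x + s) has_vector_derivative r) (at x)"
    by (auto intro!: derivative_eq_intros simp: has_vector_derivative_def)
  have "((D k \<circ> (\<lambda>x. r * x + s)) has_vector_derivative r *\<^sub>R D (Suc k) (r * x + s)) (at x)"
    by (rule vector_diff_chain_at[OF 1 derivsD[OF assms(1) assms(2)[OF x]]])
  then have "((\<lambda>x. D k (r * x + s)) has_vector_derivative of_real r * D (Suc k) (r * x + s)) (at x)"
    by (simp add: o_def scaleR_conv_of_real)
  then show "((\<lambda>x. of_real r ^ k * D k (r * x + s)) has_vector_derivative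
      of_real r ^ Suc k * D (Suc k) (r * x + s)) (at x)"
    by (auto intro!: derivative_eq_intros)
qed

definition leibniz :: "(nat \<Rightarrow> real \<Rightarrow> complex) \<Rightarrow> (nat \<Rightarrow> real \<Rightarrow> complex) \<Rightarrow> nat \<Rightarrow> real \<Rightarrow> complex"
  where "leibniz F G n x = (\<Sum>i\<le>n. of_nat (n choose i) * F i x * G (n - i) x)"

lemma leibniz_0 [simp]: "leibniz F G 0 x = F 0 x * G 0 x"
  by (simp add: leibniz_def)

lemma derivs_leibniz:
  assumes F: "derivs F S" and G: "derivs G S"
  shows "derivs (leibniz F G) S"
  unfolding derivs_def
proof (intro allI ballI)
  fix n x assume x: "x \<in> S"
  have d: "(leibniz F G n has_vector_derivative
      (\<Sum>i\<le>n. of_nat (n choose i) * (F i x * G (Suc (n - i)) x + F (Suc i) x * G (n - i) x))) (at x)"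
    unfolding leibniz_def[abs_def] mult.assoc
    by (intro has_vector_derivative_sum has_vector_derivative_mult_right has_vector_derivative_mult
        derivsD[OF F x] derivsD[OF G x])
  have "leibniz F G (Suc n) x =
     F 0 x * G (Suc n) x + (\<Sum>i\<le>n. of_nat ((n choose Suc i) + (n choose i)) * F (Suc i) x * G (n - i) x)"
    unfolding leibniz_def by (subst sum.atMost_Suc_shift) (simp add: add.commute)
  also have "\<dots> = (F 0 x * G (Suc n) x + (\<Sum>i\<le>n. of_nat (n choose Suc i) * F (Suc i) x * G (n - i) x))
     + (\<Sum>i\<le>n. of_nat (n choose i) * F (Suc i) x * G (n - i) x)"
    by (simp add: algebra_simps sum.distrib)
  also have "F 0 x * G (Suc n) x + (\<Sum>i\<le>n. of_nat (n choose Suc i) * F (Suc i) x * G (n - i) x)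
     = (\<Sum>i\<le>Suc n. of_nat (n choose i) * F i x * G (Suc n - i) x)"
    by (subst sum.atMost_Suc_shift) simp
  \<comment> \<open>The term with index \<open>Suc n\<close> drops out because
    \<open>n choose Suc n\<close> is 0.\<close>
  also have "\<dots> = (\<Sum>i\<le>n. of_nat (n choose i) * F i x * G (Suc (n - i)) x)"
    by (simp add: Suc_diff_le)
  also have "\<dots> + (\<Sum>i\<le>n. of_nat (n choose i) * F (Suc i) x * G (n - i) x) =
     (\<Sum>i\<le>n. of_nat (n choose i) * (F i x * G (Suc (n - i)) x + F (Suc i) x * G (n - i) x))"
    by (simp add: sum.distrib[symmetric] algebra_simps)
  finally show "(leibniz F G n has_vector_derivative leibniz F G (Suc n) x) (at x)"
    using d by simp
qed

lemma nth_deriv_Suc: "nth_deriv (Suc k) f = (\<lambda>x. vector_derivative (nth_deriv k f) (at x))"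
  by (simp add: nth_deriv_def)

lemma nth_deriv_0 [simp]: "nth_deriv 0 f = f"
  by (simp add: nth_deriv_def)

text \<open>The bridge from derivative families, which carry all derivatives of a smooth function at
  once, to the iterated \<open>vector_derivative\<close> in the definition of the operator. Openness
  of \<open>S\<close> makes the values of \<open>f\<close> off \<open>S\<close> invisible.\<close>

lemma nth_deriv_eqI:
  assumes "derivs D S" "open S" "\<And>x. x \<in> S \<Longrightarrow> f x = D 0 x" "x \<in> S"
  shows "nth_deriv k f x = D k x"
  using assms(4)
proof (induction k arbitrary: x)
  case 0
  then show ?case using assms(3) by simp
next
  case (Suc k)
  have "(nth_deriv k f has_vector_derivative D (Suc k) x) (at x)"
    using has_vector_derivative_transform_within_open[OF derivsD[OF assms(1) Suc.prems] assms(2) Suc.prems,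
        where g="nth_deriv k f"] Suc.IH by simp
  then show ?case
    by (simp add: nth_deriv_Suc vector_derivative_at)
qed

text \<open>The interval is a parameter: (-1,1) gives the test functions of the operator, (0,1)
  those that see a single side of 0.\<close>

definition testfn :: "real \<Rightarrow> real \<Rightarrow> (nat \<Rightarrow> real \<Rightarrow> complex) \<Rightarrow> bool"
  where "testfn a b D \<longleftrightarrow> derivs D UNIV \<and>
    (\<exists>\<alpha> \<beta>. a < \<alpha> \<and> \<alpha> < \<beta> \<and> \<beta> < b \<and> (\<forall>k x. x \<notin> {\<alpha>..\<beta>} \<longrightarrow> D k x = 0))"

text \<open>On the open complement of the support both \<open>D\<close> and the zero family consist
  of the derivatives of the zero function.\<close>

lemma derivs_vanish:
  assumes "derivs D UNIV" "\<And>x. x \<notin> {\<alpha>..\<beta>} \<Longrightarrow> D 0 x = 0" "x \<notin> {\<alpha>..\<beta>}"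
  shows "D k x = 0"
proof -
  have "nth_deriv k (\<lambda>_. 0) x = (\<lambda>k x. 0) k x"
    by (rule nth_deriv_eqI[OF derivs_zero, of UNIV]) auto
  moreover have "nth_deriv k (\<lambda>_. 0) x = D k x"
    by (rule nth_deriv_eqI[of _ "- {\<alpha>..\<beta>}"])
      (use assms in \<open>auto intro: derivs_subset simp: open_Compl\<close>)
  ultimately show ?thesis by simp
qed

lemma test_functions_testfn:
  assumes "y \<in> test_functions"
  shows "testfn (-1) 1 (\<lambda>k. nth_deriv k y)"
proof -
  obtain \<alpha> \<beta> where ab: "-1 < \<alpha>" "\<alpha> < \<beta>" "\<beta> < 1" "\<And>x. x \<notin> {\<alpha>..\<beta>} \<Longrightarrow> y x = 0"
    using assms unfolding test_functions_def by blast
  have D: "derivs (\<lambda>k. nth_deriv k y) UNIV"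
    using assms unfolding test_functions_def derivs_def
    by (auto simp: nth_deriv_Suc vector_derivative_works[symmetric])
  have "nth_deriv k y x = 0" if "x \<notin> {\<alpha>..\<beta>}" for k x
    by (rule derivs_vanish[OF D _ that]) (use ab in auto)
  with ab D show ?thesis
    unfolding testfn_def by blast
qed

lemma testfn_test_functions:
  assumes "testfn (-1) 1 D"
  shows "D 0 \<in> test_functions" "nth_deriv k (D 0) = D k"
proof -
  have D: "derivs D UNIV" using assms by (simp add: testfn_def)
  show eq: "nth_deriv k (D 0) = D k" for k
    by (rule ext, rule nth_deriv_eqI[OF D]) auto
  have "nth_deriv k (D 0) differentiable at x" for k x
    unfolding eq using derivsD[OF D] by (meson UNIV_I differentiableI_vector)
  then show "D 0 \<in> test_functions"
    using assms unfolding test_functions_def testfn_def by blast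
qed

lemma testfn_derivs: "testfn a b D \<Longrightarrow> derivs D S"
  by (auto simp: testfn_def derivs_def)

lemma testfn_continuous: "testfn a b D \<Longrightarrow> continuous_on S (D k)"
  by (meson derivs_continuous_on testfn_derivs)

lemma testfn_zero_outside: "testfn a b D \<Longrightarrow> x \<le> a \<or> b \<le> x \<Longrightarrow> D k x = 0"
  unfolding testfn_def by force

lemma testfn_mono: "testfn a b D \<Longrightarrow> a' \<le> a \<Longrightarrow> b \<le> b' \<Longrightarrow> testfn a' b' D"
  unfolding testfn_def by force

lemma testfn_shift: "testfn a b D \<Longrightarrow> testfn a b (\<lambda>k. D (k + j))"
  unfolding testfn_def using derivs_shift by blast

lemma testfn_scale: "testfn a b D \<Longrightarrow> testfn a b (\<lambda>k x. c * D k x)"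
  unfolding testfn_def using derivs_scale by fastforce

lemma testfn_add:
  assumes "testfn a b D" "testfn a b E" shows "testfn a b (\<lambda>k x. D k x + E k x)"
proof -
  obtain \<alpha> \<beta> \<alpha>' \<beta>' where 1: "a < \<alpha>" "\<alpha> < \<beta>" "\<beta> < b" "\<And>k x. x \<notin> {\<alpha>..\<beta>} \<Longrightarrow> D k x = 0"
    "a < \<alpha>'" "\<alpha>' < \<beta>'" "\<beta>' < b" "\<And>k x. x \<notin> {\<alpha>'..\<beta>'} \<Longrightarrow> E k x = 0"
    using assms unfolding testfn_def by blast
  have "\<forall>k x. x \<notin> {min \<alpha> \<alpha>'..max \<beta> \<beta>'} \<longrightarrow> D k x + E k x = 0"
    using 1(4,8) by (auto simp: min_def max_def split: if_splits)
  moreover have "a < min \<alpha> \<alpha>'" "min \<alpha> \<alpha>' < max \<beta> \<beta>'" "max \<beta> \<beta>' < b"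
    using 1 by auto
  ultimately show ?thesis
    using derivs_add assms unfolding testfn_def by blast
qed

text \<open>\<open>A\<close> is a derivative family on (a,b) only. That interval and the complement
  of the support of \<open>D\<close> are open and cover the line, so smoothness can be checked on
  each of them separately.\<close>

lemma testfn_leibniz_cutoff:
  assumes "derivs A {a<..<b}" "testfn a b D"
  shows "testfn a b (\<lambda>n x. if x \<in> {a<..<b} then leibniz A D n x else 0)"
proof -
  obtain \<alpha> \<beta> where 1: "a < \<alpha>" "\<alpha> < \<beta>" "\<beta> < b" and z: "\<And>k x. x \<notin> {\<alpha>..\<beta>} \<Longrightarrow> D k x = 0"
    using assms unfolding testfn_def by blast
  let ?E = "\<lambda>n x. if x \<in> {a<..<b} then leibniz A D n x else 0"
  have z': "?E n x = 0" if "x \<notin> {\<alpha>..\<beta>}" for n x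
    using z[OF that] by (simp add: leibniz_def)
  have "derivs (leibniz A D) {a<..<b}"
    by (intro derivs_leibniz assms testfn_derivs[OF assms(2)])
  then have 2: "derivs ?E {a<..<b}"
    by (rule derivs_cong_open) auto
  have "derivs (\<lambda>k x. 0) (- {\<alpha>..\<beta>})" by (rule derivs_zero)
  then have "derivs ?E (- {\<alpha>..\<beta>})"
    by (rule derivs_cong_open) (use z' in auto)
  with 2 have "derivs ?E ({a<..<b} \<union> - {\<alpha>..\<beta>})" by (rule derivs_Un)
  moreover have "{a<..<b} \<union> - {\<alpha>..\<beta>} = UNIV" using 1 by auto
  ultimately have "derivs ?E UNIV" by simp
  then show ?thesis
    unfolding testfn_def using 1 z' by blast
qed

text \<open>Outside (a,b) every term of the Leibniz sum contains a vanishing derivative of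
  \<open>D\<close>, so the cutoff changes nothing, whatever values \<open>A\<close> has
  there.\<close>

lemma testfn_leibniz:
  assumes "derivs A {a<..<b}" "testfn a b D"
  shows "testfn a b (leibniz A D)"
proof -
  have "leibniz A D n x = (if x \<in> {a<..<b} then leibniz A D n x else 0)" for n x
    using testfn_zero_outside[OF assms(2), of x] by (auto simp: leibniz_def not_less)
  then have "leibniz A D = (\<lambda>n x. if x \<in> {a<..<b} then leibniz A D n x else 0)" by blast
  with testfn_leibniz_cutoff[OF assms] show ?thesis by simp
qed

definition reflect :: "(nat \<Rightarrow> real \<Rightarrow> complex) \<Rightarrow> nat \<Rightarrow> real \<Rightarrow> complex"
  where "reflect Y k x = (-1) ^ k * Y k (- x)"

lemma testfn_reflect:
  assumes "testfn a b D"
  shows "testfn (- b) (- a) (reflect D)"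
proof -
  obtain \<alpha> \<beta> where 1: "a < \<alpha>" "\<alpha> < \<beta>" "\<beta> < b" and z: "\<And>k x. x \<notin> {\<alpha>..\<beta>} \<Longrightarrow> D k x = 0"
    using assms unfolding testfn_def by blast
  have "derivs (\<lambda>k x. of_real (-1) ^ k * D k (-1 * x + 0)) UNIV"
    by (rule derivs_affine[OF testfn_derivs[OF assms, of UNIV]]) auto
  then have "derivs (reflect D) UNIV" by (simp add: reflect_def[abs_def])
  moreover have "\<forall>k x. x \<notin> {-\<beta>..-\<alpha>} \<longrightarrow> reflect D k x = 0"
    using z by (auto simp: reflect_def)
  ultimately show ?thesis
    unfolding testfn_def using 1 by (intro conjI exI[of _ "-\<beta>"] exI[of _ "-\<alpha>"]) auto
qed

section \<open>Integration by parts against test functions\<close>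

lemma testfn_mult_continuous:
  assumes D: "testfn a b D" and h: "continuous_on {a<..<b} h"
  shows "continuous_on UNIV (\<lambda>x. D j x * h x)"
proof -
  obtain \<alpha> \<beta> where 1: "a < \<alpha>" "\<alpha> < \<beta>" "\<beta> < b" and z: "\<And>k x. x \<notin> {\<alpha>..\<beta>} \<Longrightarrow> D k x = 0"
    using D unfolding testfn_def by blast
  have "continuous_on {a<..<b} (\<lambda>x. D j x * h x)"
    by (intro continuous_intros h testfn_continuous[OF D])
  moreover have "continuous_on (- {\<alpha>..\<beta>}) (\<lambda>x. D j x * h x)"
    by (rule continuous_on_eq[of _ "\<lambda>_. 0"]) (use z in auto)
  ultimately have "continuous_on ({a<..<b} \<union> - {\<alpha>..\<beta>}) (\<lambda>x. D j x * h x)"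
    by (intro continuous_on_open_Un) (auto simp: open_Compl)
  moreover have "{a<..<b} \<union> - {\<alpha>..\<beta>} = UNIV" using 1 by auto
  ultimately show ?thesis by simp
qed

lemma testfn_mult_integrable:
  assumes "testfn a b D" "continuous_on {a<..<b} h"
  shows "(\<lambda>x. D j x * h x) integrable_on {c..d}"
  by (rule integrable_continuous_real, rule continuous_on_subset[OF testfn_mult_continuous[OF assms]]) auto

lemma testfn_less: "testfn a b D \<Longrightarrow> a < b"
  unfolding testfn_def by force

lemma deriv_imp_continuous_on:
  assumes "\<And>x. x \<in> S \<Longrightarrow> (H has_vector_derivative h x) (at x)"
  shows "continuous_on S H"
  by (meson assms continuous_at_imp_continuous_on has_vector_derivative_continuous)

lemma testfn_ibp_step:
  assumes D: "testfn a b D" and H: "\<And>x. x \<in> {a<..<b} \<Longrightarrow> (H has_vector_derivative h x) (at x)"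
    and h: "continuous_on {a<..<b} h"
  shows "integral {a..b} (\<lambda>x. D (Suc j) x * H x) = - integral {a..b} (\<lambda>x. D j x * h x)"
proof -
  have H': "continuous_on {a<..<b} H"
    by (rule deriv_imp_continuous_on[OF H])
  have "((\<lambda>x. D (Suc j) x * H x + D j x * h x) has_integral D j b * H b - D j a * H a) {a..b}"
  proof (rule fundamental_theorem_of_calculus_interior)
    show "a \<le> b" using testfn_less[OF D] by simp
    show "continuous_on {a..b} (\<lambda>x. D j x * H x)"
      by (rule continuous_on_subset[OF testfn_mult_continuous[OF D H']]) auto
    show "((\<lambda>x. D j x * H x) has_vector_derivative D (Suc j) x * H x + D j x * h x) (at x)"
      if "x \<in> {a<..<b}" for x
      using has_vector_derivative_mult[OF derivsD[OF testfn_derivs[OF D, of UNIV]] H[OF that], of j]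
      by (simp add: add.commute)
  qed
  moreover have "D j b * H b - D j a * H a = 0"
    using testfn_zero_outside[OF D, of b] testfn_zero_outside[OF D, of a] by simp
  ultimately have "integral {a..b} (\<lambda>x. D (Suc j) x * H x + D j x * h x) = 0"
    using integral_unique by metis
  then show ?thesis
    by (subst (asm) Henstock_Kurzweil_Integration.integral_add)
      (auto intro: testfn_mult_integrable[OF D] H' h simp: add_eq_0_iff2)
qed

lemma testfn_ibp:
  assumes D: "testfn a b D"
    and H: "\<And>k x. k < m \<Longrightarrow> x \<in> {a<..<b} \<Longrightarrow> (H k has_vector_derivative H (Suc k) x) (at x)"
    and h: "continuous_on {a<..<b} (H m)"
  shows "integral {a..b} (\<lambda>x. D m x * H 0 x) = (-1) ^ m * integral {a..b} (\<lambda>x. D 0 x * H m x)"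
proof -
  have c: "continuous_on {a<..<b} (H k)" if "k \<le> m" for k
    using that h H by (cases "k = m") (auto intro: deriv_imp_continuous_on[of _ _ "H (Suc k)"])
  have "k \<le> m \<Longrightarrow> integral {a..b} (\<lambda>x. D m x * H 0 x) = (-1) ^ k * integral {a..b} (\<lambda>x. D (m - k) x * H k x)"
    for k
  proof (induction k)
    case (Suc k)
    have "m - k = Suc (m - Suc k)" using Suc.prems by simp
    moreover have "integral {a..b} (\<lambda>x. D (Suc (m - Suc k)) x * H k x) = - integral {a..b} (\<lambda>x. D (m - Suc k) x * H (Suc k) x)"
      using Suc.prems by (intro testfn_ibp_step[OF D H] c) auto
    ultimately show ?case using Suc by simp
  qed simp
  from this[of m] show ?thesis by simp
qed

section \<open>Test functions that are derivatives of test functions\<close>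

lemma antiderivative_real:
  fixes f :: "real \<Rightarrow> complex"
  assumes "continuous_on UNIV f"
  obtains F where "\<And>x. (F has_vector_derivative f x) (at x)"
  using einterval_antiderivative[of "-\<infinity>" "\<infinity>" f] assms by (auto simp: continuous_on_eq_continuous_at)

lemma antiderivative_open_interval:
  fixes f :: "real \<Rightarrow> complex"
  assumes "continuous_on {a<..<b} f" "a < b"
  obtains F where "\<And>x. x \<in> {a<..<b} \<Longrightarrow> (F has_vector_derivative f x) (at x)"
  using einterval_antiderivative[of "ereal a" "ereal b" f] assms by (auto simp: continuous_on_eq_continuous_at)

text \<open>An antiderivative is constant on either side of the support, and the vanishing integral
  makes the two constants equal; subtracting it gives compact support.\<close>

lemma testfn_antideriv:
  assumes D: "testfn a b D" and int: "integral {a..b} (D 0) = 0"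
  shows "\<exists>Y. testfn a b Y \<and> (\<forall>k. Y (Suc k) = D k)"
proof -
  obtain \<alpha> \<beta> where 1: "a < \<alpha>" "\<alpha> < \<beta>" "\<beta> < b" and z: "\<And>k x. x \<notin> {\<alpha>..\<beta>} \<Longrightarrow> D k x = 0"
    using D unfolding testfn_def by blast
  obtain F where F: "\<And>x. (F has_vector_derivative D 0 x) (at x)"
    using antiderivative_real[OF testfn_continuous[OF D]] by blast
  have FT: "(D 0 has_integral F v - F u) {u..v}" if "u \<le> v" for u v
    by (rule fundamental_theorem_of_calculus[OF that]) (auto intro: has_vector_derivative_at_within[OF F])
  have const: "F v = F u" if "u \<le> v" "\<And>t. u \<le> t \<Longrightarrow> t \<le> v \<Longrightarrow> t \<notin> {\<alpha>..\<beta>}" for u v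
  proof -
    have "(D 0 has_integral 0) {u..v}"
      by (rule has_integral_is_0) (use that z in auto)
    from has_integral_unique[OF FT[OF that(1)] this] show ?thesis
      by simp
  qed
  have ab: "F b = F a"
    using integral_unique[OF FT[OF less_imp_le[OF testfn_less[OF D]]]] int by simp
  define Y where "Y k = (case k of 0 \<Rightarrow> \<lambda>x. F x - F a | Suc j \<Rightarrow> D j)" for k
  have "(Y k has_vector_derivative Y (Suc k) x) (at x)" for k x
    using F derivsD[OF testfn_derivs[OF D, of UNIV]]
    by (cases k) (auto simp: Y_def intro!: derivative_eq_intros)
  then have "derivs Y UNIV" by (simp add: derivs_def)
  moreover have "Y k x = 0" if "x \<notin> {\<alpha>..\<beta>}" for k x
  proof (cases k)
    case 0
    have "F x = F a"
    proof (cases "x < \<alpha>")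
      case True
      then show ?thesis using const[of x a] const[of a x] 1 by (cases "x \<le> a") auto
    next
      case False
      then have "x > \<beta>" using that by auto
      then have "F x = F b" using const[of x b] const[of b x] 1 by (cases "x \<le> b") auto
      then show ?thesis using ab by simp
    qed
    with 0 show ?thesis by (simp add: Y_def)
  next
    case (Suc j)
    then show ?thesis using z[OF that] by (simp add: Y_def)
  qed
  ultimately have "testfn a b Y" unfolding testfn_def using 1 by blast
  moreover have "Y (Suc k) = D k" for k by (simp add: Y_def)
  ultimately show ?thesis by blast
qed

text \<open>Orthogonality to the polynomials of degree below \<open>m\<close> characterizes the
  \<open>m\<close>-th derivatives of test functions.\<close>

lemma testfn_antideriv_iter:
  assumes "testfn a b D" "\<And>k. k < m \<Longrightarrow> integral {a..b} (\<lambda>x. D 0 x * of_real x ^ k) = 0"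
  shows "\<exists>Y. testfn a b Y \<and> (\<forall>k. Y (k + m) = D k)"
  using assms
proof (induction m arbitrary: D)
  case 0
  then show ?case by auto
next
  case (Suc m)
  have "integral {a..b} (D 0) = 0" using Suc.prems(2)[of 0] by simp
  from testfn_antideriv[OF Suc.prems(1) this]
  obtain Y where Y: "testfn a b Y" "\<And>k. Y (Suc k) = D k" by blast
  \<comment> \<open>By parts, the moment of order k + 1 of \<open>D 0\<close>, the derivative of
    \<open>Y 0\<close>, is -(k + 1) times the moment of order k of \<open>Y 0\<close>.\<close>
  have "integral {a..b} (\<lambda>x. Y 0 x * of_real x ^ k) = 0" if "k < m" for k
  proof -
    have "((\<lambda>x. complex_of_real x ^ Suc k) has_vector_derivative of_nat (Suc k) * of_real x ^ k) (at x)" for x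
      using has_vector_derivative_real_field[OF DERIV_power_Suc[OF DERIV_ident, of k]]
      by (simp add: add.commute)
    then have "integral {a..b} (\<lambda>x. Y (Suc 0) x * of_real x ^ Suc k)
        = - integral {a..b} (\<lambda>x. Y 0 x * (of_nat (Suc k) * of_real x ^ k))"
      by (intro testfn_ibp_step[OF Y(1)] continuous_intros)
    moreover have "integral {a..b} (\<lambda>x. Y (Suc 0) x * of_real x ^ Suc k) = 0"
      unfolding Y using Suc.prems(2)[of "Suc k"] that by simp
    moreover have "integral {a..b} (\<lambda>x. Y 0 x * (of_nat (Suc k) * of_real x ^ k))
       = of_nat (Suc k) * integral {a..b} (\<lambda>x. Y 0 x * of_real x ^ k)"
      unfolding integral_mult_right[symmetric] by (simp add: mult_ac)
    ultimately show ?thesis by (simp del: of_nat_Suc)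
  qed
  from Suc.IH[OF Y(1) this] obtain X where X: "testfn a b X" "\<And>k. X (k + m) = Y k" by blast
  have "X (k + Suc m) = D k" for k using X(2)[of "Suc k"] Y(2) by simp
  with X(1) show ?case by blast
qed

text \<open>If \<open>f a\<close> already vanishes on the common kernel of the other functionals, it
  can be left out. Otherwise some \<open>E\<close> is annihilated by all of them except
  \<open>f a\<close>, and subtracting a suitable multiple of \<open>f a\<close> from
  \<open>l\<close> reduces to the smaller family.\<close>

lemma linear_dependence_functionals:
  fixes f :: "'i \<Rightarrow> (nat \<Rightarrow> real \<Rightarrow> complex) \<Rightarrow> complex"
  assumes "finite I"
    and add: "\<And>D E. D \<in> T \<Longrightarrow> E \<in> T \<Longrightarrow> (\<lambda>k x. D k x + E k x) \<in> T"
    and scale: "\<And>c D. D \<in> T \<Longrightarrow> (\<lambda>k x. c * D k x) \<in> T"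
    and fl: "\<And>i D E c. i \<in> I \<Longrightarrow> D \<in> T \<Longrightarrow> E \<in> T \<Longrightarrow> f i (\<lambda>k x. D k x + c * E k x) = f i D + c * f i E"
    and ll: "\<And>D E c. D \<in> T \<Longrightarrow> E \<in> T \<Longrightarrow> l (\<lambda>k x. D k x + c * E k x) = l D + c * l E"
    and ker: "\<And>D. D \<in> T \<Longrightarrow> (\<And>i. i \<in> I \<Longrightarrow> f i D = 0) \<Longrightarrow> l D = 0"
  shows "\<exists>P. \<forall>D\<in>T. l D = (\<Sum>i\<in>I. P i * f i D)"
  using \<open>finite I\<close> fl ll ker
proof (induction I arbitrary: l rule: finite_induct)
  case empty
  then show ?case by auto
next
  case (insert a I)
  show ?case
  proof (cases "\<forall>D\<in>T. (\<forall>i\<in>I. f i D = 0) \<longrightarrow> f a D = 0")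
    case True
    then have "\<exists>P. \<forall>D\<in>T. l D = (\<Sum>i\<in>I. P i * f i D)"
    proof (intro insert.IH)
      fix D assume "D \<in> T" "\<And>i. i \<in> I \<Longrightarrow> f i D = 0"
      with True show "l D = 0" by (intro insert.prems(3)) auto
    qed (use insert.prems in auto)
    then obtain P where P: "\<forall>D\<in>T. l D = (\<Sum>i\<in>I. P i * f i D)" by blast
    have "\<forall>D\<in>T. l D = (\<Sum>i\<in>insert a I. (P(a := 0)) i * f i D)"
      using insert.hyps P by (auto intro!: sum.cong)
    then show ?thesis by blast
  next
    case False
    then obtain E where E: "E \<in> T" "\<And>i. i \<in> I \<Longrightarrow> f i E = 0" "f a E \<noteq> 0" by blast
    define c where "c = l E / f a E"
    have "\<exists>P. \<forall>D\<in>T. l D - c * f a D = (\<Sum>i\<in>I. P i * f i D)"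
    proof (rule insert.IH)
      fix D assume D: "D \<in> T" "\<And>i. i \<in> I \<Longrightarrow> f i D = 0"
      \<comment> \<open>The multiple of \<open>E\<close> moves \<open>D\<close> into the kernel of
        \<open>f a\<close> without leaving the kernels of the others.\<close>
      let ?D = "\<lambda>k x. D k x + (- f a D / f a E) * E k x"
      have "?D \<in> T" using D(1) E(1) by (intro add scale)
      moreover have "f i ?D = 0" if "i \<in> insert a I" for i
        using insert.prems(1)[OF that D(1) E(1), of "- f a D / f a E"] D(2) E(2,3) that by auto
      ultimately have "l ?D = 0" by (rule insert.prems(3))
      then show "l D - c * f a D = 0"
        using insert.prems(2)[OF D(1) E(1), of "- f a D / f a E"] E(3) by (simp add: c_def field_simps)
    qed (use insert.prems in \<open>auto simp: algebra_simps\<close>)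
    then obtain P where P: "\<forall>D\<in>T. l D - c * f a D = (\<Sum>i\<in>I. P i * f i D)" by blast
    have "\<forall>D\<in>T. l D = (\<Sum>i\<in>insert a I. (P(a := c)) i * f i D)"
    proof
      fix D assume "D \<in> T"
      with P have "l D - c * f a D = (\<Sum>i\<in>I. P i * f i D)" by blast
      then have "l D = c * f a D + (\<Sum>i\<in>I. P i * f i D)" by (simp add: diff_eq_eq add.commute)
      also have "(\<Sum>i\<in>I. P i * f i D) = (\<Sum>i\<in>I. (P(a := c)) i * f i D)"
        using insert.hyps by (intro sum.cong) auto
      finally show "l D = (\<Sum>i\<in>insert a I. (P(a := c)) i * f i D)"
        using insert.hyps by simp
    qed
    then show ?thesis by blast
  qed
qed

text \<open>The lemma of du Bois-Reymond in terms of functionals: what annihilates all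
  \<open>m\<close>-th derivatives of test functions is integration against a polynomial of degree
  below \<open>m\<close>. It supplies the integration constants of a weak solution, once for
  \<open>V\<close> and once for \<open>Z\<close>.\<close>

lemma functional_vanishing_on_derivatives:
  fixes l :: "(nat \<Rightarrow> real \<Rightarrow> complex) \<Rightarrow> complex"
  assumes lin: "\<And>D E c. testfn a b D \<Longrightarrow> testfn a b E \<Longrightarrow> l (\<lambda>k x. D k x + c * E k x) = l D + c * l E"
    and van: "\<And>Y. testfn a b Y \<Longrightarrow> l (\<lambda>k. Y (k + m)) = 0"
  shows "\<exists>P. \<forall>D. testfn a b D \<longrightarrow> l D = (\<Sum>k<m. P k * integral {a..b} (\<lambda>x. D 0 x * of_real x ^ k))"
proof -
  have i: "(\<lambda>x. D 0 x * of_real x ^ k) integrable_on {a..b}" if "testfn a b D" for D k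
    by (rule testfn_mult_integrable[OF that]) (intro continuous_intros)
  have "\<exists>P. \<forall>D\<in>{D. testfn a b D}. l D = (\<Sum>k\<in>{..<m}. P k * integral {a..b} (\<lambda>x. D 0 x * of_real x ^ k))"
  proof (rule linear_dependence_functionals)
    show "l D = 0" if "D \<in> {D. testfn a b D}"
      "\<And>k. k \<in> {..<m} \<Longrightarrow> integral {a..b} (\<lambda>x. D 0 x * of_real x ^ k) = 0" for D
    proof -
      have "\<exists>Y. testfn a b Y \<and> (\<forall>k. Y (k + m) = D k)"
        by (rule testfn_antideriv_iter) (use that in auto)
      then obtain Y where Y: "testfn a b Y" "\<And>k. Y (k + m) = D k" by blast
      then show ?thesis using van[OF Y(1)] by simp
    qed
    fix D E :: "nat \<Rightarrow> real \<Rightarrow> complex" and c k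
    assume DE: "D \<in> {D. testfn a b D}" "E \<in> {D. testfn a b D}"
    have "integral {a..b} (\<lambda>x. (D 0 x + c * E 0 x) * of_real x ^ k) =
      integral {a..b} (\<lambda>x. D 0 x * of_real x ^ k + c * (E 0 x * of_real x ^ k))"
      by (simp add: algebra_simps)
    also have "\<dots> = integral {a..b} (\<lambda>x. D 0 x * of_real x ^ k) + c * integral {a..b} (\<lambda>x. E 0 x * of_real x ^ k)"
      using DE by (subst Henstock_Kurzweil_Integration.integral_add)
        (auto intro!: i integrable_on_mult_right)
    finally show "integral {a..b} (\<lambda>x. (D 0 x + c * E 0 x) * of_real x ^ k) =
      integral {a..b} (\<lambda>x. D 0 x * of_real x ^ k) + c * integral {a..b} (\<lambda>x. E 0 x * of_real x ^ k)" .
  qed (auto intro: testfn_add testfn_scale lin)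
  then show ?thesis by auto
qed

section \<open>Smooth bumps and plateaus\<close>

fun bump_poly :: "nat \<Rightarrow> real poly"
  where "bump_poly 0 = 1"
  | "bump_poly (Suc k) = [:0, 0, 1:] * (bump_poly k - pderiv (bump_poly k))"

text \<open>The k-th derivative of exp(-1/x), extended by 0. In t = 1/x, whose derivative is -t^2,
  differentiation turns P(t) exp(-t) into t^2 (P(t) - P'(t)) exp(-t), which is the recursion of
  \<open>bump_poly\<close>.\<close>

definition bump :: "nat \<Rightarrow> real \<Rightarrow> real"
  where "bump k x = (if 0 < x then poly (bump_poly k) (1 / x) * exp (- (1 / x)) else 0)"

lemma poly_times_exp_tendsto_0: "((\<lambda>t::real. poly p t * exp (- t)) \<longlongrightarrow> 0) at_top"
proof -
  have "((\<lambda>t. \<Sum>i\<le>degree p. coeff p i * (t ^ i / exp t)) \<longlongrightarrow> (\<Sum>i\<le>degree p. coeff p i * 0)) at_top"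
    by (intro tendsto_sum tendsto_mult tendsto_const tendsto_power_div_exp_0)
  then show ?thesis
    by (simp add: poly_altdef sum_distrib_right exp_minus divide_inverse mult.assoc)
qed

lemma DERIV_bump: "(bump k has_field_derivative bump (Suc k) x) (at x)"
proof -
  consider "x > 0" | "x < 0" | "x = 0" by linarith
  then show ?thesis
  proof cases
    case 1
    have "((\<lambda>x. poly (bump_poly k) (1 / x) * exp (- (1 / x))) has_field_derivative bump (Suc k) x) (at x)"
      using 1 by (auto intro!: derivative_eq_intros DERIV_chain2[OF poly_DERIV]
          simp: bump_def field_simps power2_eq_square)
    then show ?thesis
      by (rule has_field_derivative_transform_within_open[of _ _ _ "{0<..}"])
        (use 1 in \<open>auto simp: bump_def\<close>)
  next
    case 2
    have "((\<lambda>x. 0) has_field_derivative bump (Suc k) x) (at x)"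
      using 2 by (auto simp: bump_def)
    then show ?thesis
      by (rule has_field_derivative_transform_within_open[of _ _ _ "{..<0}"])
        (use 2 in \<open>auto simp: bump_def\<close>)
  next
    case 3
    \<comment> \<open>In t = 1/h the right difference quotient at 0 is t times the polynomial times
      exp(-t), so it tends to 0 for every k.\<close>
    have "((\<lambda>t. poly ([:0, 1:] * bump_poly k) t * exp (- t)) \<longlongrightarrow> 0) at_top"
      by (rule poly_times_exp_tendsto_0)
    then have "((\<lambda>h. poly ([:0, 1:] * bump_poly k) (inverse h) * exp (- inverse h)) \<longlongrightarrow> 0) (at_right 0)"
      by (rule filterlim_compose) (rule filterlim_inverse_at_top_right)
    then have r: "((\<lambda>h. bump k h / h) \<longlongrightarrow> 0) (at_right 0)"
      by (rule Lim_transform_eventually)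
        (auto simp: bump_def eventually_at_filter field_simps intro!: always_eventually)
    have l: "((\<lambda>h. bump k h / h) \<longlongrightarrow> 0) (at_left 0)"
      by (rule Lim_transform_eventually[OF tendsto_const])
        (auto simp: bump_def eventually_at_filter intro!: always_eventually)
    have "((\<lambda>h. bump k h / h) \<longlongrightarrow> 0) (at 0)"
      using l r by (simp add: filterlim_at_split)
    then show ?thesis
      using 3 by (simp add: DERIV_def bump_def)
  qed
qed

lemma derivs_bump: "derivs (\<lambda>k x. of_real (bump k x)) S"
  unfolding derivs_def
  by (auto intro!: has_vector_derivative_of_real simp: DERIV_bump has_real_derivative_iff_has_vector_derivative[symmetric])

lemma bump_0: "bump 0 x = (if 0 < x then exp (- (1 / x)) else 0)"
  by (simp add: bump_def)

text \<open>The derivative family of exp(-1/(n(x - a))) exp(-1/(n(b - x))) on (a,b), extended by 0.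
  The support does not grow with n, the values stay in [0,1], and the limit is the indicator of
  (a,b).\<close>

definition plateau :: "real \<Rightarrow> real \<Rightarrow> nat \<Rightarrow> nat \<Rightarrow> real \<Rightarrow> complex"
  where "plateau a b n = leibniz
    (\<lambda>k x. of_real (real n) ^ k * of_real (bump k (real n * x + (- real n * a))))
    (\<lambda>k x. of_real (- real n) ^ k * of_real (bump k (- real n * x + real n * b)))"

lemma plateau_0: "plateau a b n 0 x = of_real (bump 0 (real n * (x - a)) * bump 0 (real n * (b - x)))"
  by (simp add: plateau_def algebra_simps)

lemma testfn_plateau:
  assumes "lo < a" "a < b" "b < hi"
  shows "testfn lo hi (plateau a b n)"
proof -
  have "derivs (plateau a b n) UNIV"
    unfolding plateau_def
    by (intro derivs_leibniz derivs_affine[OF derivs_bump[of UNIV]]) auto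
  moreover have "plateau a b n k x = 0" if "x \<notin> {a..b}" for k x
  proof -
    have "real n * x + (- real n * a) \<le> 0 \<or> - real n * x + real n * b \<le> 0"
      using that by (auto simp: mult_left_mono)
    then show ?thesis
      unfolding plateau_def leibniz_def bump_def by auto
  qed
  ultimately show ?thesis
    unfolding testfn_def using assms by blast
qed

lemma bump_bounds: "0 \<le> bump 0 x" "bump 0 x \<le> 1"
  by (auto simp: bump_0)

lemma bump_scaled_tendsto:
  assumes "x > 0" shows "(\<lambda>n. bump 0 (real n * x)) \<longlonglongrightarrow> 1"
proof -
  have "(\<lambda>n. exp (- (1 / x * inverse (real n)))) \<longlonglongrightarrow> exp (- (1 / x * 0))"
    by (intro tendsto_intros lim_inverse_n)
  then have 1: "(\<lambda>n. exp (- (1 / x * inverse (real n)))) \<longlonglongrightarrow> 1" by simp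
  show ?thesis
    by (rule Lim_transform_eventually[OF 1], rule eventually_mono[OF eventually_gt_at_top[of 0]])
      (use assms in \<open>auto simp: bump_0 field_simps\<close>)
qed

lemma plateau_tendsto: "(\<lambda>n. plateau a b n 0 x) \<longlonglongrightarrow> (if x \<in> {a<..<b} then 1 else 0)"
proof (cases "x \<in> {a<..<b}")
  case True
  then have "(\<lambda>n. of_real (bump 0 (real n * (x - a)) * bump 0 (real n * (b - x)))) \<longlonglongrightarrow> complex_of_real (1 * 1)"
    by (intro tendsto_intros bump_scaled_tendsto) auto
  then show ?thesis using True by (simp add: plateau_0)
next
  case False
  then have "plateau a b n 0 x = 0" for n
    unfolding plateau_0 bump_0 by (auto simp: zero_less_mult_iff)
  moreover have "(if x \<in> {a<..<b} then 1 else 0) = (0 :: complex)"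
    using False by (simp only: if_False)
  ultimately show ?thesis by (simp only: tendsto_const)
qed

lemma norm_plateau_le: "norm (plateau a b n 0 x) \<le> 1"
  unfolding plateau_0 norm_of_real abs_mult
  using bump_bounds by (auto intro!: mult_le_one simp: abs_of_nonneg)

section \<open>The fundamental lemma for integrable functions\<close>

lemma continuous_mult_absolutely_integrable:
  fixes f g :: "real \<Rightarrow> complex"
  assumes "continuous_on {a..b} g" "f absolutely_integrable_on {a..b}"
  shows "(\<lambda>x. g x * f x) absolutely_integrable_on {a..b}"
proof (rule absolutely_integrable_bounded_measurable_product[where h="(*)"])
  show "bilinear ((*) :: complex \<Rightarrow> _)" by (rule bilinear_times)
  show "g \<in> borel_measurable (lebesgue_on {a..b})"
    by (rule continuous_imp_measurable_on_sets_lebesgue[OF assms(1)]) auto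
  show "bounded (g ` {a..b})"
    by (intro compact_imp_bounded compact_continuous_image assms(1) compact_Icc)
qed (use assms in auto)

text \<open>Plateaus and dominated convergence give integral 0 over every compact subinterval of the
  interior; continuity of the indefinite integral adds the endpoints, and Lebesgue differentiation
  returns to \<open>f\<close>.\<close>

lemma weakly_zero_imp_negligible:
  fixes f :: "real \<Rightarrow> complex"
  assumes lohi: "lo < hi" and f: "f absolutely_integrable_on {lo..hi}"
    and weak: "\<And>D. testfn lo hi D \<Longrightarrow> integral {lo..hi} (\<lambda>x. D 0 x * f x) = 0"
  obtains N where "negligible N" "\<And>x. x \<in> {lo..hi} - N \<Longrightarrow> f x = 0"
proof -
  have fi: "f integrable_on {lo..hi}" using f absolutely_integrable_on_def by blast
  have sub: "f integrable_on {a..b}" if "lo \<le> a" "b \<le> hi" for a b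
    by (rule integrable_on_subinterval[OF fi]) (use that in auto)
  have open0: "integral {a..b} f = 0" if ab: "lo < a" "a < b" "b < hi" for a b
  proof -
    let ?g = "\<lambda>x. (if x \<in> {a<..<b} then 1 else 0) * f x"
    have "(\<lambda>n. integral {lo..hi} (\<lambda>x. plateau a b n 0 x * f x)) \<longlonglongrightarrow> integral {lo..hi} ?g"
    proof (rule dominated_convergence(2))
      show "(\<lambda>x. plateau a b n 0 x * f x) integrable_on {lo..hi}" for n
        using continuous_mult_absolutely_integrable[OF testfn_continuous[OF testfn_plateau[OF ab]] f]
        by (simp add: absolutely_integrable_on_def)
      show "(\<lambda>x. norm (f x)) integrable_on {lo..hi}"
        using f by (simp add: absolutely_integrable_on_def)
      show "norm (plateau a b n 0 x * f x) \<le> norm (f x)" for n x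
        using mult_right_mono[OF norm_plateau_le norm_ge_zero, of a b n x "f x"] by (simp add: norm_mult)
      show "(\<lambda>n. plateau a b n 0 x * f x) \<longlonglongrightarrow> ?g x" for x
        by (intro tendsto_mult plateau_tendsto tendsto_const)
    qed
    moreover have "integral {lo..hi} (\<lambda>x. plateau a b n 0 x * f x) = 0" for n
      by (rule weak[OF testfn_plateau[OF ab]])
    ultimately have "integral {lo..hi} ?g = 0"
      by (simp add: LIMSEQ_const_iff)
    moreover have "integral {lo..hi} ?g = integral {lo..hi} (\<lambda>x. if x \<in> {a..b} then f x else 0)"
      by (rule integral_spike[of "{a, b}"]) auto
    moreover have "\<dots> = integral {a..b} f"
      using ab by (subst integral_restrict_Int) (auto simp: min_def max_def)
    ultimately show ?thesis by simp
  qed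
  define F where "F x = integral {lo..x} f" for x
  have Fc: "continuous_on {lo..hi} F"
    unfolding F_def by (rule indefinite_integral_continuous_1[OF fi])
  have F_eq: "F y = F x" if "lo < x" "x \<le> y" "y < hi" for x y
  proof (cases "x = y")
    case False
    have "F y = F x + integral {x..y} f"
      unfolding F_def using that
      by (intro Henstock_Kurzweil_Integration.integral_combine[symmetric] sub) auto
    then show ?thesis using open0[of x y] that False by simp
  qed auto
  have F0: "F x = 0" if "x \<in> {lo..hi}" for x
  proof -
    let ?mid = "(lo + hi) / 2"
    have mid: "F x = F ?mid" if "x \<in> {lo<..<hi}" for x
      using F_eq[of x ?mid] F_eq[of ?mid x] that lohi by (cases "x \<le> ?mid") auto
    have "F x = F ?mid" if "x \<in> {lo..hi}" for x
      by (rule continuous_constant_on_closure[of "{lo<..<hi}" F, OF _ mid]) (use Fc that lohi in simp_all)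
    from this[OF that] this[of lo] lohi have "F x = F lo" by simp
    then show ?thesis by (simp add: F_def)
  qed
  have sub0: "integral {a..b} f = 0" if "lo \<le> a" "a \<le> b" "b \<le> hi" for a b
  proof -
    have "F b = F a + integral {a..b} f"
      unfolding F_def using that
      by (intro Henstock_Kurzweil_Integration.integral_combine[symmetric] sub) auto
    then show ?thesis using F0[of a] F0[of b] that by simp
  qed
  \<comment> \<open>The extension by 0 is integrable on every interval, as the differentiation
    theorem requires, and its integrals all vanish.\<close>
  define g where "g x = (if x \<in> {lo..hi} then f x else 0)" for x
  have gI: "integral (cbox a b) g = 0" "g integrable_on cbox a b" for a b
  proof -
    have 1: "{lo..hi} \<inter> cbox a b = {max lo a..min hi b}" by auto
    have "g integrable_on cbox a b \<longleftrightarrow> f integrable_on ({lo..hi} \<inter> cbox a b)"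
      unfolding g_def by (subst integrable_restrict_Int) (simp add: Int_commute)
    then show "g integrable_on cbox a b" unfolding 1 by (simp add: sub)
    have "integral (cbox a b) g = integral ({lo..hi} \<inter> cbox a b) f"
      unfolding g_def by (subst integral_restrict_Int) (simp add: Int_commute)
    also have "\<dots> = 0"
      unfolding 1 using sub0[of "max lo a" "min hi b"] by (cases "max lo a \<le> min hi b") auto
    finally show "integral (cbox a b) g = 0" .
  qed
  \<comment> \<open>Off a null set the averages over [x, x + h] converge to \<open>g x\<close>; here
    all of them are 0.\<close>
  obtain N where N: "negligible N" "\<And>x e. \<lbrakk>x \<notin> N; 0 < e\<rbrakk> \<Longrightarrow>
      \<exists>d>0. \<forall>h. 0 < h \<and> h < d \<longrightarrow> norm (integral (cbox x (x + h *\<^sub>R One)) g /\<^sub>R h ^ DIM(real) - g x) < e"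
    using integrable_ccontinuous_explicit[OF gI(2)] by blast
  have "f x = 0" if "x \<in> {lo..hi} - N" for x
  proof (rule ccontr)
    assume "f x \<noteq> 0"
    then have "\<exists>d>0. \<forall>h. 0 < h \<and> h < d \<longrightarrow> norm (integral {x..x + h} g /\<^sub>R h - g x) < norm (f x)"
      using N(2)[of x "norm (f x)"] that by simp
    then obtain d where d: "d > 0" "\<forall>h. 0 < h \<and> h < d \<longrightarrow>
        norm (integral {x..x + h} g /\<^sub>R h - g x) < norm (f x)" by blast
    from d(2)[rule_format, of "d / 2"] d(1) that show False
      using gI(1)[of x "x + d / 2"] by (simp add: g_def)
  qed
  with N(1) that show thesis by blast
qed

section \<open>Weighted estimates for antiderivatives\<close>

lemma norm_diff_le_antiderivative:
  fixes F :: "real \<Rightarrow> complex"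
  assumes "a \<le> b" "\<And>x. x \<in> {a..b} \<Longrightarrow> (F has_vector_derivative f x) (at x)"
    "\<And>x. x \<in> {a..b} \<Longrightarrow> (\<phi> has_real_derivative \<phi>' x) (at x)"
    "\<And>x. x \<in> {a..b} \<Longrightarrow> norm (f x) \<le> \<phi>' x"
  shows "norm (F b - F a) \<le> \<phi> b - \<phi> a"
proof (cases "a = b")
  case False
  show ?thesis
  proof (rule differentiable_bound_general[where f'=f and \<phi>'=\<phi>'])
    show "continuous_on {a..b} F" "continuous_on {a..b} \<phi>"
      using assms(2,3) by (meson continuous_at_imp_continuous_on has_vector_derivative_continuous
          DERIV_isCont)+
  qed (use assms False in \<open>auto simp: has_real_derivative_iff_has_vector_derivative[symmetric]\<close>)
qed simp

text \<open>An indefinite Lebesgue integral need not be differentiable everywhere, so integration by parts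
  is obtained by telescoping an estimate that is quadratic in the mesh of a partition.\<close>

lemma testfn_ibp_L1:
  assumes D: "testfn 0 1 D" and f: "f absolutely_integrable_on {0..1}"
  shows "integral {0..1} (\<lambda>x. D j x * f x) = - integral {0..1} (\<lambda>x. D (Suc j) x * integral {0..x} f)"
proof -
  have fi: "f integrable_on {0..1}" and nfi: "(\<lambda>x. norm (f x)) integrable_on {0..1}"
    using f by (auto simp: absolutely_integrable_on_def)
  define F where "F x = integral {0..x} f" for x
  define \<Phi> where "\<Phi> x = integral {0..x} (\<lambda>x. norm (f x))" for x
  have Fc: "continuous_on {0..1} F"
    unfolding F_def by (rule indefinite_integral_continuous_1[OF fi])
  have gfi: "(\<lambda>x. D j x * f x) integrable_on {0..1}"
    using continuous_mult_absolutely_integrable[OF testfn_continuous[OF D] f]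
    by (simp add: absolutely_integrable_on_def)
  have gFi: "(\<lambda>x. D (Suc j) x * F x) integrable_on {0..1}"
    by (intro integrable_continuous_real continuous_intros testfn_continuous[OF D] Fc)
  define K where "K x = integral {0..x} (\<lambda>t. D j t * f t + D (Suc j) t * F t)" for x
  have Ki: "(\<lambda>t. D j t * f t + D (Suc j) t * F t) integrable_on {0..1}"
    by (intro integrable_add gfi gFi)
  have sub: "h integrable_on {u..v}" if "h integrable_on {0..1}" "0 \<le> u" "v \<le> 1" for h :: "real \<Rightarrow> 'a::euclidean_space" and u v
    by (rule integrable_on_subinterval[OF that(1)]) (use that in auto)
  have comb: "integral {0..v} h = integral {0..u} h + integral {u..v} h"
    if "h integrable_on {0..1}" "0 \<le> u" "u \<le> v" "v \<le> 1" for h :: "real \<Rightarrow> 'a::euclidean_space" and u v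
    by (rule Henstock_Kurzweil_Integration.integral_combine[symmetric, OF that(2,3) sub[OF that(1) order_refl that(4)]])
  have "compact (D (Suc j) ` {0..1})"
    by (intro compact_continuous_image testfn_continuous[OF D] compact_Icc)
  then have "bounded (D (Suc j) ` {0..1})" by (rule compact_imp_bounded)
  then obtain L where L: "L > 0" "\<And>x. x \<in> {0..1} \<Longrightarrow> norm (D (Suc j) x) \<le> L"
    unfolding bounded_pos by blast
  have Phi_mono: "\<Phi> u \<le> \<Phi> v" if "0 \<le> u" "u \<le> v" "v \<le> 1" for u v
    using comb[OF nfi that] by (simp add: \<Phi>_def integral_nonneg sub[OF nfi that(1,3)])
  have F_diff: "norm (F v - F u) \<le> \<Phi> v - \<Phi> u" if "0 \<le> u" "u \<le> v" "v \<le> 1" for u v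
  proof -
    have "norm (integral {u..v} f) \<le> integral {u..v} (\<lambda>x. norm (f x))"
      by (rule integral_norm_bound_integral[OF sub[OF fi that(1,3)] sub[OF nfi that(1,3)]]) auto
    then show ?thesis using comb[OF fi that] comb[OF nfi that] by (simp add: F_def \<Phi>_def)
  qed
  have g_diff: "norm (D j v - D j u) \<le> L * (v - u)" if "0 \<le> u" "u \<le> v" "v \<le> 1" for u v
  proof -
    have "norm (D j v - D j u) \<le> L * v - L * u"
    proof (rule norm_diff_le_antiderivative[OF that(2), where f="D (Suc j)" and \<phi>'="\<lambda>_. L"])
      show "(D j has_vector_derivative D (Suc j) x) (at x)" for x
        by (rule derivsD[OF testfn_derivs[OF D, of UNIV]]) simp
    qed (use L that in \<open>auto intro!: derivative_eq_intros\<close>)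
    then show ?thesis by (simp add: algebra_simps)
  qed
  \<comment> \<open>The defect of the product rule for \<open>D j\<close> and \<open>F\<close>.
    Since \<open>D j\<close> vanishes at 0 and 1, equal values of \<open>W\<close> at both ends mean
    \<open>K 1 = 0\<close>, which is the claim.\<close>
  define W where "W x = D j x * F x - K x" for x
  have est: "norm (W v - W u) \<le> 2 * L * (v - u) * (\<Phi> v - \<Phi> u)" if uv: "0 \<le> u" "u \<le> v" "v \<le> 1" for u v
  proof -
    have i1: "(\<lambda>t. (D j v - D j t) * f t) integrable_on {u..v}"
    proof -
      have "(\<lambda>t. D j v * f t - D j t * f t) integrable_on {u..v}"
        by (intro integrable_diff integrable_on_mult_right sub[OF _ uv(1,3)] fi gfi)
      then show ?thesis by (simp add: algebra_simps)
    qed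
    have i2: "(\<lambda>t. D (Suc j) t * (F u - F t)) integrable_on {u..v}"
      by (intro integrable_continuous_real continuous_intros testfn_continuous[OF D]
          continuous_on_subset[OF Fc]) (use uv in auto)
    have "((D (Suc j)) has_integral (D j v - D j u)) {u..v}"
      by (rule fundamental_theorem_of_calculus[OF uv(2)])
        (auto intro: has_vector_derivative_at_within derivsD[OF testfn_derivs[OF D, of UNIV]])
    then have gu: "integral {u..v} (\<lambda>t. D (Suc j) t * F u) = (D j v - D j u) * F u"
      by (intro integral_unique has_integral_mult_left)
    have "W v - W u = D j v * (F v - F u) + (D j v - D j u) * F u - (K v - K u)"
      by (simp add: W_def algebra_simps)
    also have "K v - K u = integral {u..v} (\<lambda>t. D j t * f t) + integral {u..v} (\<lambda>t. D (Suc j) t * F t)"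
      unfolding K_def comb[OF Ki uv]
      by (simp add: Henstock_Kurzweil_Integration.integral_add[OF sub[OF gfi uv(1,3)] sub[OF gFi uv(1,3)]])
    also have "D j v * (F v - F u) = integral {u..v} (\<lambda>t. D j v * f t)"
      using comb[OF fi uv] by (simp add: F_def)
    finally have "W v - W u = (integral {u..v} (\<lambda>t. D j v * f t) - integral {u..v} (\<lambda>t. D j t * f t))
       + (integral {u..v} (\<lambda>t. D (Suc j) t * F u) - integral {u..v} (\<lambda>t. D (Suc j) t * F t))"
      unfolding gu by simp
    also have "\<dots> = integral {u..v} (\<lambda>t. (D j v - D j t) * f t) + integral {u..v} (\<lambda>t. D (Suc j) t * (F u - F t))"
    proof -
      have 1: "(\<lambda>t. D (Suc j) t * F u) integrable_on {u..v}"
        by (intro integrable_continuous_real continuous_intros testfn_continuous[OF D])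
      show ?thesis
        using Henstock_Kurzweil_Integration.integral_diff[OF integrable_on_mult_right[OF sub[OF fi uv(1,3)], of "D j v"]
            sub[OF gfi uv(1,3)]]
          Henstock_Kurzweil_Integration.integral_diff[OF 1 sub[OF gFi uv(1,3)]]
        by (simp add: left_diff_distrib right_diff_distrib)
    qed
    finally have eq: "W v - W u = integral {u..v} (\<lambda>t. (D j v - D j t) * f t)
      + integral {u..v} (\<lambda>t. D (Suc j) t * (F u - F t))" .
    have "norm (integral {u..v} (\<lambda>t. (D j v - D j t) * f t)) \<le> integral {u..v} (\<lambda>t. L * (v - u) * norm (f t))"
    proof (rule integral_norm_bound_integral[OF i1])
      show "(\<lambda>t. L * (v - u) * norm (f t)) integrable_on {u..v}"
        by (intro integrable_on_mult_right sub[OF nfi uv(1,3)])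
      fix t assume t: "t \<in> {u..v}"
      have "norm (D j v - D j t) \<le> L * (v - t)" using g_diff[of t v] t uv by auto
      also have "\<dots> \<le> L * (v - u)" using L t by (intro mult_left_mono) auto
      finally show "norm ((D j v - D j t) * f t) \<le> L * (v - u) * norm (f t)"
        unfolding norm_mult by (rule mult_right_mono) simp
    qed
    also have "\<dots> = L * (v - u) * (\<Phi> v - \<Phi> u)"
      using comb[OF nfi uv] by (simp add: \<Phi>_def)
    finally have 1: "norm (integral {u..v} (\<lambda>t. (D j v - D j t) * f t)) \<le> L * (v - u) * (\<Phi> v - \<Phi> u)" .
    have "norm (integral {u..v} (\<lambda>t. D (Suc j) t * (F u - F t))) \<le> integral {u..v} (\<lambda>t. L * (\<Phi> v - \<Phi> u))"
    proof (rule integral_norm_bound_integral[OF i2])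
      fix t assume t: "t \<in> {u..v}"
      have "norm (F t - F u) \<le> \<Phi> t - \<Phi> u" using F_diff[of u t] t uv by auto
      also have "\<dots> \<le> \<Phi> v - \<Phi> u" using Phi_mono[of t v] t uv by auto
      finally have "norm (F u - F t) \<le> \<Phi> v - \<Phi> u" by (simp add: norm_minus_commute)
      then show "norm (D (Suc j) t * (F u - F t)) \<le> L * (\<Phi> v - \<Phi> u)"
        unfolding norm_mult using L t uv by (intro mult_mono) auto
    qed auto
    then have 2: "norm (integral {u..v} (\<lambda>t. D (Suc j) t * (F u - F t))) \<le> L * (v - u) * (\<Phi> v - \<Phi> u)"
      using uv by (simp add: mult_ac)
    show ?thesis
      unfolding eq using norm_triangle_le[OF add_mono[OF 1 2]] by (simp add: algebra_simps)
  qed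
  \<comment> \<open>On each of the n + 1 equal cells the estimate has the factor 1/(n + 1), and the
    increments of \<open>\<Phi>\<close> telescope; so the total defect tends to 0.\<close>
  have "norm (W 1 - W 0) \<le> 2 * L * \<Phi> 1 / real (Suc n)" for n
  proof -
    let ?N = "Suc n"
    have "W 1 - W 0 = (\<Sum>i<?N. W (real (Suc i) / ?N) - W (real i / ?N))"
      by (subst sum_lessThan_telescope) (simp del: of_nat_Suc)
    also have "norm \<dots> \<le> (\<Sum>i<?N. 2 * L * (1 / ?N) * (\<Phi> (real (Suc i) / ?N) - \<Phi> (real i / ?N)))"
    proof (rule sum_norm_le)
      fix i assume "i \<in> {..<?N}"
      then have "norm (W (real (Suc i) / ?N) - W (real i / ?N)) \<le>
        2 * L * (real (Suc i) / ?N - real i / ?N) * (\<Phi> (real (Suc i) / ?N) - \<Phi> (real i / ?N))"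
        by (intro est) (auto simp: field_simps)
      also have "real (Suc i) / ?N - real i / ?N = 1 / ?N"
        by (simp add: diff_divide_distrib[symmetric])
      finally show "norm (W (real (Suc i) / ?N) - W (real i / ?N)) \<le>
        2 * L * (1 / ?N) * (\<Phi> (real (Suc i) / ?N) - \<Phi> (real i / ?N))" .
    qed
    also have "\<dots> = 2 * L * (1 / ?N) * (\<Phi> 1 - \<Phi> 0)"
      unfolding sum_distrib_left[symmetric] by (subst sum_lessThan_telescope) (simp del: of_nat_Suc)
    finally show ?thesis by (simp add: \<Phi>_def)
  qed
  then have "norm (W 1 - W 0) \<le> 0"
    by (intro LIMSEQ_le_const[OF lim_const_over_n[THEN LIMSEQ_Suc]]) blast
  then have "K 1 = 0"
    using testfn_zero_outside[OF D, of 0] testfn_zero_outside[OF D, of 1] by (simp add: W_def K_def)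
  then show ?thesis
    unfolding K_def Henstock_Kurzweil_Integration.integral_add[OF gfi gFi]
    by (simp add: F_def add_eq_0_iff2)
qed

section \<open>Antiderivatives of functions of power growth\<close>

lemma DERIV_powr_Suc:
  assumes "x > 0"
  shows "((\<lambda>x. C * x powr (\<alpha> + 1)) has_real_derivative C * (\<alpha> + 1) * x powr \<alpha>) (at x)"
  using assms by (auto intro!: derivative_eq_intros)

text \<open>The constant 4 dominates 1/(\<alpha> + 1) because \<alpha> + 1 \<ge> 1/4. A constant
  independent of the exponent keeps iterated estimates simple; the mirror case below has \<alpha> +
  1 \<le> -1/4.\<close>

lemma powr_integral_bound_high:
  fixes F :: "real \<Rightarrow> complex"
  assumes "0 < a" "a \<le> b" "\<And>x. x \<in> {a..b} \<Longrightarrow> (F has_vector_derivative f x) (at x)"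
    "\<And>x. x \<in> {a..b} \<Longrightarrow> norm (f x) \<le> C * x powr \<alpha>" "- 3 / 4 \<le> \<alpha>" "0 \<le> C"
  shows "norm (F b - F a) \<le> 4 * C * b powr (\<alpha> + 1) - 4 * C * a powr (\<alpha> + 1)"
proof (rule norm_diff_le_antiderivative[OF assms(2,3)])
  fix x assume x: "x \<in> {a..b}"
  show "((\<lambda>x. 4 * C * x powr (\<alpha> + 1)) has_real_derivative 4 * C * (\<alpha> + 1) * x powr \<alpha>) (at x)"
    using x assms by (intro DERIV_powr_Suc) auto
  have "1 * C * x powr \<alpha> \<le> (4 * (\<alpha> + 1)) * C * x powr \<alpha>"
    using assms by (intro mult_right_mono) auto
  then show "norm (f x) \<le> 4 * C * (\<alpha> + 1) * x powr \<alpha>"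
    using assms(4)[OF x] by (simp add: mult_ac)
qed auto

lemma powr_integral_bound_low:
  fixes F :: "real \<Rightarrow> complex"
  assumes "0 < a" "a \<le> b" "\<And>x. x \<in> {a..b} \<Longrightarrow> (F has_vector_derivative f x) (at x)"
    "\<And>x. x \<in> {a..b} \<Longrightarrow> norm (f x) \<le> C * x powr \<alpha>" "\<alpha> \<le> - 5 / 4" "0 \<le> C"
  shows "norm (F b - F a) \<le> 4 * C * a powr (\<alpha> + 1) - 4 * C * b powr (\<alpha> + 1)"
proof -
  have "norm (F b - F a) \<le> (- 4 * C) * b powr (\<alpha> + 1) - (- 4 * C) * a powr (\<alpha> + 1)"
  proof (rule norm_diff_le_antiderivative[OF assms(2,3)])
    fix x assume x: "x \<in> {a..b}"
    show "((\<lambda>x. (- 4 * C) * x powr (\<alpha> + 1)) has_real_derivative (- 4 * C) * (\<alpha> + 1) * x powr \<alpha>) (at x)"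
      using x assms by (intro DERIV_powr_Suc) auto
    have "1 * C * x powr \<alpha> \<le> (- 4 * (\<alpha> + 1)) * C * x powr \<alpha>"
      using assms by (intro mult_right_mono) auto
    moreover have "(- 4 * C) * (\<alpha> + 1) * x powr \<alpha> = (- 4 * (\<alpha> + 1)) * C * x powr \<alpha>"
      by (simp add: algebra_simps)
    ultimately show "norm (f x) \<le> (- 4 * C) * (\<alpha> + 1) * x powr \<alpha>"
      using assms(4)[OF x] by linarith
  qed auto
  then show ?thesis by simp
qed

text \<open>The class O(x^\<alpha>), uniformly on (0,1): the bound also controls the function near
  1, where the power is close to 1.\<close>

definition pbd :: "real \<Rightarrow> (real \<Rightarrow> complex) \<Rightarrow> bool"
  where "pbd \<alpha> f \<longleftrightarrow> (\<exists>C\<ge>0. \<forall>x\<in>{0<..<1}. norm (f x) \<le> C * x powr \<alpha>)"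

lemma pbd_mono:
  assumes "pbd \<alpha> f" "\<beta> \<le> \<alpha>" shows "pbd \<beta> f"
proof -
  obtain C where C: "C \<ge> 0" "\<And>x. x \<in> {0<..<1} \<Longrightarrow> norm (f x) \<le> C * x powr \<alpha>"
    using assms unfolding pbd_def by auto
  have "norm (f x) \<le> C * x powr \<beta>" if "x \<in> {0<..<1}" for x
  proof -
    have "x powr \<alpha> \<le> x powr \<beta>" using that assms by (intro powr_mono') auto
    then show ?thesis using C(2)[OF that] mult_left_mono[OF _ C(1)] by (meson order_trans)
  qed
  with C show ?thesis unfolding pbd_def by blast
qed

lemma pbd_add: "pbd \<alpha> f \<Longrightarrow> pbd \<alpha> g \<Longrightarrow> pbd \<alpha> (\<lambda>x. f x + g x)"
proof -
  assume "pbd \<alpha> f" "pbd \<alpha> g"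
  then obtain C B where C: "C \<ge> 0" "\<And>x. x \<in> {0<..<1} \<Longrightarrow> norm (f x) \<le> C * x powr \<alpha>"
    and B: "B \<ge> 0" "\<And>x. x \<in> {0<..<1} \<Longrightarrow> norm (g x) \<le> B * x powr \<alpha>"
    unfolding pbd_def by auto
  have "norm (f x + g x) \<le> (C + B) * x powr \<alpha>" if "x \<in> {0<..<1}" for x
    using norm_triangle_le[OF add_mono[OF C(2)[OF that] B(2)[OF that]]] by (simp add: algebra_simps)
  then show ?thesis unfolding pbd_def using B(1) C(1) by (meson add_nonneg_nonneg)
qed

lemma pbd_scale: "pbd \<alpha> f \<Longrightarrow> pbd \<alpha> (\<lambda>x. c * f x)"
  unfolding pbd_def
proof (elim exE conjE)
  fix C assume C: "0 \<le> C" "\<forall>x\<in>{0<..<1}. norm (f x) \<le> C * x powr \<alpha>"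
  show "\<exists>C\<ge>0. \<forall>x\<in>{0<..<1}. norm (c * f x) \<le> C * x powr \<alpha>"
    by (rule exI[of _ "norm c * C"]) (use C in \<open>auto simp: norm_mult mult.assoc intro!: mult_left_mono\<close>)
qed

lemma pbd_const: "pbd 0 (\<lambda>x. c)"
  unfolding pbd_def by (rule exI[of _ "norm c"]) auto

lemma pbd_cong: "pbd \<alpha> f \<Longrightarrow> (\<And>x. x \<in> {0<..<1} \<Longrightarrow> g x = f x) \<Longrightarrow> pbd \<alpha> g"
  unfolding pbd_def by auto

text \<open>Integration starts at 1/2. Since \<alpha> + 1 < 0, the power x^(\<alpha> + 1) is at
  least 1 on (0,1) and absorbs the integration constant.\<close>

lemma pbd_antideriv_low:
  fixes F :: "real \<Rightarrow> complex"
  assumes F: "\<And>x. x \<in> {0<..<1} \<Longrightarrow> (F has_vector_derivative f x) (at x)"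
    and f: "pbd \<alpha> f" and \<alpha>: "\<alpha> \<le> - 5 / 4"
  shows "pbd (\<alpha> + 1) F"
proof -
  obtain C where C: "C \<ge> 0" "\<And>x. x \<in> {0<..<1} \<Longrightarrow> norm (f x) \<le> C * x powr \<alpha>"
    using f unfolding pbd_def by auto
  have b: "norm (F b - F a) \<le> 4 * C * a powr (\<alpha> + 1)" if "0 < a" "a \<le> b" "b < 1" for a b
  proof -
    have "norm (F b - F a) \<le> 4 * C * a powr (\<alpha> + 1) - 4 * C * b powr (\<alpha> + 1)"
      using that by (intro powr_integral_bound_low[where f=f] F C \<alpha>) auto
    moreover have "0 \<le> 4 * C * b powr (\<alpha> + 1)" using C by simp
    ultimately show ?thesis by linarith
  qed
  let ?h = "(1 / 2 :: real) powr (\<alpha> + 1)"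
  have "norm (F x) \<le> (norm (F (1/2)) + 4 * C + 4 * C * ?h) * x powr (\<alpha> + 1)" if x: "x \<in> {0<..<1}" for x
  proof -
    have 1: "1 \<le> x powr (\<alpha> + 1)" using powr_mono'[of "\<alpha> + 1" 0 x] x \<alpha> by simp
    have "norm (F x - F (1/2)) \<le> 4 * C * x powr (\<alpha> + 1) + 4 * C * ?h"
      using b[of x "1/2"] b[of "1/2" x] x C
      by (cases "x \<le> 1/2") (auto simp: norm_minus_commute intro: add_increasing add_increasing2)
    then have "norm (F x) \<le> norm (F (1/2)) * 1 + 4 * C * x powr (\<alpha> + 1) + 4 * C * ?h * 1"
      using norm_triangle_sub[of "F x" "F (1/2)"] by simp
    also have "\<dots> \<le> norm (F (1/2)) * x powr (\<alpha> + 1) + 4 * C * x powr (\<alpha> + 1) + 4 * C * ?h * x powr (\<alpha> + 1)"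
      using C 1 by (intro add_mono mult_left_mono) auto
    finally show ?thesis by (simp add: algebra_simps)
  qed
  moreover have "norm (F (1/2)) + 4 * C + 4 * C * ?h \<ge> 0" using C by simp
  ultimately show ?thesis unfolding pbd_def by blast
qed

text \<open>The increments of \<open>F\<close> are dominated by those of 4 C x^(\<alpha> + 1), which
  is continuous on all of [0,1]; hence \<open>F\<close> is uniformly continuous and extends to
  0.\<close>

lemma antideriv_tendsto:
  fixes F :: "real \<Rightarrow> complex"
  assumes F: "\<And>x. x \<in> {0<..<1} \<Longrightarrow> (F has_vector_derivative f x) (at x)"
    and f: "pbd \<alpha> f" and \<alpha>: "- 3 / 4 \<le> \<alpha>"
  obtains L where "(F \<longlongrightarrow> L) (at_right 0)"
proof -
  obtain C where C: "C \<ge> 0" "\<And>x. x \<in> {0<..<1} \<Longrightarrow> norm (f x) \<le> C * x powr \<alpha>"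
    using f unfolding pbd_def by auto
  let ?\<phi> = "\<lambda>x. 4 * C * x powr (\<alpha> + 1)"
  have b: "norm (F b - F a) \<le> norm (?\<phi> b - ?\<phi> a)" if "a \<in> {0<..<1}" "b \<in> {0<..<1}" for a b
  proof -
    have *: "norm (F b - F a) \<le> ?\<phi> b - ?\<phi> a" if "0 < a" "a \<le> b" "b < 1" for a b
      using that by (intro powr_integral_bound_high[where f=f] F C \<alpha>) auto
    show ?thesis
      using *[of a b] *[of b a] that by (cases "a \<le> b") (auto simp: norm_minus_commute)
  qed
  have "continuous_on {0..1} ?\<phi>"
    using \<alpha> by (intro continuous_intros continuous_on_powr') auto
  then have "uniformly_continuous_on {0..1} ?\<phi>"
    by (rule compact_uniformly_continuous) simp
  then have u: "\<exists>d>0. \<forall>x\<in>{0..1}. \<forall>x'\<in>{0..1}. norm (x' - x) < d \<longrightarrow> norm (?\<phi> x' - ?\<phi> x) < \<epsilon>" if "\<epsilon> > 0" for \<epsilon>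
    using that unfolding uniformly_continuous_on_def dist_norm by blast
  have "uniformly_continuous_on {0<..<1} F"
    unfolding uniformly_continuous_on_def dist_norm
  proof (intro allI impI)
    fix \<epsilon> :: real assume "\<epsilon> > 0"
    from u[OF this] obtain d where d: "d > 0"
      "\<And>x x'. x \<in> {0..1} \<Longrightarrow> x' \<in> {0..1} \<Longrightarrow> norm (x' - x) < d \<Longrightarrow> norm (?\<phi> x' - ?\<phi> x) < \<epsilon>" by blast
    have "norm (F x' - F x) < \<epsilon>" if "x \<in> {0<..<1}" "x' \<in> {0<..<1}" "norm (x' - x) < d" for x x'
      by (rule le_less_trans[OF b[OF that(1,2)] d(2)]) (use that in auto)
    with d(1) show "\<exists>d>0. \<forall>x\<in>{0<..<1}. \<forall>x'\<in>{0<..<1}. norm (x' - x) < d \<longrightarrow> norm (F x' - F x) < \<epsilon>"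
      by blast
  qed
  then obtain L where "(F \<longlongrightarrow> L) (at 0 within {0<..<1})"
    by (rule uniformly_continuous_on_extension_at_closure[of _ _ 0]) auto
  moreover have "at 0 within {0<..<1} = at_right (0::real)"
    by (rule at_within_nhd[of _ "{..<1}"]) auto
  ultimately show thesis using that by simp
qed

text \<open>The lower limit of integration is sent to 0. The threshold \<open>e\<close> lets the
  same estimate serve plain power bounds, with e = 1, and the power part of the weight
  below.\<close>

lemma pbd_antideriv_zero:
  fixes F :: "real \<Rightarrow> complex"
  assumes F: "\<And>x. x \<in> {0<..<1} \<Longrightarrow> (F has_vector_derivative f x) (at x)"
    and f: "\<And>x. x \<in> {0<..<1} \<Longrightarrow> x \<le> e \<Longrightarrow> norm (f x) \<le> C * x powr \<alpha>" and "C \<ge> 0" and \<alpha>: "- 3 / 4 \<le> \<alpha>"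
    and lim: "(F \<longlongrightarrow> 0) (at_right 0)" and x: "x \<in> {0<..<1}" "x \<le> e"
  shows "norm (F x) \<le> 4 * C * x powr (\<alpha> + 1)"
proof -
  have "norm (F x - F a) \<le> 4 * C * x powr (\<alpha> + 1)" if a: "0 < a" "a \<le> x" for a
  proof -
    have "norm (F x - F a) \<le> 4 * C * x powr (\<alpha> + 1) - 4 * C * a powr (\<alpha> + 1)"
      using a x by (intro powr_integral_bound_high[where f=f] F f \<alpha> \<open>C \<ge> 0\<close>) auto
    moreover have "0 \<le> 4 * C * a powr (\<alpha> + 1)" using \<open>C \<ge> 0\<close> by simp
    ultimately show ?thesis by linarith
  qed
  then have "eventually (\<lambda>a. norm (F x - F a) \<le> 4 * C * x powr (\<alpha> + 1)) (at_right 0)"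
    using x eventually_at_right_less[of "0::real"] eventually_at_right_field[of _ "0::real"]
    by (intro eventually_at_right_field[THEN iffD2] exI[of _ x]) auto
  moreover have "((\<lambda>a. norm (F x - F a)) \<longlongrightarrow> norm (F x - 0)) (at_right 0)"
    by (intro tendsto_intros lim)
  ultimately have "norm (F x - 0) \<le> 4 * C * x powr (\<alpha> + 1)"
    by (intro tendsto_upperbound) auto
  then show ?thesis by simp
qed

lemma pbd_antideriv_high:
  fixes F :: "real \<Rightarrow> complex"
  assumes F: "\<And>x. x \<in> {0<..<1} \<Longrightarrow> (F has_vector_derivative f x) (at x)"
    and f: "pbd \<alpha> f" and \<alpha>: "- 3 / 4 \<le> \<alpha>" and lim: "(F \<longlongrightarrow> 0) (at_right 0)"
  shows "pbd (\<alpha> + 1) F"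
proof -
  obtain C where C: "C \<ge> 0" "\<And>x. x \<in> {0<..<1} \<Longrightarrow> norm (f x) \<le> C * x powr \<alpha>"
    using f unfolding pbd_def by auto
  have "norm (F x) \<le> 4 * C * x powr (\<alpha> + 1)" if "x \<in> {0<..<1}" for x
    by (rule pbd_antideriv_zero[OF F C(2) C(1) \<alpha> lim that, where e=1]) (use that in auto)
  then show ?thesis unfolding pbd_def using C by (intro exI[of _ "4 * C"]) auto
qed

lemma pbd_antideriv_bounded:
  fixes F :: "real \<Rightarrow> complex"
  assumes F: "\<And>x. x \<in> {0<..<1} \<Longrightarrow> (F has_vector_derivative f x) (at x)"
    and f: "pbd \<alpha> f" and \<alpha>: "- 3 / 4 \<le> \<alpha>"
  shows "pbd 0 F"
proof -
  obtain L where L: "(F \<longlongrightarrow> L) (at_right 0)"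
    using antideriv_tendsto[OF F f \<alpha>] by blast
  have "pbd (\<alpha> + 1) (\<lambda>x. F x - L)"
  proof (rule pbd_antideriv_high[OF _ f \<alpha>])
    show "((\<lambda>x. F x - L) has_vector_derivative f x) (at x)" if "x \<in> {0<..<1}" for x
      using F[OF that] by (auto intro!: derivative_eq_intros)
    show "((\<lambda>x. F x - L) \<longlongrightarrow> 0) (at_right 0)" using L by (simp add: LIM_zero)
  qed
  then have "pbd 0 (\<lambda>x. F x - L)" by (rule pbd_mono) (use \<alpha> in auto)
  from pbd_add[OF this pbd_const[of L]] show ?thesis by simp
qed

text \<open>The exponential growth beyond \<open>e\<close> makes an antiderivative gain the factor \<open>e\<close> there as well, so one
  contraction argument covers the whole interval.\<close>

definition wt :: "real \<Rightarrow> real \<Rightarrow> real \<Rightarrow> real"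
  where "wt e \<alpha> x = (if x \<le> e then x powr \<alpha> else e powr \<alpha> * exp ((x - e) / e))"

definition wbd :: "real \<Rightarrow> real \<Rightarrow> real \<Rightarrow> (real \<Rightarrow> complex) \<Rightarrow> bool"
  where "wbd e \<alpha> C f \<longleftrightarrow> (\<forall>x\<in>{0<..<1}. norm (f x) \<le> C * wt e \<alpha> x)"

lemma wt_nonneg: "0 \<le> wt e \<alpha> x"
  by (auto simp: wt_def)

lemma wbdD: "wbd e \<alpha> C f \<Longrightarrow> x \<in> {0<..<1} \<Longrightarrow> norm (f x) \<le> C * wt e \<alpha> x"
  by (simp add: wbd_def)

lemma wbdD_left: "wbd e \<alpha> C f \<Longrightarrow> x \<in> {0<..<1} \<Longrightarrow> x \<le> e \<Longrightarrow> norm (f x) \<le> C * x powr \<alpha>"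
  using wbdD[of e \<alpha> C f x] by (simp add: wt_def)

text \<open>A surplus power of x is worth a power of \<open>e\<close>, on both parts of the weight.
  This is the source of the small contraction constant.\<close>

lemma wt_add_le:
  assumes "0 < e" "0 < x" "0 \<le> \<gamma>"
  shows "wt e (\<beta> + \<gamma>) x \<le> e powr \<gamma> * wt e \<beta> x"
proof (cases "x \<le> e")
  case True
  have "x powr \<beta> * x powr \<gamma> \<le> x powr \<beta> * e powr \<gamma>"
    using True assms by (intro mult_left_mono powr_mono2) auto
  then show ?thesis using True by (simp add: wt_def powr_add mult_ac)
qed (simp add: wt_def powr_add)

lemma wt_div_le:
  assumes "0 < e" "0 < x"
  shows "wt e \<alpha> x / x ^ n \<le> wt e (\<alpha> - real n) x"
proof (cases "x \<le> e")
  case True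
  then show ?thesis using assms by (simp add: wt_def powr_diff powr_realpow)
next
  case False
  have "e powr \<alpha> * exp ((x - e) / e) / x ^ n \<le> e powr \<alpha> * exp ((x - e) / e) / e ^ n"
    using False assms by (intro divide_left_mono power_mono) auto
  then show ?thesis using False assms by (simp add: wt_def powr_diff powr_realpow)
qed

lemma wbd_mono:
  assumes "wbd e \<alpha> C f" "\<beta> \<le> \<alpha>" "0 < e" "e \<le> 1" "0 \<le> C"
  shows "wbd e \<beta> C f"
  unfolding wbd_def
proof
  fix x :: real assume x: "x \<in> {0<..<1}"
  have "wt e (\<beta> + (\<alpha> - \<beta>)) x \<le> e powr (\<alpha> - \<beta>) * wt e \<beta> x"
    using x assms by (intro wt_add_le) auto
  also have "\<dots> \<le> 1 * wt e \<beta> x"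
    using assms by (intro mult_right_mono wt_nonneg powr_le1) auto
  finally have "C * wt e \<alpha> x \<le> C * wt e \<beta> x" using assms by (intro mult_left_mono) auto
  then show "norm (f x) \<le> C * wt e \<beta> x" using assms(1) x unfolding wbd_def by fastforce
qed

text \<open>Beyond \<open>e\<close> the weight is an exponential with antiderivative
  \<open>e\<close> times itself, and this factor raises e^\<alpha> to e^(\<alpha> + 1).\<close>

lemma wbd_right_part:
  fixes F :: "real \<Rightarrow> complex"
  assumes F: "\<And>x. x \<in> {0<..<1} \<Longrightarrow> (F has_vector_derivative f x) (at x)"
    and f: "wbd e \<alpha> C f" and e: "0 < e" "e < 1" and x: "e \<le> x" "x < 1" and C: "C \<ge> 0"
  shows "norm (F x - F e) \<le> C * e powr (\<alpha> + 1) * exp ((x - e) / e) - C * e powr (\<alpha> + 1)"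
proof -
  have "norm (F x - F e) \<le> C * e powr (\<alpha> + 1) * exp ((x - e) / e) - C * e powr (\<alpha> + 1) * exp ((e - e) / e)"
  proof (rule norm_diff_le_antiderivative[OF x(1), where f=f])
    fix t assume t: "t \<in> {e..x}"
    then have tI: "t \<in> {0<..<1}" using e x by auto
    show "(F has_vector_derivative f t) (at t)" using F[OF tI] .
    have "e powr (\<alpha> + 1) = e powr \<alpha> * e" using e by (simp add: powr_add)
    then show "((\<lambda>x. C * e powr (\<alpha> + 1) * exp ((x - e) / e)) has_real_derivative
      C * e powr \<alpha> * exp ((t - e) / e)) (at t)"
      using e by (auto intro!: derivative_eq_intros)
    show "norm (f t) \<le> C * e powr \<alpha> * exp ((t - e) / e)"
      using f tI t by (cases "t = e") (auto simp: wbd_def wt_def dest!: bspec[of _ _ t])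
  qed
  then show ?thesis by simp
qed

lemma wbd_antideriv_high:
  fixes F :: "real \<Rightarrow> complex"
  assumes F: "\<And>x. x \<in> {0<..<1} \<Longrightarrow> (F has_vector_derivative f x) (at x)"
    and f: "wbd e \<alpha> C f" and e: "0 < e" "e < 1" and C: "C \<ge> 0"
    and \<alpha>: "- 3 / 4 \<le> \<alpha>" and lim: "(F \<longlongrightarrow> 0) (at_right 0)"
  shows "wbd e (\<alpha> + 1) (4 * C) F"
proof -
  have l: "norm (F x) \<le> 4 * C * x powr (\<alpha> + 1)" if "x \<in> {0<..<1}" "x \<le> e" for x
    by (rule pbd_antideriv_zero[OF F _ C \<alpha> lim that]) (use f in \<open>auto intro: wbdD_left\<close>)
  have "norm (F x) \<le> 4 * C * (e powr (\<alpha> + 1) * exp ((x - e) / e))" if "x \<in> {0<..<1}" "e < x" for x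
  proof -
    have "norm (F x) \<le> norm (F e) + norm (F x - F e)" by (rule norm_triangle_sub)
    also have "\<dots> \<le> 4 * C * e powr (\<alpha> + 1) + (C * e powr (\<alpha> + 1) * exp ((x - e) / e) - C * e powr (\<alpha> + 1))"
      by (intro add_mono l wbd_right_part[OF F f e _ _ C]) (use e that in auto)
    also have "\<dots> = C * e powr (\<alpha> + 1) * (3 + exp ((x - e) / e))"
      by (simp add: algebra_simps)
    \<comment> \<open>The exponential is at least 1 here, so the constant 4 of the power part is
      kept.\<close>
    also have "\<dots> \<le> C * e powr (\<alpha> + 1) * (4 * exp ((x - e) / e))"
      using C e that by (intro mult_left_mono) auto
    finally show ?thesis by (simp add: mult_ac)
  qed
  with l show ?thesis by (auto simp: wbd_def wt_def)
qed

lemma wbd_antideriv_low: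
  fixes F :: "real \<Rightarrow> complex"
  assumes F: "\<And>x. x \<in> {0<..<1} \<Longrightarrow> (F has_vector_derivative f x) (at x)"
    and f: "wbd e \<alpha> C f" and e: "0 < e" "e < 1" and C: "C \<ge> 0"
    and \<alpha>: "\<alpha> \<le> - 5 / 4" and zero: "F e = 0"
  shows "wbd e (\<alpha> + 1) (4 * C) F"
proof -
  have "norm (F x) \<le> 4 * C * x powr (\<alpha> + 1)" if "x \<in> {0<..<1}" "x \<le> e" for x
  proof -
    have "norm (F e - F x) \<le> 4 * C * x powr (\<alpha> + 1) - 4 * C * e powr (\<alpha> + 1)"
      using that e f by (intro powr_integral_bound_low[where f=f] F \<alpha> C wbdD_left[OF f]) auto
    moreover have "0 \<le> 4 * C * e powr (\<alpha> + 1)" using C by simp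
    ultimately show ?thesis using zero by simp
  qed
  moreover have "norm (F x) \<le> 4 * C * (e powr (\<alpha> + 1) * exp ((x - e) / e))" if "x \<in> {0<..<1}" "e < x" for x
  proof -
    have "norm (F x) \<le> C * e powr (\<alpha> + 1) * exp ((x - e) / e) - C * e powr (\<alpha> + 1)"
      using wbd_right_part[OF F f e _ _ C, of x] e that zero by simp
    also have "\<dots> \<le> 1 * (C * e powr (\<alpha> + 1) * exp ((x - e) / e))" using C by simp
    also have "\<dots> \<le> 4 * (C * e powr (\<alpha> + 1) * exp ((x - e) / e))"
      using C by (intro mult_right_mono) auto
    finally show ?thesis by (simp add: mult_ac)
  qed
  ultimately show ?thesis by (auto simp: wbd_def wt_def)
qed

section \<open>Solutions at a singular endpoint\<close>

lemma tendsto_divide_power2: "(\<lambda>n. W / 2 ^ n) \<longlonglongrightarrow> (0 :: real)"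
proof -
  have "(\<lambda>n. W * (1 / 2) ^ n) \<longlonglongrightarrow> W * 0"
    by (intro tendsto_mult tendsto_const LIMSEQ_power_zero) simp
  then show ?thesis by (simp add: power_divide)
qed

lemma geometric_increments_converge:
  fixes u :: "nat \<Rightarrow> complex"
  assumes "\<And>n. norm (u (Suc n) - u n) \<le> B / 2 ^ n"
  obtains l where "u \<longlonglongrightarrow> l" "\<And>n. norm (l - u n) \<le> 2 * B / 2 ^ n"
proof -
  have B: "0 \<le> B" using order_trans[OF norm_ge_zero assms[of 0]] by simp
  have d: "norm (u (n + k) - u n) \<le> 2 * B / 2 ^ n - 2 * B / 2 ^ (n + k)" for n k
  proof (induction k)
    case (Suc k)
    have "norm (u (n + Suc k) - u n) \<le> norm (u (n + Suc k) - u (n + k)) + norm (u (n + k) - u n)"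
      using norm_triangle_ineq[of "u (n + Suc k) - u (n + k)" "u (n + k) - u n"] by simp
    also have "\<dots> \<le> B / 2 ^ (n + k) + (2 * B / 2 ^ n - 2 * B / 2 ^ (n + k))"
      using assms[of "n + k"] Suc by simp
    also have "\<dots> = 2 * B / 2 ^ n - 2 * B / 2 ^ (n + Suc k)"
      by (simp add: field_simps)
    finally show ?case .
  qed simp
  have d': "norm (u (n + k) - u n) \<le> 2 * B / 2 ^ n" for n k
    by (rule order_trans[OF d]) (use B in simp)
  have "summable (\<lambda>n. B * (1 / 2) ^ n)"
    by (intro summable_mult summable_geometric) simp
  then have "summable (\<lambda>n. B / 2 ^ n)" by (simp add: power_divide)
  then have "summable (\<lambda>n. u (Suc n) - u n)"
    by (rule summable_comparison_test[rotated]) (use assms in auto)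
  then obtain L where "(\<lambda>n. \<Sum>i<n. u (Suc i) - u i) \<longlonglongrightarrow> L"
    by (auto simp: summable_def sums_def)
  then have "(\<lambda>n. u n - u 0) \<longlonglongrightarrow> L" by (simp add: sum_lessThan_telescope)
  then have "(\<lambda>n. (u n - u 0) + u 0) \<longlonglongrightarrow> L + u 0" by (intro tendsto_intros)
  then obtain l where l: "u \<longlonglongrightarrow> l" by auto
  have "norm (l - u n) \<le> 2 * B / 2 ^ n" for n
  proof (rule tendsto_upperbound)
    show "(\<lambda>k. norm (u (k + n) - u n)) \<longlonglongrightarrow> norm (l - u n)"
      by (intro tendsto_intros LIMSEQ_ignore_initial_segment[OF l])
    show "eventually (\<lambda>k. norm (u (k + n) - u n) \<le> 2 * B / 2 ^ n) sequentially"
      using d'[of n] by (simp add: add.commute)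
  qed simp
  with l that show thesis by blast
qed

text \<open>One half of the interval, turned to the right of 0. The lower bound for |c| controls the
  division by \<open>c\<close>; \<open>lam\<close> is the factor in V^(m) = lam z, so it includes
  the sign (-1)^m of the operator.\<close>

locale side =
  fixes m p :: nat and c :: "real \<Rightarrow> real" and \<kappa> :: real and lam :: complex
  assumes m: "1 \<le> m" and p: "1 \<le> p" "p < 2 * m" and \<kappa>: "0 < \<kappa>"
    and c_lower: "\<And>x. x \<in> {0<..<1} \<Longrightarrow> \<kappa> * x ^ p \<le> \<bar>c x\<bar>"
    and c_cont: "continuous_on {0<..<1} c"
begin

text \<open>A passage through all \<open>2 * m\<close> antiderivatives costs the factor \<open>4 ^ (2 * m)\<close>, and at least one
  power of the anchor is gained; this choice makes the Picard map a contraction with constant 1/2.\<close>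

definition anchor :: real
  where "anchor = min (1 / 2) (\<kappa> / (2 * 4 ^ (2 * m) * (norm lam + 1)))"

lemma anchor: "0 < anchor" "anchor < 1" "anchor \<le> 1" "4 ^ (2 * m) * norm lam / \<kappa> * anchor \<le> 1 / 2"
proof -
  have pos: "0 < 2 * 4 ^ (2 * m) * (norm lam + 1)"
    by (intro mult_pos_pos) (auto intro: add_nonneg_pos)
  show "0 < anchor" "anchor < 1" "anchor \<le> 1"
    using pos \<kappa> by (auto simp: anchor_def)
  have "4 ^ (2 * m) * norm lam / \<kappa> * anchor
      \<le> 4 ^ (2 * m) * norm lam / \<kappa> * (\<kappa> / (2 * 4 ^ (2 * m) * (norm lam + 1)))"
    using \<kappa> by (intro mult_left_mono) (auto simp: anchor_def)
  also have "\<dots> = norm lam / (norm lam + 1) / 2"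
  proof -
    have "T * l / \<kappa> * (\<kappa> / (2 * T * s)) = l / s / 2" if "T \<noteq> 0" "s \<noteq> 0" for T l s :: real
      using that \<kappa> by (simp add: field_simps)
    moreover have "norm lam + 1 \<noteq> 0" using norm_ge_zero[of lam] by linarith
    ultimately show ?thesis by simp
  qed
  also have "\<dots> \<le> 1 / 2"
  proof -
    have "0 < norm lam + 1" using norm_ge_zero[of lam] by linarith
    then have "norm lam / (norm lam + 1) \<le> 1" by (simp add: divide_le_eq_1_pos)
    then show ?thesis by (rule divide_right_mono) simp
  qed
  finally show "4 ^ (2 * m) * norm lam / \<kappa> * anchor \<le> 1 / 2" .
qed

text \<open>The growth exponent at 0 of the \<open>k\<close>-th derivative of a solution. All exponents that occur differ
  from an integer by 1/4, so that no antiderivative is logarithmic.\<close>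

definition ex :: "nat \<Rightarrow> real"
  where "ex k = - real (k - (m - p)) - 1 / 4"

lemma ex_0: "ex 0 = - 1 / 4" by (simp add: ex_def)

text \<open>\<open>Z k\<close> is the \<open>k\<close>-th derivative of the solution and \<open>V j\<close> its \<open>(m + j)\<close>-th quasi-derivative.
  The derivatives of order below \<open>m - p\<close> (truncated subtraction) have limits at 0; the other ones are
  normalized at an interior point.\<close>

definition chain :: "(nat \<Rightarrow> complex) \<Rightarrow> (nat \<Rightarrow> complex) \<Rightarrow> (nat \<Rightarrow> real \<Rightarrow> complex) \<Rightarrow> (nat \<Rightarrow> real \<Rightarrow> complex) \<Rightarrow> bool"
  where "chain P Q Z V \<longleftrightarrow>
    (\<forall>k<m. \<forall>x\<in>{0<..<1}. (Z k has_vector_derivative Z (Suc k) x) (at x)) \<and>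
    (\<forall>x\<in>{0<..<1}. Z m x = V 0 x / of_real (c x)) \<and>
    (\<forall>j<m. \<forall>x\<in>{0<..<1}. (V j has_vector_derivative V (Suc j) x) (at x)) \<and>
    (\<forall>j<m. (V j \<longlongrightarrow> P j) (at_right 0)) \<and>
    (\<forall>k<m. if k < m - p then (Z k \<longlongrightarrow> Q k) (at_right 0) else Z k anchor = Q k)"

lemma chainD:
  assumes "chain P Q Z V"
  shows "\<And>k x. k < m \<Longrightarrow> x \<in> {0<..<1} \<Longrightarrow> (Z k has_vector_derivative Z (Suc k) x) (at x)"
    "\<And>x. x \<in> {0<..<1} \<Longrightarrow> Z m x = V 0 x / of_real (c x)"
    "\<And>j x. j < m \<Longrightarrow> x \<in> {0<..<1} \<Longrightarrow> (V j has_vector_derivative V (Suc j) x) (at x)"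
    "\<And>j. j < m \<Longrightarrow> (V j \<longlongrightarrow> P j) (at_right 0)"
    "\<And>k. k < m \<Longrightarrow> k < m - p \<Longrightarrow> (Z k \<longlongrightarrow> Q k) (at_right 0)"
    "\<And>k. k < m \<Longrightarrow> \<not> k < m - p \<Longrightarrow> Z k anchor = Q k"
  using assms unfolding chain_def by (auto split: if_splits)

lemma chain_linear:
  assumes "chain P Q Z V" "chain P' Q' Z' V'"
  shows "chain (\<lambda>j. P j + a * P' j) (\<lambda>j. Q j + a * Q' j) (\<lambda>j x. Z j x + a * Z' j x) (\<lambda>j x. V j x + a * V' j x)"
  unfolding chain_def
proof (intro conjI allI impI ballI)
  fix k x assume "k < m" "x \<in> {0<..<1::real}"
  then show "((\<lambda>x. Z k x + a * Z' k x) has_vector_derivative Z (Suc k) x + a * Z' (Suc k) x) (at x)"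
    "((\<lambda>x. V k x + a * V' k x) has_vector_derivative V (Suc k) x + a * V' (Suc k) x) (at x)"
    using chainD(1,3)[OF assms(1)] chainD(1,3)[OF assms(2)]
    by (auto intro!: has_vector_derivative_add has_vector_derivative_mult_right)
next
  fix x assume "x \<in> {0<..<1::real}"
  then show "Z m x + a * Z' m x = (V 0 x + a * V' 0 x) / of_real (c x)"
    using chainD(2)[OF assms(1)] chainD(2)[OF assms(2)] by (simp add: add_divide_distrib)
next
  fix j assume "j < m"
  then show "((\<lambda>x. V j x + a * V' j x) \<longlongrightarrow> P j + a * P' j) (at_right 0)"
    by (intro tendsto_intros chainD(4)[OF assms(1)] chainD(4)[OF assms(2)])
  show "if j < m - p then ((\<lambda>x. Z j x + a * Z' j x) \<longlongrightarrow> Q j + a * Q' j) (at_right 0)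
     else Z j anchor + a * Z' j anchor = Q j + a * Q' j"
    using \<open>j < m\<close> chainD(5,6)[OF assms(1)] chainD(5,6)[OF assms(2)] by (auto intro!: tendsto_intros)
qed

text \<open>For two Picard steps with equal data, the difference has data 0, so no integration
  constants arise and each of the \<open>2 * m\<close> antiderivatives costs the factor 4. The
  exponents gained exceed those lost by dividing by \<open>c\<close>, and the surplus becomes a
  power of the anchor.\<close>

lemma chain_contraction:
  assumes ch: "chain (\<lambda>_. 0) (\<lambda>_. 0) Z V"
    and V: "\<And>x. x \<in> {0<..<1} \<Longrightarrow> V m x = lam * g x"
    and g: "wbd anchor (- 1 / 4) M g" and M: "0 \<le> M"
  shows "wbd anchor (- 1 / 4) (M / 2) (Z 0)"
proof -
  note e = anchor(1,2)
  let ?A = "norm lam * M"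
  have A: "0 \<le> ?A" using M by simp
  have 1: "i \<le> m \<Longrightarrow> wbd anchor (real i - 1 / 4) (4 ^ i * ?A) (V (m - i))" for i
  proof (induction i)
    case 0
    have "norm (V m x) \<le> ?A * wt anchor (- 1 / 4) x" if "x \<in> {0<..<1}" for x
      using mult_left_mono[OF wbdD[OF g that], of "norm lam"] V[OF that] by (simp add: norm_mult mult.assoc)
    then show ?case by (simp add: wbd_def)
  next
    case (Suc i)
    then have eq: "m - i = Suc (m - Suc i)" by simp
    have "wbd anchor (real i - 1 / 4 + 1) (4 * (4 ^ i * ?A)) (V (m - Suc i))"
    proof (rule wbd_antideriv_high[OF _ _ e])
      show "(V (m - Suc i) has_vector_derivative V (m - i) x) (at x)" if "x \<in> {0<..<1}" for x
        using chainD(3)[OF ch, of "m - Suc i" x] that Suc.prems eq by simp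
      show "(V (m - Suc i) \<longlongrightarrow> 0) (at_right 0)"
        using chainD(4)[OF ch, of "m - Suc i"] Suc.prems by simp
    qed (use Suc A in auto)
    then show ?case by (simp add: algebra_simps)
  qed
  have V0: "wbd anchor (real m - 1 / 4) (4 ^ m * ?A) (V 0)" using 1[of m] by simp
  define K where "K = 4 ^ m * ?A / \<kappa> * anchor"
  have K: "0 \<le> K" using A \<kappa> e by (simp add: K_def)
  have exm: "ex m = - real (min m p) - 1 / 4" by (simp add: ex_def min_def)
  have Zm: "wbd anchor (ex m) K (Z m)"
    unfolding wbd_def
  proof
    fix x :: real assume x: "x \<in> {0<..<1}"
    \<comment> \<open>The surplus exponent after \<open>m\<close> integrations and the division by
      x^p: it is m for p \<le> m and 2m - p otherwise, hence at least 1 because p < 2m.\<close>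
    define \<gamma> where "\<gamma> = real m + real (min m p) - real p"
    have \<gamma>: "\<gamma> \<ge> 1" using p m by (auto simp: \<gamma>_def min_def)
    have cx: "0 < \<kappa> * x ^ p" using \<kappa> x by simp
    have "norm (Z m x) = norm (V 0 x) / \<bar>c x\<bar>"
      using chainD(2)[OF ch x] by (simp add: norm_divide)
    also have "\<dots> \<le> (4 ^ m * ?A * wt anchor (real m - 1 / 4) x) / (\<kappa> * x ^ p)"
      using c_lower[OF x] cx wbdD[OF V0 x] by (intro frac_le) (auto intro: order_trans[OF norm_ge_zero])
    also have "\<dots> = 4 ^ m * ?A / \<kappa> * (wt anchor (real m - 1 / 4) x / x ^ p)" by simp
    also have "\<dots> \<le> 4 ^ m * ?A / \<kappa> * wt anchor (real m - 1 / 4 - real p) x"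
      using x e A \<kappa> by (intro mult_left_mono wt_div_le) auto
    also have "real m - 1 / 4 - real p = ex m + \<gamma>" by (simp add: exm \<gamma>_def)
    also have "4 ^ m * ?A / \<kappa> * wt anchor (ex m + \<gamma>) x \<le> 4 ^ m * ?A / \<kappa> * (anchor powr \<gamma> * wt anchor (ex m) x)"
      using x e A \<kappa> \<gamma> by (intro mult_left_mono wt_add_le) auto
    also have "\<dots> \<le> 4 ^ m * ?A / \<kappa> * (anchor * wt anchor (ex m) x)"
      using powr_mono'[of 1 \<gamma> anchor] e A \<kappa> \<gamma> by (intro mult_left_mono mult_right_mono wt_nonneg) auto
    finally show "norm (Z m x) \<le> K * wt anchor (ex m) x" by (simp add: K_def mult_ac)
  qed
  have 2: "i \<le> m \<Longrightarrow> wbd anchor (ex (m - i)) (4 ^ i * K) (Z (m - i))" for i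
  proof (induction i)
    case (Suc i)
    define k where "k = m - Suc i"
    have k: "m - i = Suc k" "k < m" using Suc.prems by (auto simp: k_def)
    have d: "\<And>x. x \<in> {0<..<1} \<Longrightarrow> (Z k has_vector_derivative Z (Suc k) x) (at x)"
      using chainD(1)[OF ch k(2)] .
    have IH: "wbd anchor (ex (Suc k)) (4 ^ i * K) (Z (Suc k))" using Suc k by simp
    have nn: "0 \<le> 4 ^ i * K" using K by simp
    show ?case
    proof (cases "k < m - p")
      case True
      have "wbd anchor (ex (Suc k) + 1) (4 * (4 ^ i * K)) (Z k)"
        by (rule wbd_antideriv_high[OF d IH e nn _ chainD(5)[OF ch k(2) True]])
          (use True in \<open>auto simp: ex_def\<close>)
      \<comment> \<open>Below \<open>m - p\<close> the exponent remains -1/4; the power gained by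
        this integration is given up.\<close>
      then have "wbd anchor (ex k) (4 * (4 ^ i * K)) (Z k)"
        by (rule wbd_mono) (use e K True in \<open>auto simp: ex_def\<close>)
      then show ?thesis by (simp add: k_def mult.assoc)
    next
      case False
      have "wbd anchor (ex (Suc k) + 1) (4 * (4 ^ i * K)) (Z k)"
        by (rule wbd_antideriv_low[OF d IH e nn _ chainD(6)[OF ch k(2) False]])
          (use False in \<open>auto simp: ex_def Suc_diff_le\<close>)
      moreover have "ex (Suc k) + 1 = ex k" using False by (simp add: ex_def Suc_diff_le)
      ultimately show ?thesis by (simp add: k_def mult.assoc)
    qed
  qed (use Zm in simp)
  have 3: "wbd anchor (- 1 / 4) (4 ^ m * K) (Z 0)" using 2[of m] by (simp add: ex_0)
  have "4 ^ m * K = M * (4 ^ (2 * m) * norm lam / \<kappa> * anchor)"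
    by (simp add: K_def mult_2 power_add)
  also have "\<dots> \<le> M * (1 / 2)" by (rule mult_left_mono[OF anchor(4) M])
  finally have le: "4 ^ m * K \<le> M / 2" by simp
  show ?thesis
    unfolding wbd_def using 3 mult_right_mono[OF le wt_nonneg] by (meson order_trans wbdD)
qed

lemma antideriv_pbd_high:
  assumes "continuous_on {0<..<1} g" "pbd \<alpha> g" "- 3 / 4 \<le> \<alpha>"
  obtains G where "\<And>x. x \<in> {0<..<1} \<Longrightarrow> (G has_vector_derivative g x) (at x)"
    "(G \<longlongrightarrow> L) (at_right 0)" "pbd 0 G"
proof -
  obtain F where F: "\<And>x. x \<in> {0<..<1} \<Longrightarrow> (F has_vector_derivative g x) (at x)"
    using antiderivative_open_interval[OF assms(1)] by auto
  obtain L' where L': "(F \<longlongrightarrow> L') (at_right 0)" using antideriv_tendsto[OF F assms(2,3)] by blast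
  have 1: "((\<lambda>x. F x + (L - L')) has_vector_derivative g x) (at x)" if "x \<in> {0<..<1}" for x
    using F[OF that] by (auto intro!: derivative_eq_intros)
  have "((\<lambda>x. F x + (L - L')) \<longlongrightarrow> L' + (L - L')) (at_right 0)"
    by (intro tendsto_intros L')
  then have 2: "((\<lambda>x. F x + (L - L')) \<longlongrightarrow> L) (at_right 0)" by simp
  show thesis by (rule that[OF 1 2 pbd_antideriv_bounded[OF 1 assms(2,3)]])
qed

lemma quasi_tower:
  assumes "continuous_on {0<..<1} g" "pbd (- 1 / 4) g"
  shows "\<exists>V. V n = g \<and> (\<forall>j<n. (\<forall>x\<in>{0<..<1}. (V j has_vector_derivative V (Suc j) x) (at x)) \<and>
    (V j \<longlongrightarrow> P j) (at_right 0) \<and> pbd 0 (V j))"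
  using assms
proof (induction n arbitrary: g)
  case 0
  then show ?case by auto
next
  case (Suc n)
  obtain G where G: "\<And>x. x \<in> {0<..<1} \<Longrightarrow> (G has_vector_derivative g x) (at x)"
    "(G \<longlongrightarrow> P n) (at_right 0)" "pbd 0 G"
    using antideriv_pbd_high[OF Suc.prems] by auto
  obtain V where V: "V n = G" "\<forall>j<n. (\<forall>x\<in>{0<..<1}. (V j has_vector_derivative V (Suc j) x) (at x)) \<and>
    (V j \<longlongrightarrow> P j) (at_right 0) \<and> pbd 0 (V j)"
    using Suc.IH[OF deriv_imp_continuous_on[OF G(1)] pbd_mono[OF G(3)]] by auto
  show ?case
    by (rule exI[of _ "V(Suc n := g)"]) (use V G in \<open>auto simp: less_Suc_eq\<close>)
qed

lemma solution_tower:
  assumes "continuous_on {0<..<1} g" "pbd (ex n) g"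
  shows "\<exists>Z. Z n = g \<and> (\<forall>k<n. (\<forall>x\<in>{0<..<1}. (Z k has_vector_derivative Z (Suc k) x) (at x)) \<and>
    (if k < m - p then (Z k \<longlongrightarrow> Q k) (at_right 0) else Z k anchor = Q k) \<and> pbd (ex k) (Z k))"
  using assms
proof (induction n arbitrary: g)
  case 0
  then show ?case by auto
next
  case (Suc n)
  have "\<exists>G. (\<forall>x\<in>{0<..<1}. (G has_vector_derivative g x) (at x)) \<and>
    (if n < m - p then (G \<longlongrightarrow> Q n) (at_right 0) else G anchor = Q n) \<and> pbd (ex n) G"
  proof (cases "n < m - p")
    case True
    then have 1: "- 3 / 4 \<le> ex (Suc n)" "ex n \<le> 0" by (auto simp: ex_def)
    obtain G where G: "\<And>x. x \<in> {0<..<1} \<Longrightarrow> (G has_vector_derivative g x) (at x)"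
      "(G \<longlongrightarrow> Q n) (at_right 0)" "pbd 0 G"
      using antideriv_pbd_high[OF Suc.prems 1(1)] by auto
    then show ?thesis using True pbd_mono[OF G(3) 1(2)] by (intro exI[of _ G]) auto
  next
    case False
    then have 1: "ex (Suc n) \<le> - 5 / 4" "ex (Suc n) + 1 = ex n" by (auto simp: ex_def Suc_diff_le)
    obtain F where F: "\<And>x. x \<in> {0<..<1} \<Longrightarrow> (F has_vector_derivative g x) (at x)"
      using antiderivative_open_interval[OF Suc.prems(1)] by auto
    have 2: "((\<lambda>x. F x + (Q n - F anchor)) has_vector_derivative g x) (at x)" if "x \<in> {0<..<1}" for x
      using F[OF that] by (auto intro!: derivative_eq_intros)
    from pbd_antideriv_low[OF 2 Suc.prems(2) 1(1)] show ?thesis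
      using False 1(2) 2 by (intro exI[of _ "\<lambda>x. F x + (Q n - F anchor)"]) auto
  qed
  then obtain G where G: "\<And>x. x \<in> {0<..<1} \<Longrightarrow> (G has_vector_derivative g x) (at x)"
    "if n < m - p then (G \<longlongrightarrow> Q n) (at_right 0) else G anchor = Q n" "pbd (ex n) G" by blast
  obtain Z where Z: "Z n = G" "\<forall>k<n. (\<forall>x\<in>{0<..<1}. (Z k has_vector_derivative Z (Suc k) x) (at x)) \<and>
    (if k < m - p then (Z k \<longlongrightarrow> Q k) (at_right 0) else Z k anchor = Q k) \<and> pbd (ex k) (Z k)"
    using Suc.IH[OF deriv_imp_continuous_on[OF G(1)] G(3)] by auto
  show ?case
    by (rule exI[of _ "Z(Suc n := g)"]) (use Z G in \<open>auto simp: less_Suc_eq\<close>)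
qed

text \<open>Integrating down from the bounded function \<open>V (p - m)\<close> with zero initial
  values gains one power of x each time. This order of vanishing compensates the excess of
  \<open>p\<close> over \<open>m\<close> in the division by \<open>c\<close>.\<close>

lemma quasi_order_at_0:
  assumes V: "\<And>j x. j < m \<Longrightarrow> x \<in> {0<..<1} \<Longrightarrow> (V j has_vector_derivative V (Suc j) x) (at x)"
    and lim: "\<And>j. j < p - m \<Longrightarrow> (V j \<longlongrightarrow> 0) (at_right 0)" and bd: "pbd 0 (V (p - m))"
  shows "pbd (real (p - m)) (V 0)"
proof -
  have "i \<le> p - m \<Longrightarrow> pbd (real i) (V (p - m - i))" for i
  proof (induction i)
    case (Suc i)
    then have eq: "p - m - i = Suc (p - m - Suc i)" by simp
    have "pbd (real i + 1) (V (p - m - Suc i))"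
    proof (rule pbd_antideriv_high)
      show "(V (p - m - Suc i) has_vector_derivative V (p - m - i) x) (at x)" if "x \<in> {0<..<1}" for x
        unfolding eq by (rule V) (use that p in auto)
      show "(V (p - m - Suc i) \<longlongrightarrow> 0) (at_right 0)" by (rule lim) (use Suc.prems in auto)
    qed (use Suc in auto)
    then show ?case by (simp add: add.commute)
  qed (use bd in simp)
  from this[of "p - m"] show ?thesis by simp
qed

lemma pbd_divide_c:
  assumes "pbd \<alpha> g"
  shows "pbd (\<alpha> - real p) (\<lambda>x. g x / of_real (c x))"
proof -
  obtain C where C: "C \<ge> 0" "\<And>x. x \<in> {0<..<1} \<Longrightarrow> norm (g x) \<le> C * x powr \<alpha>"
    using assms unfolding pbd_def by auto
  have "norm (g x / of_real (c x)) \<le> C / \<kappa> * x powr (\<alpha> - real p)" if x: "x \<in> {0<..<1}" for x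
  proof -
    have "norm (g x) / \<bar>c x\<bar> \<le> (C * x powr \<alpha>) / (\<kappa> * x ^ p)"
      using c_lower[OF x] C(2)[OF x] \<kappa> x by (intro frac_le) (auto intro: order_trans[OF norm_ge_zero])
    also have "\<dots> = C / \<kappa> * x powr (\<alpha> - real p)"
      using x by (simp add: powr_diff powr_realpow)
    finally show ?thesis by (simp add: norm_divide)
  qed
  moreover have "0 \<le> C / \<kappa>" using C \<kappa> by simp
  ultimately show ?thesis unfolding pbd_def by blast
qed

lemma c_nonzero: "x \<in> {0<..<1} \<Longrightarrow> c x \<noteq> 0"
  using c_lower[of x] mult_pos_pos[OF \<kappa> zero_less_power[of x p]] by auto

section \<open>Existence and uniqueness by Picard iteration\<close>

definition good :: "(real \<Rightarrow> complex) \<Rightarrow> bool"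
  where "good g \<longleftrightarrow> continuous_on {0<..<1} g \<and> pbd (- 1 / 4) g"

text \<open>One Picard step: \<open>m\<close> antiderivatives of \<open>lam * g\<close> with initial
  values \<open>P\<close>, division by \<open>c\<close>, then \<open>m\<close> antiderivatives
  normalized by \<open>Q\<close>. The condition on \<open>P\<close> keeps the result in the class
  \<open>good\<close>.\<close>

lemma chain_exists:
  assumes g: "good g" and P: "\<And>j. j < p - m \<Longrightarrow> P j = 0"
  shows "\<exists>h. good h \<and> (\<exists>Z V. chain P Q Z V \<and> V m = (\<lambda>x. lam * g x) \<and> Z 0 = h)"
proof -
  have "continuous_on {0<..<1} (\<lambda>x. lam * g x)" "pbd (- 1 / 4) (\<lambda>x. lam * g x)"
    using g by (auto simp: good_def intro!: continuous_intros pbd_scale)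
  from quasi_tower[OF this, of m P] obtain V where V: "V m = (\<lambda>x. lam * g x)"
    "\<And>j x. j < m \<Longrightarrow> x \<in> {0<..<1} \<Longrightarrow> (V j has_vector_derivative V (Suc j) x) (at x)"
    "\<And>j. j < m \<Longrightarrow> (V j \<longlongrightarrow> P j) (at_right 0)" "\<And>j. j < m \<Longrightarrow> pbd 0 (V j)" by blast
  have pm: "p - m < m" using p by simp
  have "pbd (real (p - m)) (V 0)"
  proof (rule quasi_order_at_0[OF V(2) _ V(4)[OF pm]])
    show "(V j \<longlongrightarrow> 0) (at_right 0)" if "j < p - m" for j
      using V(3)[of j] P[OF that] that pm by simp
  qed auto
  then have "pbd (real (p - m) - real p) (\<lambda>x. V 0 x / of_real (c x))"
    by (rule pbd_divide_c)
  then have "pbd (ex m) (\<lambda>x. V 0 x / of_real (c x))"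
    by (rule pbd_mono) (auto simp: ex_def)
  moreover have "continuous_on {0<..<1} (\<lambda>x. V 0 x / of_real (c x))"
    using m c_nonzero by (intro continuous_intros c_cont deriv_imp_continuous_on[OF V(2)]) auto
  ultimately obtain Z where Z: "Z m = (\<lambda>x. V 0 x / of_real (c x))"
    "\<forall>k<m. (\<forall>x\<in>{0<..<1}. (Z k has_vector_derivative Z (Suc k) x) (at x)) \<and>
    (if k < m - p then (Z k \<longlongrightarrow> Q k) (at_right 0) else Z k anchor = Q k) \<and> pbd (ex k) (Z k)"
    using solution_tower[of _ m Q] by blast
  have "chain P Q Z V" unfolding chain_def using V Z by auto
  moreover have "good (Z 0)"
  proof -
    have "pbd (ex 0) (Z 0)" "\<And>x. x \<in> {0<..<1} \<Longrightarrow> (Z 0 has_vector_derivative Z (Suc 0) x) (at x)"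
      using Z(2)[rule_format, of 0] m by auto
    then show ?thesis unfolding good_def ex_0 using deriv_imp_continuous_on by blast
  qed
  ultimately show ?thesis using V(1) by blast
qed

definition onesol :: "(nat \<Rightarrow> complex) \<Rightarrow> (nat \<Rightarrow> complex) \<Rightarrow> (real \<Rightarrow> complex) \<Rightarrow> bool"
  where "onesol P Q f \<longleftrightarrow> pbd (- 1 / 4) f \<and> (\<forall>j<p - m. P j = 0) \<and> (\<exists>Z V. chain P Q Z V \<and>
    (\<forall>x\<in>{0<..<1}. Z 0 x = f x) \<and> (\<forall>x\<in>{0<..<1}. V m x = lam * f x))"

lemma onesol_linear:
  assumes "onesol P Q f" "onesol P' Q' f'"
  shows "onesol (\<lambda>j. P j + a * P' j) (\<lambda>j. Q j + a * Q' j) (\<lambda>x. f x + a * f' x)"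
proof -
  obtain Z V Z' V' where 1: "chain P Q Z V" "\<forall>x\<in>{0<..<1}. Z 0 x = f x" "\<forall>x\<in>{0<..<1}. V m x = lam * f x"
    "chain P' Q' Z' V'" "\<forall>x\<in>{0<..<1}. Z' 0 x = f' x" "\<forall>x\<in>{0<..<1}. V' m x = lam * f' x"
    using assms unfolding onesol_def by blast
  show ?thesis
    unfolding onesol_def
    by (intro conjI exI[of _ "\<lambda>j x. Z j x + a * Z' j x"] exI[of _ "\<lambda>j x. V j x + a * V' j x"]
        chain_linear 1 pbd_add pbd_scale)
      (use assms 1 in \<open>auto simp: onesol_def algebra_simps\<close>)
qed

text \<open>Together with the next bound: for the fixed anchor the weight and x^(-1/4) are
  comparable on (0,1), so weighted bounds describe the same functions and differ only in
  constants.\<close>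

lemma powr_le_wt: "x \<in> {0<..<1} \<Longrightarrow> x powr (- 1 / 4) \<le> wt anchor (- 1 / 4) x"
proof (cases "x \<le> anchor")
  case False
  assume x: "x \<in> {0<..<1}"
  have "x powr (- 1 / 4) \<le> anchor powr (- 1 / 4)"
    using False anchor by (intro powr_mono2') auto
  also have "\<dots> \<le> anchor powr (- 1 / 4) * exp ((x - anchor) / anchor)"
    using mult_left_mono[of 1 "exp ((x - anchor) / anchor)" "anchor powr (- 1 / 4)"] False anchor by simp
  finally show ?thesis using False by (simp add: wt_def)
qed (simp add: wt_def)

lemma wt_le_powr: "x \<in> {0<..<1} \<Longrightarrow> wt anchor (- 1 / 4) x \<le> anchor powr (- 1 / 4) * exp (1 / anchor) * x powr (- 1 / 4)"
proof (cases "x \<le> anchor")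
  case True
  assume x: "x \<in> {0<..<1}"
  have "1 \<le> anchor powr (- 1 / 4)" using powr_mono'[of "-1/4" 0 anchor] anchor by simp
  moreover have "1 \<le> exp (1 / anchor)" using anchor by simp
  ultimately have "1 * 1 \<le> anchor powr (- 1 / 4) * exp (1 / anchor)" by (intro mult_mono) auto
  then show ?thesis
    using True mult_right_mono[of 1 "anchor powr (- 1 / 4) * exp (1 / anchor)" "x powr (- 1 / 4)"]
    by (simp add: wt_def)
next
  case False
  assume x: "x \<in> {0<..<1}"
  have "1 \<le> x powr (- 1 / 4)" using powr_mono'[of "-1/4" 0 x] x by simp
  moreover have "exp ((x - anchor) / anchor) \<le> exp (1 / anchor)"
    using x anchor by (simp add: divide_right_mono)
  ultimately have "anchor powr (- 1 / 4) * exp ((x - anchor) / anchor) * 1 \<le> anchor powr (- 1 / 4) * exp (1 / anchor) * x powr (- 1 / 4)"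
    by (intro mult_mono) auto
  then show ?thesis using False by (simp add: wt_def)
qed

lemma pbd_imp_wbd:
  assumes "pbd (- 1 / 4) f" obtains M where "0 \<le> M" "wbd anchor (- 1 / 4) M f"
proof -
  obtain C where C: "C \<ge> 0" "\<And>x. x \<in> {0<..<1} \<Longrightarrow> norm (f x) \<le> C * x powr (- 1 / 4)"
    using assms unfolding pbd_def by auto
  have "norm (f x) \<le> C * wt anchor (- 1 / 4) x" if "x \<in> {0<..<1}" for x
    using C(2)[OF that] mult_left_mono[OF powr_le_wt[OF that] C(1)] by linarith
  with C(1) that show thesis unfolding wbd_def by blast
qed

lemma wbd_imp_pbd:
  assumes "wbd anchor (- 1 / 4) M f" "0 \<le> M" shows "pbd (- 1 / 4) f"
proof -
  have "norm (f x) \<le> M * (anchor powr (- 1 / 4) * exp (1 / anchor)) * x powr (- 1 / 4)" if "x \<in> {0<..<1}" for x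
    using wbdD[OF assms(1) that] mult_left_mono[OF wt_le_powr[OF that] assms(2)] by (simp add: mult.assoc)
  moreover have "0 \<le> M * (anchor powr (- 1 / 4) * exp (1 / anchor))" using assms(2) by simp
  ultimately show ?thesis unfolding pbd_def by blast
qed

theorem onesol_exists:
  assumes P: "\<And>j. j < p - m \<Longrightarrow> P j = 0"
  shows "\<exists>f. onesol P Q f"
proof -
  \<comment> \<open>The Picard map is obtained by choice, with arbitrary values outside the class
    \<open>good\<close>; only the data of the chosen chains matter below.\<close>
  have "\<forall>g. \<exists>h. good g \<longrightarrow> good h \<and> (\<exists>Z V. chain P Q Z V \<and> V m = (\<lambda>x. lam * g x) \<and> Z 0 = h)"
  proof
    fix g show "\<exists>h. good g \<longrightarrow> good h \<and> (\<exists>Z V. chain P Q Z V \<and> V m = (\<lambda>x. lam * g x) \<and> Z 0 = h)"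
      using chain_exists[where g=g and Q=Q, OF _ P] by (cases "good g") auto
  qed
  then have "\<exists>\<Phi>. \<forall>g. good g \<longrightarrow> good (\<Phi> g) \<and> (\<exists>Z V. chain P Q Z V \<and> V m = (\<lambda>x. lam * g x) \<and> Z 0 = \<Phi> g)"
    by (rule choice)
  then obtain \<Phi> where \<Phi>0: "\<forall>g. good g \<longrightarrow> good (\<Phi> g) \<and> (\<exists>Z V. chain P Q Z V \<and> V m = (\<lambda>x. lam * g x) \<and> Z 0 = \<Phi> g)" ..
  have \<Phi>: "good (\<Phi> g)" "\<exists>Z V. chain P Q Z V \<and> V m = (\<lambda>x. lam * g x) \<and> Z 0 = \<Phi> g" if "good g" for g
    using \<Phi>0[rule_format, OF that] by simp_all
  \<comment> \<open>Both images have the data \<open>P\<close> and \<open>Q\<close>, so their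
    difference has data 0.\<close>
  have contr: "wbd anchor (- 1 / 4) (M / 2) (\<lambda>x. \<Phi> g x - \<Phi> h x)"
    if gh: "good g" "good h" "0 \<le> M" "wbd anchor (- 1 / 4) M (\<lambda>x. g x - h x)" for g h M
  proof -
    obtain Z V Z' V' where 1: "chain P Q Z V" "V m = (\<lambda>x. lam * g x)" "Z 0 = \<Phi> g"
      "chain P Q Z' V'" "V' m = (\<lambda>x. lam * h x)" "Z' 0 = \<Phi> h"
      using \<Phi>(2)[OF gh(1)] \<Phi>(2)[OF gh(2)] by blast
    have "wbd anchor (- 1 / 4) (M / 2) (\<lambda>x. Z 0 x + (- 1) * Z' 0 x)"
    proof (rule chain_contraction[OF _ _ gh(4,3)])
      show "chain (\<lambda>_. 0) (\<lambda>_. 0) (\<lambda>j x. Z j x + (- 1) * Z' j x) (\<lambda>j x. V j x + (- 1) * V' j x)"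
        using chain_linear[OF 1(1) 1(4), of "- 1"] by simp
    qed (simp add: 1 algebra_simps)
    then show ?thesis by (simp add: 1)
  qed
  define f where "f n = (\<Phi> ^^ n) (\<lambda>_. 0)" for n
  have f_Suc: "f (Suc n) = \<Phi> (f n)" for n by (simp add: f_def)
  have "good (\<lambda>_. 0)" by (auto simp: good_def pbd_def intro!: exI[of _ 0])
  then have good_f: "good (f n)" for n by (induction n) (auto simp: f_def \<Phi>(1))
  obtain M where M: "0 \<le> M" "wbd anchor (- 1 / 4) M (f 1)"
    using pbd_imp_wbd good_f[of 1] unfolding good_def by blast
  have step: "wbd anchor (- 1 / 4) (M / 2 ^ n) (\<lambda>x. f (Suc n) x - f n x)" for n
  proof (induction n)
    case 0
    then show ?case using M by (simp add: f_def)
  next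
    case (Suc n)
    from contr[OF good_f good_f _ Suc] show ?case using M by (simp add: f_Suc mult.commute)
  qed
  have "\<exists>l. \<forall>n. norm (l - f n x) \<le> 2 * (M * wt anchor (- 1 / 4) x) / 2 ^ n" if "x \<in> {0<..<1}" for x
  proof -
    have "norm (f (Suc n) x - f n x) \<le> M * wt anchor (- 1 / 4) x / 2 ^ n" for n
      using wbdD[OF step that, of n] by simp
    from geometric_increments_converge[of "\<lambda>n. f n x", OF this] show ?thesis by blast
  qed
  then obtain F where F: "\<And>x n. x \<in> {0<..<1} \<Longrightarrow> norm (F x - f n x) \<le> 2 * (M * wt anchor (- 1 / 4) x) / 2 ^ n"
    by metis
  have wF: "wbd anchor (- 1 / 4) (2 * M / 2 ^ n) (\<lambda>x. F x - f n x)" for n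
    using F by (auto simp: wbd_def mult.assoc)
  have pF: "pbd (- 1 / 4) F"
  proof -
    have "wbd anchor (- 1 / 4) (2 * M) F" using wF[of 0] by (simp add: f_def)
    then show ?thesis by (rule wbd_imp_pbd) (use M in simp)
  qed
  \<comment> \<open>The weight is unbounded at 0, so the bounds give uniform convergence only away
    from 0; that suffices for continuity at each point.\<close>
  have cF: "continuous_on {0<..<1} F"
  proof -
    have "continuous_on {a<..<1} F" if a: "0 < a" "a < 1" for a
    proof (rule uniform_limit_theorem)
      define W where "W = 2 * M * (anchor powr (- 1 / 4) * exp (1 / anchor) * a powr (- 1 / 4))"
      have b: "norm (F x - f n x) \<le> W / 2 ^ n" if x: "x \<in> {a<..<1}" for x n
      proof -
        have "wt anchor (- 1 / 4) x \<le> anchor powr (- 1 / 4) * exp (1 / anchor) * x powr (- 1 / 4)"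
          using x a by (intro wt_le_powr) auto
        also have "\<dots> \<le> anchor powr (- 1 / 4) * exp (1 / anchor) * a powr (- 1 / 4)"
          using x a by (intro mult_left_mono powr_mono2') auto
        finally have "2 * M * wt anchor (- 1 / 4) x / 2 ^ n \<le> W / 2 ^ n"
          unfolding W_def using M by (intro divide_right_mono mult_left_mono) auto
        then show ?thesis using F[of x n] x a by (simp add: mult.assoc)
      qed
      have lim: "(\<lambda>n. W / 2 ^ n) \<longlonglongrightarrow> 0"
        by (rule tendsto_divide_power2)
      show "uniform_limit {a<..<1} f F sequentially"
      proof (rule uniform_limitI)
        fix e :: real assume "0 < e"
        with lim have "eventually (\<lambda>n. W / 2 ^ n < e) sequentially"
          by (rule order_tendstoD(2))
        then show "eventually (\<lambda>n. \<forall>x\<in>{a<..<1}. dist (f n x) (F x) < e) sequentially"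
          by eventually_elim (auto simp: dist_norm norm_minus_commute intro: le_less_trans[OF b])
      qed
      show "eventually (\<lambda>n. continuous_on {a<..<1} (f n)) sequentially"
      proof (intro always_eventually allI)
        fix n show "continuous_on {a<..<1} (f n)"
          by (rule continuous_on_subset[of "{0<..<1}"]) (use good_f[of n] a in \<open>auto simp: good_def\<close>)
      qed
    qed simp
    then have "isCont F x" if "x \<in> {0<..<1}" for x
      using continuous_on_interior[of "{x / 2<..<1}" F x] that by (auto simp: interior_open)
    then show ?thesis by (simp add: continuous_at_imp_continuous_on)
  qed
  have gF: "good F" using pF cF by (simp add: good_def)
  \<comment> \<open>\<open>F\<close> and \<open>\<Phi> F\<close> are both within a multiple of
    2^(-n) of the iterate \<open>f (Suc n)\<close>.\<close>
  have fixp: "\<Phi> F x = F x" if x: "x \<in> {0<..<1}" for x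
  proof -
    define B where "B = 4 * M * wt anchor (- 1 / 4) x"
    have "norm (\<Phi> F x - F x) \<le> B / 2 ^ n" for n
    proof -
      have "norm (\<Phi> F x - f (Suc n) x) \<le> (2 * M / 2 ^ n) / 2 * wt anchor (- 1 / 4) x"
        using wbdD[OF contr[OF gF good_f _ wF] x, of n] M by (simp add: f_Suc)
      moreover have "norm (F x - f (Suc n) x) \<le> (2 * M / 2 ^ n) / 2 * wt anchor (- 1 / 4) x"
        using wbdD[OF wF x, of "Suc n"] by simp
      ultimately have "norm (\<Phi> F x - F x) \<le> (2 * M / 2 ^ n) * wt anchor (- 1 / 4) x"
        using norm_triangle_ineq4[of "\<Phi> F x - f (Suc n) x" "F x - f (Suc n) x"] by simp
      also have "\<dots> \<le> B / 2 ^ n"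
        using M wt_nonneg[of anchor "-1/4" x] by (simp add: B_def divide_right_mono mult_right_mono)
      finally show ?thesis .
    qed
    moreover have "(\<lambda>n. B / 2 ^ n) \<longlonglongrightarrow> 0"
      by (rule tendsto_divide_power2)
    ultimately have "norm (\<Phi> F x - F x) \<le> 0" by (intro LIMSEQ_le_const) auto
    then show ?thesis by simp
  qed
  obtain Z V where ZV: "chain P Q Z V" "V m = (\<lambda>x. lam * F x)" "Z 0 = \<Phi> F" using \<Phi>(2)[OF gF] by blast
  then have "onesol P Q F"
    unfolding onesol_def using pF P by (intro conjI exI[of _ Z] exI[of _ V]) (auto simp: fixp)
  then show ?thesis by blast
qed

text \<open>A solution with data 0 is its own Picard image, so its weighted bound can be halved
  indefinitely.\<close>

theorem onesol_unique:
  assumes "onesol (\<lambda>_. 0) (\<lambda>_. 0) f" "x \<in> {0<..<1}"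
  shows "f x = 0"
proof -
  obtain Z V where 1: "chain (\<lambda>_. 0) (\<lambda>_. 0) Z V" "\<And>x. x \<in> {0<..<1} \<Longrightarrow> Z 0 x = f x"
    "\<And>x. x \<in> {0<..<1} \<Longrightarrow> V m x = lam * f x" "pbd (- 1 / 4) f"
    using assms unfolding onesol_def by blast
  obtain M where M: "0 \<le> M" "wbd anchor (- 1 / 4) M f" using pbd_imp_wbd[OF 1(4)] .
  have w: "wbd anchor (- 1 / 4) (M / 2 ^ n) f" for n
  proof (induction n)
    case (Suc n)
    have "wbd anchor (- 1 / 4) (M / 2 ^ n / 2) (Z 0)"
      by (rule chain_contraction[OF 1(1,3) Suc]) (use M in auto)
    then show ?case using 1(2) by (simp add: wbd_def mult.commute)
  qed (use M in simp)
  have "(\<lambda>n. M * wt anchor (- 1 / 4) x / 2 ^ n) \<longlonglongrightarrow> 0"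
    by (rule tendsto_divide_power2)
  then have "norm (f x) \<le> 0"
    by (rule LIMSEQ_le_const) (use wbdD[OF w assms(2)] in auto)
  then show ?thesis by simp
qed

lemma vector_derivative_zero_fun:
  assumes "(F has_vector_derivative d) (at x)" "x \<in> {0<..<1}" "\<And>x. x \<in> {0<..<1} \<Longrightarrow> F x = 0"
  shows "d = (0 :: complex)"
proof -
  have "((\<lambda>_. 0) has_vector_derivative d) (at x)"
    by (rule has_vector_derivative_transform_within_open[OF assms(1), of "{0<..<1}"]) (use assms in auto)
  from vector_derivative_unique_at[OF this has_vector_derivative_const] show ?thesis .
qed

text \<open>The converse of uniqueness: distinct data give distinct solutions. All derivatives of
  the zero function vanish, hence so does \<open>V 0\<close>, which is \<open>c\<close> times the
  last of them, and with it every \<open>V k\<close>.\<close>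

theorem onesol_data_unique:
  assumes "onesol P Q f" "\<And>x. x \<in> {0<..<1} \<Longrightarrow> f x = 0" "j < m"
  shows "P j = 0" "Q j = 0"
proof -
  obtain Z V where 1: "chain P Q Z V" "\<And>x. x \<in> {0<..<1} \<Longrightarrow> Z 0 x = f x"
    using assms unfolding onesol_def by blast
  have Z: "k \<le> m \<Longrightarrow> \<forall>x\<in>{0<..<1}. Z k x = 0" for k
  proof (induction k)
    case (Suc k)
    then show ?case using vector_derivative_zero_fun[OF chainD(1)[OF 1(1)]] by auto
  qed (use 1 assms in auto)
  have V: "k \<le> m \<Longrightarrow> \<forall>x\<in>{0<..<1}. V k x = 0" for k
  proof (induction k)
    case 0
    then show ?case using chainD(2)[OF 1(1)] Z[of m] c_nonzero by auto
  next
    case (Suc k)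
    then show ?case using vector_derivative_zero_fun[OF chainD(3)[OF 1(1)]] by auto
  qed
  have lim: "L = 0" if "(F \<longlongrightarrow> L) (at_right 0)" "\<forall>x\<in>{0<..<1}. F x = 0" for F :: "real \<Rightarrow> complex" and L
  proof (rule tendsto_unique[OF _ that(1)])
    have "eventually (\<lambda>x. 0 = F x) (at_right 0)"
      using that(2) unfolding eventually_at_right_field by (intro exI[of _ 1]) auto
    then show "(F \<longlongrightarrow> 0) (at_right 0)" by (rule Lim_transform_eventually[OF tendsto_const])
  qed simp
  show "P j = 0" using lim[OF chainD(4)[OF 1(1) assms(3)]] V[of j] assms by simp
  show "Q j = 0"
    using lim[OF chainD(5)[OF 1(1) assms(3)]] chainD(6)[OF 1(1) assms(3)] Z[of j] assms(3) anchor
    by (cases "j < m - p") auto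
qed

end

section \<open>Auxiliary limits and jets\<close>

lemma derivs_unique:
  assumes "derivs D S" "derivs E S" "open S" "\<And>x. x \<in> S \<Longrightarrow> D 0 x = E 0 x" "x \<in> S"
  shows "D k x = E k x"
  using nth_deriv_eqI[OF assms(1,3), of "D 0" x k] nth_deriv_eqI[OF assms(2,3), of "D 0" x k] assms(4,5)
  by simp

lemma DERIV_inverse_power_Suc:
  fixes z :: "'a :: real_normed_field"
  assumes "z \<noteq> 0"
  shows "((\<lambda>z. inverse (z ^ Suc n)) has_field_derivative - (of_nat (Suc n) / z ^ (n + 2))) (at z)"
proof -
  have "((\<lambda>z. inverse (z ^ Suc n)) has_field_derivative
      - ((1 + of_nat n) * (1 * z ^ n) * inverse ((z ^ Suc n) ^ Suc (Suc 0)))) (at z)"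
    by (rule DERIV_inverse_fun[OF DERIV_power_Suc[OF DERIV_ident]]) (use assms in simp)
  moreover have "(1 + of_nat n) * (1 * z ^ n) * inverse ((z ^ Suc n) ^ Suc (Suc 0)) = of_nat (Suc n) / z ^ (n + 2)"
    using assms by (simp add: field_simps)
  ultimately show ?thesis by simp
qed

text \<open>The n-th derivative of 1/A is N_n / A^(n+1) with numerators N_(n+1) = A N_n' - (n+1) A'
  N_n. Each numerator is built as a whole derivative family, since the next one needs its
  derivative.\<close>

lemma derivs_reciprocal:
  assumes A: "derivs A S" and nz: "\<And>x. x \<in> S \<Longrightarrow> A 0 x \<noteq> 0"
  shows "\<exists>R. derivs R S \<and> (\<forall>x. R 0 x = 1 / A 0 x)"
proof -
  define N where "N = rec_nat (\<lambda>k x. if k = 0 then 1 else 0)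
    (\<lambda>n E k x. leibniz (\<lambda>k. E (k + 1)) A k x + (- of_nat (Suc n)) * leibniz E (\<lambda>k. A (k + 1)) k x)"
  have N_Suc: "N (Suc n) = (\<lambda>k x. leibniz (\<lambda>k. N n (k + 1)) A k x + (- of_nat (Suc n)) * leibniz (N n) (\<lambda>k. A (k + 1)) k x)" for n
    by (simp add: N_def)
  have N_0: "N 0 = (\<lambda>k x. if k = 0 then 1 else 0)" by (simp add: N_def)
  have N: "derivs (N n) S" for n
  proof (induction n)
    case 0
    show ?case by (auto simp: N_0 derivs_def)
  next
    case (Suc n)
    show ?case unfolding N_Suc
      by (intro derivs_add derivs_scale derivs_leibniz derivs_shift[OF Suc] derivs_shift[OF A] Suc A)
  qed
  define R where "R n x = N n 0 x / A 0 x ^ Suc n" for n x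
  have "(R n has_vector_derivative R (Suc n) x) (at x)" if x: "x \<in> S" for n x
  proof -
    have a: "((\<lambda>z. inverse (z ^ Suc n)) has_field_derivative - (of_nat (Suc n) / A 0 x ^ (n + 2))) (at (A 0 x))"
      by (rule DERIV_inverse_power_Suc[OF nz[OF x]])
    have "((\<lambda>x. N n 0 x * inverse (A 0 x ^ Suc n)) has_vector_derivative
      N n 0 x * (A (Suc 0) x * - (of_nat (Suc n) / A 0 x ^ (n + 2))) + N n (Suc 0) x * inverse (A 0 x ^ Suc n)) (at x)"
      using field_vector_diff_chain_at[OF derivsD[OF A x, of 0] a]
      by (intro has_vector_derivative_mult derivsD[OF N x]) (simp add: o_def)
    moreover have "N n 0 x * (A (Suc 0) x * - (of_nat (Suc n) / A 0 x ^ (n + 2))) + N n (Suc 0) x * inverse (A 0 x ^ Suc n)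
        = R (Suc n) x"
      using nz[OF x] by (simp add: R_def N_Suc field_simps)
    ultimately show ?thesis unfolding R_def[abs_def] by (simp add: divide_inverse)
  qed
  then have "derivs R S" by (simp add: derivs_def)
  moreover have "R 0 x = 1 / A 0 x" for x by (simp add: R_def N_0)
  ultimately show ?thesis by blast
qed

text \<open>L'Hopital's rule for \<open>F\<close> over x^(-(n+1)), whose derivative is -(n+1)
  x^(-(n+2)). Only the denominator has to tend to infinity, so it applies also when L = 0.\<close>

lemma lhopital_power:
  fixes F f :: "real \<Rightarrow> real"
  assumes F: "\<And>x. x \<in> {0<..<1} \<Longrightarrow> (F has_real_derivative f x) (at x)"
    and lim: "((\<lambda>x. x ^ Suc (Suc n) * f x) \<longlongrightarrow> L) (at_right 0)"
  shows "((\<lambda>x. x ^ Suc n * F x) \<longlongrightarrow> - L / Suc n) (at_right 0)"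
proof -
  have ev: "eventually (\<lambda>x. x \<in> {0<..<1}) (at_right (0::real))"
    by (auto simp: eventually_at_right_field intro!: exI[of _ 1])
  have "((\<lambda>x. F x / inverse (x ^ Suc n)) \<longlongrightarrow> - L / Suc n) (at_right 0)"
  proof (rule lhopital_right_0_at_top)
    have "((\<lambda>x::real. x ^ Suc n) \<longlongrightarrow> 0 ^ Suc n) (at_right 0)"
      by (intro tendsto_intros)
    then show "LIM x at_right 0. inverse (x ^ Suc n :: real) :> at_top"
      by (intro filterlim_inverse_at_top eventually_mono[OF ev]) auto
    show "eventually (\<lambda>x. - (real (Suc n) / x ^ Suc (Suc n)) \<noteq> 0) (at_right 0)"
      by (rule eventually_mono[OF ev]) (auto simp del: of_nat_Suc)
    show "eventually (\<lambda>x. (F has_real_derivative f x) (at x)) (at_right 0)"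
      by (rule eventually_mono[OF ev F])
    show "eventually (\<lambda>x. ((\<lambda>x. inverse (x ^ Suc n)) has_real_derivative - (real (Suc n) / x ^ Suc (Suc n))) (at x)) (at_right 0)"
    proof (rule eventually_mono[OF ev])
      show "((\<lambda>x. inverse (x ^ Suc n)) has_real_derivative - (real (Suc n) / x ^ Suc (Suc n))) (at x)"
        if "x \<in> {0<..<1}" for x
        using DERIV_inverse_power_Suc[of x n] that by (simp del: of_nat_Suc)
    qed
    have "((\<lambda>x. - (x ^ Suc (Suc n) * f x) / Suc n) \<longlongrightarrow> - L / Suc n) (at_right 0)"
      by (intro tendsto_intros lim) simp
    then show "((\<lambda>x. f x / - (real (Suc n) / x ^ Suc (Suc n))) \<longlongrightarrow> - L / Suc n) (at_right 0)"
      by (rule Lim_transform_eventually)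
        (use eventually_mono[OF ev] in \<open>auto simp: field_simps simp del: of_nat_Suc power_Suc\<close>)
  qed
  then show ?thesis by (simp add: divide_inverse mult.commute del: power_Suc inverse_mult_distrib of_nat_Suc)
qed

lemma lhopital_power_complex:
  fixes F f :: "real \<Rightarrow> complex"
  assumes F: "\<And>x. x \<in> {0<..<1} \<Longrightarrow> (F has_vector_derivative f x) (at x)"
    and lim: "((\<lambda>x. of_real x ^ Suc (Suc n) * f x) \<longlongrightarrow> L) (at_right 0)"
  shows "((\<lambda>x. of_real x ^ Suc n * F x) \<longlongrightarrow> - L / of_nat (Suc n)) (at_right 0)"
proof -
  have Re: "((\<lambda>x. x ^ Suc n * Re (F x)) \<longlongrightarrow> - Re L / Suc n) (at_right 0)"
  proof (rule lhopital_power)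
    show "((\<lambda>x. Re (F x)) has_real_derivative Re (f x)) (at x)" if "x \<in> {0<..<1}" for x
      using bounded_linear.has_vector_derivative[OF bounded_linear_Re F[OF that]]
      by (simp add: has_real_derivative_iff_has_vector_derivative)
    show "((\<lambda>x. x ^ Suc (Suc n) * Re (f x)) \<longlongrightarrow> Re L) (at_right 0)"
      using tendsto_Re[OF lim] by (simp flip: of_real_power of_real_mult)
  qed
  have Im: "((\<lambda>x. x ^ Suc n * Im (F x)) \<longlongrightarrow> - Im L / Suc n) (at_right 0)"
  proof (rule lhopital_power)
    show "((\<lambda>x. Im (F x)) has_real_derivative Im (f x)) (at x)" if "x \<in> {0<..<1}" for x
      using bounded_linear.has_vector_derivative[OF bounded_linear_Im F[OF that]]
      by (simp add: has_real_derivative_iff_has_vector_derivative)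
    show "((\<lambda>x. x ^ Suc (Suc n) * Im (f x)) \<longlongrightarrow> Im L) (at_right 0)"
      using tendsto_Im[OF lim] by (simp flip: of_real_power of_real_mult)
  qed
  show ?thesis
    unfolding tendsto_complex_iff using Re Im
    by (simp del: of_nat_Suc add: Re_divide_of_nat Im_divide_of_nat flip: of_real_power of_real_mult)
qed

text \<open>Otherwise |f| \<ge> d/x near 0, and the integral of d/x diverges
  logarithmically.\<close>

lemma not_integrable_pole:
  fixes f :: "real \<Rightarrow> complex"
  assumes f: "f absolutely_integrable_on {0..1}"
    and lim: "((\<lambda>x. of_real x ^ Suc n * f x) \<longlongrightarrow> L) (at_right 0)"
  shows "L = 0"
proof (rule ccontr)
  assume L: "L \<noteq> 0"
  define d where "d = norm L / 2"
  have d: "0 < d" using L by (simp add: d_def)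
  have "((\<lambda>x. norm (of_real x ^ Suc n * f x)) \<longlongrightarrow> norm L) (at_right 0)"
    by (intro tendsto_norm lim)
  then have "eventually (\<lambda>x. d < norm (of_real x ^ Suc n * f x)) (at_right 0)"
    by (rule order_tendstoD(1)) (use L in \<open>simp add: d_def\<close>)
  then obtain b where b: "0 < b" "\<And>x. 0 < x \<Longrightarrow> x < b \<Longrightarrow> d < norm (of_real x ^ Suc n * f x)"
    unfolding eventually_at_right_field by auto
  define h where "h = min (b / 2) (1 / 2)"
  have h: "0 < h" "h < b" "h < 1" using b by (auto simp: h_def)
  have ge: "d / x \<le> norm (f x)" if "0 < x" "x \<le> h" for x
  proof -
    have "d < x ^ Suc n * norm (f x)" using b(2)[of x] that h by (simp add: norm_mult norm_power)
    also have "\<dots> \<le> x * norm (f x)"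
      using that h power_le_one[of x n] by (intro mult_right_mono) (auto simp: mult_left_le)
    finally show ?thesis using that by (simp add: field_simps)
  qed
  have nf: "(\<lambda>x. norm (f x)) integrable_on {0..1}"
    using f by (simp add: absolutely_integrable_on_def)
  define J where "J = integral {0..1} (\<lambda>x. norm (f x))"
  have "d * (ln h - ln x) \<le> J" if x: "0 < x" "x \<le> h" for x
  proof -
    have "((\<lambda>t. d / t) has_integral d * ln h - d * ln x) {x..h}"
      by (rule fundamental_theorem_of_calculus[OF x(2)])
        (use x in \<open>auto intro!: derivative_eq_intros simp flip: has_real_derivative_iff_has_vector_derivative\<close>)
    then have "d * (ln h - ln x) = integral {x..h} (\<lambda>t. d / t)" "(\<lambda>t. d / t) integrable_on {x..h}"
      by (auto simp: integral_unique right_diff_distrib)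
    moreover have "integral {x..h} (\<lambda>t. d / t) \<le> integral {x..h} (\<lambda>t. norm (f t))"
      by (rule integral_le) (use calculation(2) ge x h in \<open>auto intro: integrable_on_subinterval[OF nf]\<close>)
    moreover have "integral {x..h} (\<lambda>t. norm (f t)) \<le> J"
      unfolding J_def
      by (rule integral_subset_le) (use x h in \<open>auto intro: integrable_on_subinterval[OF nf] nf\<close>)
    ultimately show ?thesis by simp
  qed
  \<comment> \<open>The point x = h exp(-(J + 1)/d) makes d (ln h - ln x) equal to J + 1; the sign
    of \<open>J\<close> ensures x \<le> h.\<close>
  moreover have "0 \<le> J" unfolding J_def by (rule integral_nonneg[OF nf]) auto
  then have "- (J + 1) / d \<le> 0" using d by (intro divide_nonpos_pos) auto
  then have "exp (- (J + 1) / d) \<le> 1" by simp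
  then have "h * exp (- (J + 1) / d) \<le> h" using mult_left_mono[of "exp (- (J + 1) / d)" 1 h] h by linarith
  ultimately have "d * (ln h - ln (h * exp (- (J + 1) / d))) \<le> J"
    using h by simp
  moreover have "ln (h * exp (- (J + 1) / d)) = ln h - (J + 1) / d"
    using h by (subst ln_mult) (auto simp: minus_divide_left)
  ultimately show False using d by simp
qed

lemma pbd_imp_tendsto_0:
  assumes "pbd \<alpha> f" "0 < \<alpha>" shows "(f \<longlongrightarrow> 0) (at_right 0)"
proof -
  obtain C where C: "C \<ge> 0" "\<And>x. x \<in> {0<..<1} \<Longrightarrow> norm (f x) \<le> C * x powr \<alpha>"
    using assms unfolding pbd_def by auto
  have "((\<lambda>x. C * x powr \<alpha>) \<longlongrightarrow> C * 0 powr \<alpha>) (at_right 0)"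
    using assms(2) by (intro tendsto_intros) (auto simp: eventually_at_right_field intro!: exI[of _ 1])
  then have lim: "((\<lambda>x. C * x powr \<alpha>) \<longlongrightarrow> 0) (at_right 0)" using assms(2) by simp
  show ?thesis
    by (rule Lim_null_comparison[OF _ lim]) (use C(2) in \<open>auto simp: eventually_at_right_field intro!: exI[of _ 1]\<close>)
qed

lemma pbd_mult:
  assumes "pbd \<alpha> f" "pbd \<beta> g" shows "pbd (\<alpha> + \<beta>) (\<lambda>x. f x * g x)"
proof -
  obtain C B where C: "C \<ge> 0" "\<And>x. x \<in> {0<..<1} \<Longrightarrow> norm (f x) \<le> C * x powr \<alpha>"
    and B: "B \<ge> 0" "\<And>x. x \<in> {0<..<1} \<Longrightarrow> norm (g x) \<le> B * x powr \<beta>"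
    using assms unfolding pbd_def by auto
  have "norm (f x * g x) \<le> C * B * x powr (\<alpha> + \<beta>)" if "x \<in> {0<..<1}" for x
    using mult_mono[OF C(2)[OF that] B(2)[OF that]] C(1) by (simp add: norm_mult powr_add mult_ac)
  then show ?thesis unfolding pbd_def using C(1) B(1) by (meson mult_nonneg_nonneg)
qed

lemma continuous_imp_pbd:
  fixes f :: "real \<Rightarrow> complex"
  assumes "continuous_on {0..1} f" shows "pbd 0 f"
proof -
  have "bounded (f ` {0..1})"
    by (intro compact_imp_bounded compact_continuous_image assms compact_Icc)
  then obtain B where "B > 0" "\<And>x. x \<in> {0..1} \<Longrightarrow> norm (f x) \<le> B"
    unfolding bounded_pos by blast
  then show ?thesis unfolding pbd_def by (intro exI[of _ B]) auto
qed

text \<open>Taylor's estimate, obtained by integrating down from the bounded function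
  \<open>D p\<close>; for n > p truncated subtraction leaves mere boundedness.\<close>

lemma jet_order_at_0:
  assumes D: "derivs D UNIV" and z: "\<And>i. i < p \<Longrightarrow> D i 0 = 0"
  shows "pbd (real (p - n)) (D n)"
proof -
  have cont: "continuous_on S (D k)" for k S
    by (rule derivs_continuous_on[OF derivs_subset[OF D]]) auto
  have "i \<le> p \<Longrightarrow> pbd (real i) (D (p - i))" for i
  proof (induction i)
    case 0
    show ?case using continuous_imp_pbd[OF cont] by simp
  next
    case (Suc i)
    then have eq: "p - i = Suc (p - Suc i)" by simp
    have "pbd (real i + 1) (D (p - Suc i))"
    proof (rule pbd_antideriv_high)
      show "(D (p - Suc i) has_vector_derivative D (p - i) x) (at x)" for x
        unfolding eq by (rule derivsD[OF D]) simp
      have "isCont (D (p - Suc i)) 0"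
        using cont[of UNIV] by (simp add: continuous_on_eq_continuous_at)
      then show "(D (p - Suc i) \<longlongrightarrow> 0) (at_right 0)"
        using z[of "p - Suc i"] Suc.prems by (simp add: isCont_def filterlim_at_split)
    qed (use Suc in auto)
    then show ?case by (simp add: add.commute)
  qed
  from this[of "p - n"] show ?thesis
  proof (cases "n \<le> p")
    case False
    then show ?thesis using continuous_imp_pbd[OF cont, of n] by simp
  qed auto
qed

text \<open>Lagrange's bilinear concomitant: by the alternating signs the inner terms of the product
  rule telescope.\<close>

lemma alternating_pairing_derivative:
  fixes F G :: "nat \<Rightarrow> real \<Rightarrow> complex"
  assumes F: "\<And>k. k < m \<Longrightarrow> (F k has_vector_derivative F (Suc k) x) (at x)"
    and G: "\<And>k. k < m \<Longrightarrow> (G k has_vector_derivative G (Suc k) x) (at x)"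
  shows "((\<lambda>x. \<Sum>k<m. (-1) ^ k * F (m - 1 - k) x * G k x) has_vector_derivative
    F m x * G 0 x - (-1) ^ m * F 0 x * G m x) (at x)"
proof -
  have "((\<lambda>x. \<Sum>k<m. (-1) ^ k * (F (m - 1 - k) x * G k x)) has_vector_derivative
    (\<Sum>k<m. (-1) ^ k * (F (m - 1 - k) x * G (Suc k) x + F (Suc (m - 1 - k)) x * G k x))) (at x)"
    by (intro has_vector_derivative_sum has_vector_derivative_mult_right has_vector_derivative_mult F G) auto
  moreover have "(\<Sum>k<m. (-1) ^ k * (F (m - 1 - k) x * G (Suc k) x + F (Suc (m - 1 - k)) x * G k x))
    = (\<Sum>k<m. (-1) ^ k * F (m - k) x * G k x - (-1) ^ Suc k * F (m - Suc k) x * G (Suc k) x)"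
    by (intro sum.cong refl) (auto simp: algebra_simps Suc_diff_Suc)
  moreover have "\<dots> = F m x * G 0 x - (-1) ^ m * F 0 x * G m x"
    by (subst sum_lessThan_telescope') simp
  ultimately show ?thesis by (simp add: mult.assoc)
qed

section \<open>Green's identity at the singular endpoint\<close>

lemma (in side) solution_bounds:
  assumes Z: "\<And>k x. k < m \<Longrightarrow> x \<in> {0<..<1} \<Longrightarrow> (Z k has_vector_derivative Z (Suc k) x) (at x)"
    and top: "pbd (ex m) (Z m)"
  shows "k \<le> m \<Longrightarrow> pbd (ex k) (Z k)"
proof -
  have "i \<le> m \<Longrightarrow> pbd (ex (m - i)) (Z (m - i))" for i
  proof (induction i)
    case (Suc i)
    define k where "k = m - Suc i"
    have k: "m - i = Suc k" "k < m" using Suc.prems by (auto simp: k_def)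
    have IH: "pbd (ex (Suc k)) (Z (Suc k))" using Suc k by simp
    have "pbd (ex k) (Z k)"
    proof (cases "k < m - p")
      case True
      have "pbd 0 (Z k)"
        by (rule pbd_antideriv_bounded[OF Z[OF k(2)] IH]) (use True in \<open>auto simp: ex_def\<close>)
      then show ?thesis by (rule pbd_mono) (simp add: ex_def)
    next
      case False
      have "pbd (ex (Suc k) + 1) (Z k)"
        by (rule pbd_antideriv_low[OF Z[OF k(2)] IH]) (use False in \<open>auto simp: ex_def Suc_diff_le\<close>)
      moreover have "ex (Suc k) + 1 = ex k" using False by (simp add: ex_def Suc_diff_le)
      ultimately show ?thesis by simp
    qed
    then show ?case by (simp add: k_def)
  qed (use top in simp)
  from this[of "m - k"] show "k \<le> m \<Longrightarrow> pbd (ex k) (Z k)" by simp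
qed

lemma (in side) quasi_bounds:
  assumes V: "\<And>j x. j < m \<Longrightarrow> x \<in> {0<..<1} \<Longrightarrow> (V j has_vector_derivative V (Suc j) x) (at x)"
    and top: "pbd (- 1 / 4) (V m)"
  shows "j < m \<Longrightarrow> pbd 0 (V j)"
proof -
  have "Suc i \<le> m \<Longrightarrow> pbd 0 (V (m - Suc i))" for i
  proof (induction i)
    case 0
    then have "m = Suc (m - Suc 0)" by simp
    then show ?case using pbd_antideriv_bounded[OF V[of "m - Suc 0"], of "- 1 / 4"] top 0 by simp
  next
    case (Suc i)
    then have eq: "m - Suc i = Suc (m - Suc (Suc i))" by simp
    show ?case using pbd_antideriv_bounded[OF V[of "m - Suc (Suc i)"], of 0] Suc eq by simp
  qed
  from this[of "m - Suc j"] show "j < m \<Longrightarrow> pbd 0 (V j)" by simp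
qed

lemma (in side) top_bound:
  assumes "pbd (real (p - m)) (V 0)" "\<And>x. x \<in> {0<..<1} \<Longrightarrow> Z m x = V 0 x / of_real (c x)"
  shows "pbd (ex m) (Z m)"
proof -
  have "pbd (real (p - m) - real p) (Z m)"
    by (rule pbd_cong[OF pbd_divide_c[OF assms(1)] assms(2)])
  then show ?thesis by (rule pbd_mono) (auto simp: ex_def)
qed

lemma continuous_antideriv_tower:
  fixes g :: "real \<Rightarrow> complex"
  assumes "continuous_on {a<..<b} g" "a < b"
  shows "\<exists>H. H n = g \<and> (\<forall>k<n. \<forall>x\<in>{a<..<b}. (H k has_vector_derivative H (Suc k) x) (at x))"
  using assms(1)
proof (induction n arbitrary: g)
  case 0
  then show ?case by auto
next
  case (Suc n)
  obtain G where G: "\<And>x. x \<in> {a<..<b} \<Longrightarrow> (G has_vector_derivative g x) (at x)"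
    using antiderivative_open_interval[OF Suc.prems assms(2)] by blast
  obtain H where H: "H n = G" "\<forall>k<n. \<forall>x\<in>{a<..<b}. (H k has_vector_derivative H (Suc k) x) (at x)"
    using Suc.IH[OF deriv_imp_continuous_on[OF G]] by blast
  show ?case
    by (rule exI[of _ "H(Suc n := g)"]) (use H G in \<open>auto simp: less_Suc_eq\<close>)
qed

text \<open>The j-th derivative of the polynomial with coefficients \<open>P k\<close>; the quotient
  of factorials is the falling factorial.\<close>

definition polysum :: "nat \<Rightarrow> (nat \<Rightarrow> complex) \<Rightarrow> nat \<Rightarrow> real \<Rightarrow> complex"
  where "polysum m P j x = (\<Sum>k<m. P k * (if j \<le> k then of_nat (fact k div fact (k - j)) * of_real x ^ (k - j) else 0))"

lemma polysum_derivative: "(polysum m P j has_vector_derivative polysum m P (Suc j) x) (at x)"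
proof -
  have "((\<lambda>x. if j \<le> k then of_nat (fact k div fact (k - j)) * of_real x ^ (k - j) else 0) has_vector_derivative
    (if Suc j \<le> k then of_nat (fact k div fact (k - Suc j)) * complex_of_real x ^ (k - Suc j) else 0)) (at x)" for k
  proof (cases "Suc j \<le> k")
    case True
    define i where "i = k - Suc j"
    have i: "k - j = Suc i" using True by (simp add: i_def)
    have f: "fact (Suc i) dvd (fact k :: nat)" "fact i dvd (fact k :: nat)"
      using True unfolding i_def by (auto intro!: fact_dvd simp del: fact_Suc)
    have "fact k div fact (Suc i) * Suc i = (fact k :: nat) div fact i"
    proof -
      obtain q where q: "(fact k :: nat) = fact (Suc i) * q" using f(1) by (auto elim: dvdE)
      have "fact k div fact (Suc i) = q" unfolding q by (rule nonzero_mult_div_cancel_left) (rule fact_nonzero)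
      moreover have "(fact k :: nat) = fact i * (Suc i * q)" unfolding q by (simp add: algebra_simps)
      then have "(fact k :: nat) div fact i = Suc i * q" by simp
      ultimately show ?thesis by (simp add: mult.commute)
    qed
    then have eq: "of_nat (fact k div fact (Suc i)) * of_nat (Suc i) = (of_nat (fact k div fact i) :: complex)"
      by (simp only: of_nat_mult[symmetric])
    have "((\<lambda>x. of_nat (fact k div fact (Suc i)) * complex_of_real x ^ Suc i) has_vector_derivative
      of_nat (fact k div fact (Suc i)) * ((1 + of_nat i) * (1 * complex_of_real x ^ i))) (at x)"
      by (intro has_vector_derivative_mult_right has_vector_derivative_real_field DERIV_power_Suc DERIV_ident)
    also have "of_nat (fact k div fact (Suc i)) * ((1 + of_nat i) * (1 * complex_of_real x ^ i))
      = of_nat (fact k div fact i) * complex_of_real x ^ i"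
      unfolding eq[symmetric] by (simp del: fact_Suc)
    finally show ?thesis using True i by (simp add: i_def)
  next
    case False
    then show ?thesis by (cases "j \<le> k") auto
  qed
  then show ?thesis
    unfolding polysum_def[abs_def] by (intro has_vector_derivative_sum has_vector_derivative_mult_right)
qed

lemma polysum_0: "polysum m P 0 x = (\<Sum>k<m. P k * of_real x ^ k)"
  by (simp add: polysum_def)

lemma polysum_top: "polysum m P m x = 0"
  by (auto simp: polysum_def intro!: sum.neutral)

lemma polysum_at_0: "j < m \<Longrightarrow> polysum m P j 0 = fact j * P j"
proof -
  assume j: "j < m"
  have "polysum m P j 0 = (\<Sum>k<m. if k = j then fact j * P j else 0)"
    unfolding polysum_def by (intro sum.cong refl) (auto simp: power_0_left)
  then show ?thesis using j by simp
qed

lemma derivs_polysum: "derivs (polysum m P) S"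
  by (simp add: derivs_def polysum_derivative)

lemma polysum_continuous: "continuous_on S (polysum m P j)"
  using derivs_continuous_on[OF derivs_polysum] .

text \<open>\<open>A\<close> continues the right-hand piece of the coefficient smoothly to negative
  x, where it is unrelated to the actual coefficient. Its jet at 0 is thus the one-sided jet of
  \<open>c\<close>, and \<open>a0\<close> is the leading coefficient.\<close>

locale side_jet = side +
  fixes A :: "nat \<Rightarrow> real \<Rightarrow> complex" and a0 :: real
  assumes A: "derivs A {-1<..<1}"
    and A_c: "\<And>x. x \<in> {0<..<1} \<Longrightarrow> A 0 x = of_real (c x)"
    and A_zero: "\<And>i. i < p \<Longrightarrow> A i 0 = 0"
    and c_limit: "((\<lambda>x. c x / x ^ p) \<longlongrightarrow> a0) (at_right 0)" "a0 \<noteq> 0"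
begin

text \<open>The limit at 0 of the concomitant of y and a solution. For k \<ge> m - p the number
  \<open>Q k\<close> is not a limit at 0, but then m - 1 - k < p, so its factor vanishes.\<close>

definition boundary :: "(nat \<Rightarrow> complex) \<Rightarrow> (nat \<Rightarrow> complex) \<Rightarrow> (nat \<Rightarrow> real \<Rightarrow> complex) \<Rightarrow> complex"
  where "boundary P Q Y = (-1) ^ m * (\<Sum>k<m. (-1) ^ k * leibniz A (\<lambda>k. Y (k + m)) (m - 1 - k) 0 * Q k)
    + (\<Sum>j<m. (-1) ^ j * Y (m - 1 - j) 0 * P j)"

theorem green:
  assumes sol: "onesol P Q f" and Y: "testfn (-1) 1 Y"
  shows "((\<lambda>x. (-1) ^ m * leibniz A (\<lambda>k. Y (k + m)) m x * f x - (-1) ^ m * lam * (Y 0 x * f x))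
    has_integral - boundary P Q Y) {0..1}"
proof -
  obtain Z V where ch: "chain P Q Z V" and Z0: "\<And>x. x \<in> {0<..<1} \<Longrightarrow> Z 0 x = f x"
    and Vm: "\<And>x. x \<in> {0<..<1} \<Longrightarrow> V m x = lam * f x" and bf: "pbd (- 1 / 4) f" and P0: "\<And>j. j < p - m \<Longrightarrow> P j = 0"
    using sol unfolding onesol_def by blast
  \<comment> \<open>On the right this is c times y^(m), but it is a test function across 0.\<close>
  define \<theta> where "\<theta> = leibniz A (\<lambda>k. Y (k + m))"
  have \<theta>: "testfn (-1) 1 \<theta>"
    unfolding \<theta>_def by (rule testfn_leibniz[OF A testfn_shift[OF Y]])
  have \<theta>0: "\<theta> n 0 = leibniz A (\<lambda>k. Y (k + m)) n 0" for n by (simp add: \<theta>_def)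
  have \<theta>z: "\<theta> n 0 = 0" if "n < p" for n
    unfolding \<theta>0 leibniz_def using A_zero that by (intro sum.neutral) auto
  have "pbd (- 1 / 4) (\<lambda>x. lam * f x)" by (rule pbd_scale[OF bf])
  then have bVm: "pbd (- 1 / 4) (V m)" by (rule pbd_cong) (rule Vm)
  have bV: "pbd 0 (V j)" if "j < m" for j
    by (rule quasi_bounds[OF chainD(3)[OF ch] bVm that])
  have "pbd (real (p - m)) (V 0)"
  proof (rule quasi_order_at_0[of V])
    show "(V j has_vector_derivative V (Suc j) x) (at x)" if "j < m" "x \<in> {0<..<1}" for j x
      by (rule chainD(3)[OF ch that])
    show "(V j \<longlongrightarrow> 0) (at_right 0)" if "j < p - m" for j
      using chainD(4)[OF ch, of j] P0[OF that] that p by simp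
    show "pbd 0 (V (p - m))" by (rule bV) (use p in simp)
  qed
  from top_bound[of V Z, OF this chainD(2)[OF ch]] have top: "pbd (ex m) (Z m)" by simp
  have bZ: "pbd (ex k) (Z k)" if "k \<le> m" for k
    by (rule solution_bounds[OF chainD(1)[OF ch] top that])
  define E where "E x = (-1) ^ m * (\<Sum>k<m. (-1) ^ k * \<theta> (m - 1 - k) x * Z k x)
    + (\<Sum>j<m. (-1) ^ j * Y (m - 1 - j) x * V j x)" for x
  have dE: "(E has_vector_derivative (-1) ^ m * leibniz A (\<lambda>k. Y (k + m)) m x * f x - (-1) ^ m * lam * (Y 0 x * f x)) (at x)"
    if x: "x \<in> {0<..<1}" for x
  proof -
    have "(E has_vector_derivative (-1) ^ m * (\<theta> m x * Z 0 x - (-1) ^ m * \<theta> 0 x * Z m x)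
      + (Y m x * V 0 x - (-1) ^ m * Y 0 x * V m x)) (at x)"
      unfolding E_def[abs_def]
      by (intro has_vector_derivative_add has_vector_derivative_mult_right alternating_pairing_derivative
          derivsD[OF testfn_derivs[OF \<theta>, of UNIV]] derivsD[OF testfn_derivs[OF Y, of UNIV]]
          chainD(1,3)[OF ch] x UNIV_I)
    moreover have "\<theta> 0 x * Z m x = Y m x * V 0 x"
      using chainD(2)[OF ch x] A_c[OF x] c_nonzero[OF x] x by (simp add: \<theta>_def)
    moreover have "(-1) ^ m * ((-1) ^ m * z) = z" for z :: complex
      by (simp add: mult.assoc[symmetric] power_mult_distrib[symmetric])
    moreover have "\<theta> m x = leibniz A (\<lambda>k. Y (k + m)) m x" using x by (simp add: \<theta>_def)
    ultimately show ?thesis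
      using Z0[OF x] Vm[OF x] by (simp add: right_diff_distrib mult_ac)
  qed
  have cont_at: "isCont (D k) x" if "testfn (-1) 1 D" for D k x
    using testfn_continuous[OF that, of UNIV k] by (simp add: continuous_on_eq_continuous_at)
  have r: "(D k \<longlongrightarrow> D k 0) (at_right 0)" if "testfn (-1) 1 D" for D k
    using cont_at[OF that, where k=k and x=0] by (simp add: isCont_def filterlim_at_split)
  have lim1: "((\<lambda>x. \<Sum>k<m. (-1) ^ k * \<theta> (m - 1 - k) x * Z k x) \<longlongrightarrow>
    (\<Sum>k<m. (-1) ^ k * leibniz A (\<lambda>k. Y (k + m)) (m - 1 - k) 0 * Q k)) (at_right 0)"
  proof (rule tendsto_sum)
    fix k assume "k \<in> {..<m}"
    then have k: "k < m" by simp
    show "((\<lambda>x. (-1) ^ k * \<theta> (m - 1 - k) x * Z k x) \<longlongrightarrow> (-1) ^ k * leibniz A (\<lambda>k. Y (k + m)) (m - 1 - k) 0 * Q k) (at_right 0)"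
    proof (cases "k < m - p")
      case True
      then show ?thesis
        unfolding \<theta>0[symmetric] by (intro tendsto_mult tendsto_const r[OF \<theta>] chainD(5)[OF ch k])
    next
      case False
      then have lt: "m - 1 - k < p" using k by simp
      \<comment> \<open>\<open>Z k\<close> may be unbounded at 0, but
        \<open>\<theta> (m - 1 - k)\<close> vanishes there to a higher order: the exponents add up
        to at least 3/4.\<close>
      have "pbd (real (p - (m - 1 - k)) + ex k) (\<lambda>x. \<theta> (m - 1 - k) x * Z k x)"
        using k by (intro pbd_mult jet_order_at_0 bZ testfn_derivs[OF \<theta>] \<theta>z) auto
      moreover have "0 < real (p - (m - 1 - k)) + ex k"
        using False k lt p by (auto simp: ex_def of_nat_diff)
      ultimately have "((\<lambda>x. \<theta> (m - 1 - k) x * Z k x) \<longlongrightarrow> 0) (at_right 0)"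
        by (rule pbd_imp_tendsto_0)
      from tendsto_mult[OF tendsto_const this, of "(-1) ^ k"] show ?thesis
        using \<theta>z[OF lt] by (simp add: \<theta>0 mult.assoc)
    qed
  qed
  have lim2: "((\<lambda>x. \<Sum>j<m. (-1) ^ j * Y (m - 1 - j) x * V j x) \<longlongrightarrow>
    (\<Sum>j<m. (-1) ^ j * Y (m - 1 - j) 0 * P j)) (at_right 0)"
    by (intro tendsto_sum tendsto_mult tendsto_const r[OF Y] chainD(4)[OF ch]) auto
  have lim: "(E \<longlongrightarrow> boundary P Q Y) (at_right 0)"
    unfolding E_def[abs_def] boundary_def by (intro tendsto_add tendsto_mult tendsto_const lim1 lim2)
  obtain b where b: "0 < b" "b < 1" "\<And>k x. b \<le> x \<Longrightarrow> \<theta> k x = 0" "\<And>k x. b \<le> x \<Longrightarrow> Y k x = 0"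
  proof -
    have *: "\<exists>\<beta><1. \<forall>k x. \<beta> < x \<longrightarrow> D k x = 0" if "testfn (-1) 1 D" for D
      using that unfolding testfn_def by fastforce
    obtain \<beta> \<beta>' where "\<beta> < 1" "\<forall>k x. \<beta> < x \<longrightarrow> \<theta> k x = 0" "\<beta>' < 1" "\<forall>k x. \<beta>' < x \<longrightarrow> Y k x = 0"
      using *[OF \<theta>] *[OF Y] by blast
    then show thesis
      by (intro that[of "(max (max \<beta> \<beta>') 0 + 1) / 2"]) auto
  qed
  \<comment> \<open>\<open>E\<close> is replaced by its limit at 0 and by 0 at 1, near which the
    test functions vanish; so the fundamental theorem applies on the closed interval.\<close>
  define G where "G x = (if x \<le> 0 then boundary P Q Y else if x < 1 then E x else 0)" for x
  have GE: "eventually (\<lambda>x. E x = G x) (at_right 0)"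
    unfolding eventually_at_right_field by (intro exI[of _ 1]) (auto simp: G_def)
  have G01: "G 0 = boundary P Q Y" "G 1 = 0" by (simp_all add: G_def)
  have "continuous_on {0..1} G"
  proof (rule continuous_on_IccI)
    show "(G \<longlongrightarrow> G 0) (at_right 0)"
      unfolding G01 by (rule Lim_transform_eventually[OF lim GE])
    have "eventually (\<lambda>x. 0 = G x) (at_left 1)"
      unfolding eventually_at_left_field using b by (intro exI[of _ b]) (auto simp: G_def E_def)
    from Lim_transform_eventually[OF tendsto_const this] show "(G \<longlongrightarrow> G 1) (at_left 1)"
      unfolding G01 .
    fix x :: real assume x: "0 < x" "x < 1"
    have "(G has_vector_derivative (-1) ^ m * leibniz A (\<lambda>k. Y (k + m)) m x * f x - (-1) ^ m * lam * (Y 0 x * f x)) (at x)"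
      by (rule has_vector_derivative_transform_within_open[OF dE, of _ "{0<..<1}"]) (use x in \<open>auto simp: G_def\<close>)
    then show "G \<midarrow>x\<rightarrow> G x"
      using has_vector_derivative_continuous isCont_def by blast
  qed simp
  then have "((\<lambda>x. (-1) ^ m * leibniz A (\<lambda>k. Y (k + m)) m x * f x - (-1) ^ m * lam * (Y 0 x * f x))
    has_integral G 1 - G 0) {0..1}"
  proof (intro fundamental_theorem_of_calculus_interior)
    fix x :: real assume x: "x \<in> {0<..<1}"
    show "(G has_vector_derivative (-1) ^ m * leibniz A (\<lambda>k. Y (k + m)) m x * f x - (-1) ^ m * lam * (Y 0 x * f x)) (at x)"
      by (rule has_vector_derivative_transform_within_open[OF dE, of _ "{0<..<1}"]) (use x in \<open>auto simp: G_def\<close>)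
  qed auto
  then show ?thesis by (simp add: G01)
qed

end

section \<open>Weak solutions\<close>

lemma leibniz_linear_right: "leibniz A (\<lambda>k x. D k x + c * E k x) n x = leibniz A D n x + c * leibniz A E n x"
  by (simp add: leibniz_def algebra_simps sum.distrib sum_distrib_left)

lemma testfn_integrable_L1:
  assumes "testfn a b D" "f absolutely_integrable_on {a..b}"
  shows "(\<lambda>x. D j x * f x) integrable_on {a..b}"
  using continuous_mult_absolutely_integrable[OF testfn_continuous[OF assms(1)] assms(2)]
  by (simp add: absolutely_integrable_on_def)

text \<open>\<open>g\<close> may fail to be integrable up to the ends, so the fundamental lemma is
  used on compact subintervals, and countably many of them exhaust (0,1).\<close>

lemma weakly_equal_imp_ae_equal:
  fixes f g :: "real \<Rightarrow> complex"
  assumes f: "f absolutely_integrable_on {0..1}" and g: "continuous_on {0<..<1} g"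
    and eq: "\<And>D. testfn 0 1 D \<Longrightarrow> integral {0..1} (\<lambda>x. D 0 x * f x) = integral {0..1} (\<lambda>x. D 0 x * g x)"
  obtains N where "negligible N" "\<And>x. x \<in> {0<..<1} - N \<Longrightarrow> f x = g x"
proof -
  have "\<exists>N. negligible N \<and> (\<forall>x\<in>{a..b} - N. f x - g x = 0)" if ab: "0 < a" "a < b" "b < 1" for a b
  proof -
    have fab: "f absolutely_integrable_on {a..b}"
      by (rule absolutely_integrable_on_subinterval[OF f]) (use ab in auto)
    have gab: "g absolutely_integrable_on {a..b}"
      by (rule absolutely_integrable_continuous_real, rule continuous_on_subset[OF g]) (use ab in auto)
    have res: "integral {0..1} (\<lambda>x. D 0 x * h x) = integral {a..b} (\<lambda>x. D 0 x * h x)" if "testfn a b D" for D h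
    proof -
      have "(if x \<in> {a..b} then D 0 x * h x else 0) = D 0 x * h x" for x
        using testfn_zero_outside[OF that, of x] by auto
      moreover have "{a..b} \<subseteq> {0..1}" using ab by auto
      ultimately show ?thesis
        using integral_restrict_Int[of "{0..1}" "{a..b}" "\<lambda>x. D 0 x * h x"] ab
        by (simp add: max_absorb1 min_absorb1 del: atLeastAtMost_iff)
    qed
    obtain N where "negligible N" "\<And>x. x \<in> {a..b} - N \<Longrightarrow> f x - g x = 0"
    proof (rule weakly_zero_imp_negligible[OF ab(2)])
      show "(\<lambda>x. f x - g x) absolutely_integrable_on {a..b}"
        by (rule set_integral_diff(1)[OF fab gab])
      fix D assume D: "testfn a b D"
      have "integral {a..b} (\<lambda>x. D 0 x * f x) = integral {a..b} (\<lambda>x. D 0 x * g x)"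
        using eq[OF testfn_mono[OF D]] ab by (simp add: res[OF D])
      moreover have "integral {a..b} (\<lambda>x. D 0 x * f x - D 0 x * g x)
        = integral {a..b} (\<lambda>x. D 0 x * f x) - integral {a..b} (\<lambda>x. D 0 x * g x)"
        by (rule Henstock_Kurzweil_Integration.integral_diff[OF testfn_integrable_L1[OF D fab] testfn_integrable_L1[OF D gab]])
      ultimately show "integral {a..b} (\<lambda>x. D 0 x * (f x - g x)) = 0"
        by (simp add: right_diff_distrib)
    qed blast
    then show ?thesis by blast
  qed
  \<comment> \<open>The shift by 3 keeps 1/(n + 3) below 1/2, so every interval is
    nondegenerate.\<close>
  then have "\<forall>n. \<exists>N. negligible N \<and> (\<forall>x\<in>{1 / real (n + 3)..1 - 1 / real (n + 3)} - N. f x - g x = 0)"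
    by (simp add: field_simps)
  from choice[OF this] obtain N where N: "\<And>n. negligible (N n)"
    "\<And>n x. x \<in> {1 / real (n + 3)..1 - 1 / real (n + 3)} - N n \<Longrightarrow> f x - g x = 0" by blast
  show thesis
  proof (rule that[of "\<Union>n. N n"])
    show "negligible (\<Union>n. N n)" by (rule negligible_Union_nat[OF N(1)])
    fix x assume x: "x \<in> {0<..<1} - (\<Union>n. N n)"
    define \<delta> where "\<delta> = min x (1 - x)"
    have "0 < \<delta>" using x by (simp add: \<delta>_def)
    then obtain n where n: "n > 0" "inverse (real n) < \<delta>" using ex_inverse_of_nat_less by blast
    have "1 / real (n + 3) \<le> inverse (real n)" using n(1) by (simp add: field_simps)
    then have "1 / real (n + 3) \<le> x" "x \<le> 1 - 1 / real (n + 3)" using n(2) by (auto simp: \<delta>_def)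
    with N(2)[of x n] x show "f x = g x" by auto
  qed
qed

context side_jet
begin

text \<open>By strong induction the earlier coefficients vanish, so \<open>Z m\<close> behaves like
  a multiple of P_j x^(j-p). Applying L'Hopital \<open>m\<close> times gives the limit of x^(p-j-m)
  \<open>Z 0\<close> as a nonzero multiple of P_j, and p - j - m \<ge> 1 contradicts integrability
  unless P_j = 0.\<close>

lemma zero_low_quasi_data:
  assumes W: "pbd (real (m - 1)) W"
    and Z: "\<And>k x. k < m \<Longrightarrow> x \<in> {0<..<1} \<Longrightarrow> (Z k has_vector_derivative Z (Suc k) x) (at x)"
    and Zm: "\<And>x. x \<in> {0<..<1} \<Longrightarrow> Z m x = (W x + polysum m P 0 x) / of_real (c x)"
    and int: "Z 0 absolutely_integrable_on {0..1}"
    and j: "j < p - m"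
  shows "P j = 0"
  using j
proof (induction j rule: less_induct)
  case (less j)
  \<comment> \<open>Because p < 2m; hence \<open>W\<close>, being O(x^(m-1)), is of higher order
    than x^j.\<close>
  have jm: "j < m - 1" using less.prems p by simp
  have ev: "eventually (\<lambda>x. x \<in> {0<..<1}) (at_right (0::real))"
    by (auto simp: eventually_at_right_field intro!: exI[of _ 1])
  have "pbd (- real j) (\<lambda>x. 1 / of_real x ^ j)"
    unfolding pbd_def by (intro exI[of _ 1])
      (auto simp: powr_minus powr_realpow norm_inverse norm_power divide_inverse)
  from pbd_mult[OF W this] have "pbd (real (m - 1) - real j) (\<lambda>x. W x / of_real x ^ j)" by simp
  then have 1: "((\<lambda>x. W x / of_real x ^ j) \<longlongrightarrow> 0) (at_right 0)"
    by (rule pbd_imp_tendsto_0) (use jm in simp)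
  have id0: "(complex_of_real \<longlongrightarrow> 0) (at_right 0)"
  proof -
    have "(complex_of_real \<longlongrightarrow> of_real 0) (at_right 0)" by (rule tendsto_of_real[OF tendsto_ident_at])
    then show ?thesis by simp
  qed
  have "((\<lambda>x. \<Sum>k<m. P k * (if j \<le> k then of_real x ^ (k - j) else 0)) \<longlongrightarrow>
      (\<Sum>k<m. P k * (if j \<le> k then complex_of_real 0 ^ (k - j) else 0))) (at_right 0)"
    using id0 by (intro tendsto_sum tendsto_mult tendsto_const) (auto intro!: tendsto_power)
  also have "(\<Sum>k<m. P k * (if j \<le> k then complex_of_real 0 ^ (k - j) else 0)) = (\<Sum>k<m. if k = j then P j else 0)"
    by (intro sum.cong refl) (auto simp: power_0_left)
  also have "\<dots> = P j" using jm by simp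
  finally have 2: "((\<lambda>x. \<Sum>k<m. P k * (if j \<le> k then of_real x ^ (k - j) else 0)) \<longlongrightarrow> P j) (at_right 0)" .
  have 3: "polysum m P 0 x / of_real x ^ j = (\<Sum>k<m. P k * (if j \<le> k then of_real x ^ (k - j) else 0))"
    if x: "x \<in> {0<..<1}" for x
  proof -
    have "P k * of_real x ^ k / of_real x ^ j = P k * (if j \<le> k then of_real x ^ (k - j) else 0)" if "k < m" for k
    proof (cases "j \<le> k")
      case True
      then show ?thesis using x by (simp add: power_diff)
    next
      case False
      then have "P k = 0" using less.IH[of k] less.prems by simp
      then show ?thesis by simp
    qed
    then show ?thesis by (simp add: polysum_0 sum_divide_distrib)
  qed
  have c_inv: "((\<lambda>x. inverse (complex_of_real (c x / x ^ p))) \<longlongrightarrow> inverse (of_real a0)) (at_right 0)"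
    using c_limit by (intro tendsto_inverse tendsto_of_real) auto
  have "((\<lambda>x. (W x / of_real x ^ j + (\<Sum>k<m. P k * (if j \<le> k then of_real x ^ (k - j) else 0)))
     * inverse (complex_of_real (c x / x ^ p))) \<longlongrightarrow> (0 + P j) * inverse (of_real a0)) (at_right 0)"
    by (intro tendsto_mult tendsto_add 1 2 c_inv)
  moreover have "eventually (\<lambda>x. (W x / of_real x ^ j + (\<Sum>k<m. P k * (if j \<le> k then of_real x ^ (k - j) else 0)))
     * inverse (complex_of_real (c x / x ^ p)) = of_real x ^ (p - j) * Z m x) (at_right 0)"
  proof (rule eventually_mono[OF ev])
    fix x :: real assume x: "x \<in> {0<..<1}"
    have "complex_of_real x ^ p = of_real x ^ (p - j) * of_real x ^ j"
      using less.prems by (simp flip: power_add)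
    then show "(W x / of_real x ^ j + (\<Sum>k<m. P k * (if j \<le> k then of_real x ^ (k - j) else 0)))
      * inverse (complex_of_real (c x / x ^ p)) = of_real x ^ (p - j) * Z m x"
      unfolding 3[OF x, symmetric] Zm[OF x] using x c_nonzero[OF x] by (simp add: field_simps)
  qed
  ultimately have base: "((\<lambda>x. of_real x ^ (p - j) * Z m x) \<longlongrightarrow> P j * inverse (of_real a0)) (at_right 0)"
    by (simp add: Lim_transform_eventually)
  have "i \<le> m \<Longrightarrow> \<exists>r. r \<noteq> 0 \<and> ((\<lambda>x. of_real x ^ (p - j - i) * Z (m - i) x) \<longlongrightarrow> r * P j) (at_right 0)" for i
  proof (induction i)
    case 0
    show ?case using base c_limit(2) by (intro exI[of _ "inverse (of_real a0)"]) (simp add: mult.commute)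
  next
    case (Suc i)
    then obtain r where r: "r \<noteq> 0" "((\<lambda>x. of_real x ^ (p - j - i) * Z (m - i) x) \<longlongrightarrow> r * P j) (at_right 0)" by auto
    \<comment> \<open>As p - j > m > i, the pole of \<open>Z (m - i)\<close> has order at least 2,
      so the integration never meets the logarithmic case.\<close>
    define n where "n = p - j - i - 2"
    have n: "p - j - i = Suc (Suc n)" "p - j - Suc i = Suc n" "m - i = Suc (m - Suc i)"
      using Suc.prems less.prems by (auto simp: n_def)
    have "((\<lambda>x. of_real x ^ Suc n * Z (m - Suc i) x) \<longlongrightarrow> - (r * P j) / of_nat (Suc n)) (at_right 0)"
    proof (rule lhopital_power_complex)
      show "(Z (m - Suc i) has_vector_derivative Z (m - i) x) (at x)" if "x \<in> {0<..<1}" for x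
        unfolding n(3) by (rule Z) (use that Suc.prems in auto)
      show "((\<lambda>x. of_real x ^ Suc (Suc n) * Z (m - i) x) \<longlongrightarrow> r * P j) (at_right 0)"
        using r(2) unfolding n(1) .
    qed
    then show ?case
      unfolding n(2) by (intro exI[of _ "- r / of_nat (Suc n)"]) (use r(1) in \<open>simp del: of_nat_Suc\<close>)
  qed
  from this[of m] obtain r where r: "r \<noteq> 0"
    "((\<lambda>x. of_real x ^ (p - j - m) * Z 0 x) \<longlongrightarrow> r * P j) (at_right 0)" by auto
  have "p - j - m = Suc (p - j - m - 1)" using less.prems by simp
  with r(2) have "((\<lambda>x. of_real x ^ Suc (p - j - m - 1) * Z 0 x) \<longlongrightarrow> r * P j) (at_right 0)" by simp
  from not_integrable_pole[OF int this] r(1) show ?case by simp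
qed

text \<open>Since \<open>c\<close> does not vanish in the open interval, \<open>Y m\<close> is \<open>A\<close> times a test function
  for every test function \<open>Y\<close>; so the weak equation can be integrated in two stages.\<close>

theorem weak_solution_imp_onesol:
  assumes f: "f absolutely_integrable_on {0..1}"
    and weak: "\<And>Y. testfn 0 1 Y \<Longrightarrow> integral {0..1} (\<lambda>x. (-1) ^ m * leibniz A (\<lambda>k. Y (k + m)) m x * f x)
      = (-1) ^ m * lam * integral {0..1} (\<lambda>x. Y 0 x * f x)"
  shows "\<exists>P Q g N. onesol P Q g \<and> negligible N \<and> (\<forall>x\<in>{0<..<1} - N. f x = g x)"
proof -
  have A': "derivs A {0<..<1}" by (rule derivs_subset[OF A]) auto
  have fi: "f integrable_on {0..1}" using f by (simp add: absolutely_integrable_on_def)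
  define F where "F x = integral {0..x} f" for x
  have Fc: "continuous_on {0..1} F"
    unfolding F_def by (rule indefinite_integral_continuous_1[OF fi])
  have "continuous_on {0<..<1} F" by (rule continuous_on_subset[OF Fc]) auto
  then have lFc: "continuous_on {0<..<1} (\<lambda>x. lam * F x)" by (intro continuous_intros)
  have lFb: "pbd 0 (\<lambda>x. lam * F x)" by (rule pbd_scale[OF continuous_imp_pbd[OF Fc]])
  have "(F \<longlongrightarrow> F 0) (at_right 0)"
    using Fc by (auto simp: continuous_on_def at_within_Icc_at_right dest!: bspec[of _ _ 0])
  then have F0: "(F \<longlongrightarrow> 0) (at_right 0)" by (simp add: F_def)
  \<comment> \<open>A candidate for the quasi-derivatives, up to a polynomial. It starts from the
    indefinite integral \<open>F\<close>, since \<open>f\<close> itself is not yet known to be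
    continuous.\<close>
  obtain W where W: "W (m - 1) = (\<lambda>x. lam * F x)"
    and W': "\<forall>j<m - 1. (\<forall>x\<in>{0<..<1}. (W j has_vector_derivative W (Suc j) x) (at x)) \<and>
      (W j \<longlongrightarrow> 0) (at_right 0) \<and> pbd 0 (W j)"
    using quasi_tower[OF lFc pbd_mono[OF lFb], of "m - 1" "\<lambda>_. 0"] by auto
  have Wd: "\<And>j x. j < m - 1 \<Longrightarrow> x \<in> {0<..<1} \<Longrightarrow> (W j has_vector_derivative W (Suc j) x) (at x)"
    using W' by blast
  have Wl: "(W j \<longlongrightarrow> 0) (at_right 0)" if "j < m" for j
  proof (cases "j = m - 1")
    case True
    have "((\<lambda>x. lam * F x) \<longlongrightarrow> 0) (at_right 0)" using tendsto_mult[OF tendsto_const F0, of lam] by simp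
    then show ?thesis unfolding True W .
  qed (use W' that in auto)
  have Wb: "pbd 0 (W j)" if "j < m" for j
    using W' that lFb W by (cases "j = m - 1") auto
  have W0c: "continuous_on {0<..<1} (W 0)"
  proof (cases "m - 1 = 0")
    case True
    show ?thesis using lFc unfolding W[symmetric] True .
  next
    case False
    then show ?thesis using deriv_imp_continuous_on[OF Wd[of 0]] by blast
  qed
  have "i \<le> m - 1 \<Longrightarrow> pbd (real i) (W (m - 1 - i))" for i
  proof (induction i)
    case 0
    show ?case using Wb[of "m - 1"] m by simp
  next
    case (Suc i)
    then have eq: "m - 1 - i = Suc (m - 1 - Suc i)" by simp
    have "pbd (real i + 1) (W (m - 1 - Suc i))"
    proof (rule pbd_antideriv_high)
      show "(W (m - 1 - Suc i) has_vector_derivative W (m - 1 - i) x) (at x)" if "x \<in> {0<..<1}" for x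
        unfolding eq by (rule Wd) (use that Suc.prems in auto)
      show "(W (m - 1 - Suc i) \<longlongrightarrow> 0) (at_right 0)" by (rule Wl) (use Suc.prems in auto)
    qed (use Suc in auto)
    then show ?case by (simp add: add.commute)
  qed
  from this[of "m - 1"] have W0b: "pbd (real (m - 1)) (W 0)" by simp
  \<comment> \<open>Of the \<open>m\<close> integrations by parts only the one between
    \<open>f\<close> and \<open>F\<close> needs the version for integrable functions.\<close>
  have step1: "(-1) ^ m * lam * integral {0..1} (\<lambda>x. Y 0 x * f x) = integral {0..1} (\<lambda>x. Y m x * W 0 x)"
    if Y: "testfn 0 1 Y" for Y
  proof -
    have Y1: "testfn 0 1 (\<lambda>k. Y (k + 1))" by (rule testfn_shift[OF Y])
    have "integral {0..1} (\<lambda>x. Y (m - 1 + 1) x * W 0 x) = (-1) ^ (m - 1) * integral {0..1} (\<lambda>x. Y (0 + 1) x * W (m - 1) x)"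
    proof (rule testfn_ibp[OF Y1, of "m - 1" W])
      show "(W k has_vector_derivative W (Suc k) x) (at x)" if "k < m - 1" "x \<in> {0<..<1}" for k x
        by (rule Wd[OF that])
      show "continuous_on {0<..<1} (W (m - 1))" unfolding W by (rule lFc)
    qed
    also have "integral {0..1} (\<lambda>x. Y (0 + 1) x * W (m - 1) x) = lam * integral {0..1} (\<lambda>x. Y (Suc 0) x * F x)"
      unfolding W by (simp add: mult.left_commute flip: integral_mult_right)
    also have "integral {0..1} (\<lambda>x. Y (Suc 0) x * F x) = - integral {0..1} (\<lambda>x. Y 0 x * f x)"
      using testfn_ibp_L1[OF Y f, of 0] by (simp add: F_def)
    also have "(-1) ^ (m - 1) * (lam * - integral {0..1} (\<lambda>x. Y 0 x * f x)) = (-1) ^ Suc (m - 1) * lam * integral {0..1} (\<lambda>x. Y 0 x * f x)"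
      by simp
    finally show ?thesis using m by simp
  qed
  \<comment> \<open>The weak equation says that \<open>l1\<close> vanishes on \<open>m\<close>-th
    derivatives. The polynomial it yields completes \<open>W 0\<close> to \<open>V0\<close>, the
    function standing for c times z^(m).\<close>
  define l1 where "l1 D = integral {0..1} (\<lambda>x. (-1) ^ m * leibniz A D m x * f x) - integral {0..1} (\<lambda>x. D 0 x * W 0 x)"
    for D :: "nat \<Rightarrow> real \<Rightarrow> complex"
  have i1: "(\<lambda>x. (-1) ^ m * leibniz A D m x * f x) integrable_on {0..1}" if "testfn 0 1 D" for D
    using integrable_on_mult_right[OF testfn_integrable_L1[OF testfn_leibniz[OF A' that] f, of m], of "(-1) ^ m"]
    by (simp add: mult.assoc)
  have lin: "integral {0..1} (\<lambda>x. h x + a * k x) = integral {0..1} h + a * integral {0..1} k"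
    if "h integrable_on {0..1}" "k integrable_on {0..1}" for h k :: "real \<Rightarrow> complex" and a
    using Henstock_Kurzweil_Integration.integral_add[OF that(1) integrable_on_mult_right[OF that(2), of a]] by simp
  have "\<exists>P. \<forall>D. testfn 0 1 D \<longrightarrow> l1 D = (\<Sum>k<m. P k * integral {0..1} (\<lambda>x. D 0 x * of_real x ^ k))"
  proof (rule functional_vanishing_on_derivatives)
    show "l1 (\<lambda>k. Y (k + m)) = 0" if "testfn 0 1 Y" for Y
      using weak[OF that] step1[OF that] by (simp add: l1_def)
    fix D E a assume DE: "testfn 0 1 D" "testfn 0 1 E"
    have "(\<lambda>x. (-1) ^ m * leibniz A (\<lambda>k x. D k x + a * E k x) m x * f x) =
      (\<lambda>x. (-1) ^ m * leibniz A D m x * f x + a * ((-1) ^ m * leibniz A E m x * f x))"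
      "(\<lambda>x. (D 0 x + a * E 0 x) * W 0 x) = (\<lambda>x. D 0 x * W 0 x + a * (E 0 x * W 0 x))"
      by (auto simp: leibniz_linear_right algebra_simps)
    then show "l1 (\<lambda>k x. D k x + a * E k x) = l1 D + a * l1 E"
      unfolding l1_def
      by (simp only: lin[OF i1[OF DE(1)] i1[OF DE(2)]]
          lin[OF testfn_mult_integrable[OF DE(1) W0c] testfn_mult_integrable[OF DE(2) W0c]]) (simp add: algebra_simps)
  qed
  then obtain P where P: "\<And>D. testfn 0 1 D \<Longrightarrow> l1 D = (\<Sum>k<m. P k * integral {0..1} (\<lambda>x. D 0 x * of_real x ^ k))" by blast
  have poly_int: "(\<Sum>k<m. P k * integral {0..1} (\<lambda>x. D 0 x * of_real x ^ k)) = integral {0..1} (\<lambda>x. D 0 x * polysum m P 0 x)"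
    if "testfn 0 1 D" for D P
  proof -
    have "(\<Sum>k<m. P k * integral {0..1} (\<lambda>x. D 0 x * of_real x ^ k)) = (\<Sum>k<m. integral {0..1} (\<lambda>x. P k * (D 0 x * of_real x ^ k)))"
      by simp
    also have "\<dots> = integral {0..1} (\<lambda>x. \<Sum>k<m. P k * (D 0 x * of_real x ^ k))"
      by (intro integral_sum[symmetric] integrable_on_mult_right testfn_mult_integrable[OF that] continuous_intros) auto
    also have "\<dots> = integral {0..1} (\<lambda>x. D 0 x * polysum m P 0 x)"
      by (simp add: polysum_0 sum_distrib_left mult_ac)
    finally show ?thesis .
  qed
  define V0 where "V0 x = W 0 x + polysum m P 0 x" for x
  have V0c: "continuous_on {0<..<1} V0"
    unfolding V0_def by (intro continuous_intros W0c polysum_continuous)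
  have eq1: "integral {0..1} (\<lambda>x. (-1) ^ m * leibniz A D m x * f x) = integral {0..1} (\<lambda>x. D 0 x * V0 x)"
    if D: "testfn 0 1 D" for D
  proof -
    have "integral {0..1} (\<lambda>x. (-1) ^ m * leibniz A D m x * f x) =
      integral {0..1} (\<lambda>x. D 0 x * W 0 x) + integral {0..1} (\<lambda>x. D 0 x * polysum m P 0 x)"
      using P[OF D] poly_int[OF D] by (simp add: l1_def algebra_simps)
    also have "\<dots> = integral {0..1} (\<lambda>x. D 0 x * V0 x)"
      unfolding V0_def distrib_left
      by (intro Henstock_Kurzweil_Integration.integral_add[symmetric] testfn_mult_integrable[OF D] W0c polysum_continuous)
    finally show ?thesis .
  qed
  have "\<exists>R. derivs R {0<..<1} \<and> (\<forall>x. R 0 x = 1 / A 0 x)"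
    by (rule derivs_reciprocal[OF A']) (use A_c c_nonzero in auto)
  then obtain R where R: "derivs R {0<..<1}" "\<And>x. R 0 x = 1 / A 0 x" by blast
  have V0cc: "continuous_on {0<..<1} (\<lambda>x. V0 x / of_real (c x))"
    using c_nonzero by (intro continuous_intros V0c c_cont) auto
  obtain H where H: "H m = (\<lambda>x. V0 x / of_real (c x))"
    and Hd: "\<And>k x. k < m \<Longrightarrow> x \<in> {0<..<1} \<Longrightarrow> (H k has_vector_derivative H (Suc k) x) (at x)"
    using continuous_antideriv_tower[OF V0cc, of m] by auto
  have H0c: "continuous_on {0<..<1} (H 0)" using Hd[of 0] m by (intro deriv_imp_continuous_on[of _ _ "H (Suc 0)"]) auto
  have step2: "integral {0..1} (\<lambda>x. Y m x * f x) = integral {0..1} (\<lambda>x. Y m x * H 0 x)" if Y: "testfn 0 1 Y" for Y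
  proof -
    let ?D = "leibniz R Y"
    have D: "testfn 0 1 ?D" by (rule testfn_leibniz[OF R(1) Y])
    have "leibniz A ?D m x = Y m x" for x
    proof (cases "x \<in> {0<..<1}")
      case True
      show ?thesis
        by (rule derivs_unique[OF derivs_leibniz[OF A' testfn_derivs[OF D]] testfn_derivs[OF Y] _ _ True])
          (use A_c c_nonzero in \<open>auto simp: R(2)\<close>)
    next
      case False
      then show ?thesis
        using testfn_zero_outside[OF testfn_leibniz[OF A' D], of x m] testfn_zero_outside[OF Y, of x m] by auto
    qed
    then have "integral {0..1} (\<lambda>x. (-1) ^ m * Y m x * f x) = integral {0..1} (\<lambda>x. ?D 0 x * V0 x)"
      using eq1[OF D] by simp
    also have "(\<lambda>x. ?D 0 x * V0 x) = (\<lambda>x. Y 0 x * H m x)"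
    proof
      show "?D 0 x * V0 x = Y 0 x * H m x" for x
        using testfn_zero_outside[OF Y, of x 0] A_c[of x] by (cases "x \<in> {0<..<1}") (auto simp: R(2) H)
    qed
    finally have 1: "(-1) ^ m * integral {0..1} (\<lambda>x. Y m x * f x) = integral {0..1} (\<lambda>x. Y 0 x * H m x)"
      by (simp add: mult.assoc)
    have 2: "integral {0..1} (\<lambda>x. Y m x * H 0 x) = (-1) ^ m * integral {0..1} (\<lambda>x. Y 0 x * H m x)"
      by (rule testfn_ibp[OF Y, of m H]) (use V0cc H Hd in auto)
    show ?thesis
      unfolding 2 1[symmetric] by (simp add: mult.assoc[symmetric] power_mult_distrib[symmetric])
  qed
  define l2 where "l2 D = integral {0..1} (\<lambda>x. D 0 x * f x) - integral {0..1} (\<lambda>x. D 0 x * H 0 x)"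
    for D :: "nat \<Rightarrow> real \<Rightarrow> complex"
  have "\<exists>P. \<forall>D. testfn 0 1 D \<longrightarrow> l2 D = (\<Sum>k<m. P k * integral {0..1} (\<lambda>x. D 0 x * of_real x ^ k))"
  proof (rule functional_vanishing_on_derivatives)
    show "l2 (\<lambda>k. Y (k + m)) = 0" if "testfn 0 1 Y" for Y
      using step2[OF that] by (simp add: l2_def)
    fix D E a assume DE: "testfn 0 1 D" "testfn 0 1 E"
    have "(\<lambda>x. (D 0 x + a * E 0 x) * h x) = (\<lambda>x. D 0 x * h x + a * (E 0 x * h x))" for h
      by (auto simp: algebra_simps)
    then show "l2 (\<lambda>k x. D k x + a * E k x) = l2 D + a * l2 E"
      unfolding l2_def
      by (simp only: lin[OF testfn_integrable_L1[OF DE(1) f] testfn_integrable_L1[OF DE(2) f]]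
          lin[OF testfn_mult_integrable[OF DE(1) H0c] testfn_mult_integrable[OF DE(2) H0c]]) (simp add: algebra_simps)
  qed
  then obtain Q' where Q': "\<And>D. testfn 0 1 D \<Longrightarrow> l2 D = (\<Sum>k<m. Q' k * integral {0..1} (\<lambda>x. D 0 x * of_real x ^ k))" by blast
  define Z where "Z k x = H k x + polysum m Q' k x" for k x
  have Zd: "(Z k has_vector_derivative Z (Suc k) x) (at x)" if "k < m" "x \<in> {0<..<1}" for k x
    unfolding Z_def[abs_def] by (intro has_vector_derivative_add Hd that polysum_derivative)
  have Zm: "Z m x = V0 x / of_real (c x)" for x by (simp add: Z_def H polysum_top)
  have Z0c: "continuous_on {0<..<1} (Z 0)" using Zd[of 0] m by (intro deriv_imp_continuous_on[of _ _ "Z (Suc 0)"]) auto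
  have "integral {0..1} (\<lambda>x. D 0 x * f x) = integral {0..1} (\<lambda>x. D 0 x * Z 0 x)" if D: "testfn 0 1 D" for D
  proof -
    have "integral {0..1} (\<lambda>x. D 0 x * f x) = integral {0..1} (\<lambda>x. D 0 x * H 0 x) + integral {0..1} (\<lambda>x. D 0 x * polysum m Q' 0 x)"
      using Q'[OF D] poly_int[OF D] by (simp add: l2_def algebra_simps)
    also have "\<dots> = integral {0..1} (\<lambda>x. D 0 x * Z 0 x)"
      unfolding Z_def distrib_left
      by (intro Henstock_Kurzweil_Integration.integral_add[symmetric] testfn_mult_integrable[OF D] H0c polysum_continuous)
    finally show ?thesis .
  qed
  then obtain N where N: "negligible N" "\<And>x. x \<in> {0<..<1} - N \<Longrightarrow> f x = Z 0 x"
    using weakly_equal_imp_ae_equal[OF f Z0c] by blast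
  have N': "negligible (N \<union> {0, 1})" by (rule negligible_Un[OF N(1)]) (simp add: negligible_finite)
  have Z0int: "Z 0 absolutely_integrable_on {0..1}"
    by (rule absolutely_integrable_spike[OF f N']) (use N(2) in \<open>auto simp: less_le\<close>)
  \<comment> \<open>Now that \<open>f\<close> agrees almost everywhere with a continuous function,
    \<open>F\<close> is differentiable everywhere, which provides the last derivative
    \<open>V m\<close>.\<close>
  have Fd: "(F has_vector_derivative Z 0 x) (at x)" if x: "x \<in> {0<..<1}" for x
  proof -
    define a b where "a = x / 2" and "b = (1 + x) / 2"
    have ab: "0 < a" "a < x" "x < b" "b < 1" using x by (auto simp: a_def b_def)
    have "((\<lambda>u. integral {a..u} (Z 0)) has_vector_derivative Z 0 x) (at x within {a..b})"
      by (rule integral_has_vector_derivative) (use ab in \<open>auto intro: continuous_on_subset[OF Z0c]\<close>)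
    then have "((\<lambda>u. integral {a..u} (Z 0)) has_vector_derivative Z 0 x) (at x)"
      using ab by (simp add: at_within_Icc_at)
    then have "((\<lambda>u. F a + integral {a..u} (Z 0)) has_vector_derivative Z 0 x) (at x)"
      by (auto intro!: derivative_eq_intros)
    then show ?thesis
    proof (rule has_vector_derivative_transform_within_open[of _ _ _ "{a<..<b}"])
      fix y assume y: "y \<in> {a<..<b}"
      have "integral {a..y} (Z 0) = integral {a..y} f"
        by (rule integral_spike[OF N']) (use N(2) y ab in auto)
      moreover have "F y = F a + integral {a..y} f"
        unfolding F_def
        by (rule Henstock_Kurzweil_Integration.integral_combine[symmetric])
          (use y ab in \<open>auto intro: integrable_on_subinterval[OF fi]\<close>)
      ultimately show "F a + integral {a..y} (Z 0) = F y" by simp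
    qed (use ab in auto)
  qed
  define V where "V j x = (if j < m then W j x + polysum m P j x else lam * Z 0 x)" for j x
  have Vd: "(V j has_vector_derivative V (Suc j) x) (at x)" if "j < m" "x \<in> {0<..<1}" for j x
  proof (cases "j = m - 1")
    case True
    have "((\<lambda>x. lam * F x + polysum m P j x) has_vector_derivative lam * Z 0 x + polysum m P (Suc j) x) (at x)"
      by (intro has_vector_derivative_add has_vector_derivative_mult_right Fd that polysum_derivative)
    then show ?thesis using True m W by (simp add: V_def[abs_def] polysum_top)
  next
    case False
    then have "j < m - 1" using that by simp
    then have "((\<lambda>x. W j x + polysum m P j x) has_vector_derivative W (Suc j) x + polysum m P (Suc j) x) (at x)"
      by (intro has_vector_derivative_add Wd that polysum_derivative)
    moreover have "Suc j < m" "j < m" using \<open>j < m - 1\<close> by auto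
    ultimately show ?thesis by (simp add: V_def[abs_def])
  qed
  \<comment> \<open>\<open>W\<close> has limits 0, so the initial values of \<open>V\<close> are
    those of the polynomial with coefficients \<open>P\<close>; hence the factorials.\<close>
  have Vl: "(V j \<longlongrightarrow> fact j * P j) (at_right 0)" if j: "j < m" for j
  proof -
    have "isCont (polysum m P j) 0"
      using polysum_continuous[of UNIV] by (simp add: continuous_on_eq_continuous_at)
    then have "(polysum m P j \<longlongrightarrow> polysum m P j 0) (at_right 0)"
      by (simp add: isCont_def filterlim_at_split)
    from tendsto_add[OF Wl[OF j] this] show ?thesis
      using j by (simp add: V_def[abs_def] polysum_at_0)
  qed
  have Vb: "pbd 0 (V j)" if "j < m" for j
    using that by (simp add: V_def[abs_def] pbd_add Wb continuous_imp_pbd polysum_continuous)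
  have Pz: "P j = 0" if "j < p - m" for j
    by (rule zero_low_quasi_data[OF W0b Zd _ Z0int that]) (auto simp: Zm V0_def)
  have Zm': "Z m x = V 0 x / of_real (c x)" for x using m by (simp add: Zm V_def V0_def)
  have "pbd (real (p - m)) (V 0)"
  proof (rule quasi_order_at_0[of V])
    show "(V j has_vector_derivative V (Suc j) x) (at x)" if "j < m" "x \<in> {0<..<1}" for j x
      by (rule Vd[OF that])
    show "(V j \<longlongrightarrow> 0) (at_right 0)" if "j < p - m" for j
      using Vl[of j] Pz[OF that] that p by simp
    show "pbd 0 (V (p - m))" by (rule Vb) (use p in simp)
  qed
  from top_bound[of V Z, OF this Zm'] have top: "pbd (ex m) (Z m)" by simp
  have Zb: "pbd (ex k) (Z k)" if "k \<le> m" for k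
    by (rule solution_bounds[of Z, OF _ top that]) (rule Zd)
  define Q where "Q k = (if k < m - p then (SOME L. (Z k \<longlongrightarrow> L) (at_right 0)) else Z k anchor)" for k
  have Ql: "(Z k \<longlongrightarrow> Q k) (at_right 0)" if "k < m" "k < m - p" for k
  proof -
    have "\<exists>L. (Z k \<longlongrightarrow> L) (at_right 0)"
      using antideriv_tendsto[OF Zd[OF that(1)] Zb[of "Suc k"]] that by (auto simp: ex_def)
    from someI_ex[OF this] show ?thesis using that by (simp add: Q_def)
  qed
  have "chain (\<lambda>j. fact j * P j) Q Z V"
    unfolding chain_def using Zd Zm' Vd Vl Ql by (auto simp: Q_def)
  moreover have "pbd (- 1 / 4) (Z 0)" using Zb[of 0] by (simp add: ex_0)
  ultimately have "onesol (\<lambda>j. fact j * P j) Q (Z 0)"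
    unfolding onesol_def using Pz by (intro conjI exI[of _ Z] exI[of _ V]) (auto simp: V_def)
  with N show ?thesis by blast
qed

end

section \<open>Linear algebra of the matching conditions\<close>

lemma leibniz_monomial_jet:
  assumes D: "\<And>j. X j 0 = (if j = s then fact s else 0)"
  shows "leibniz X B i 0 = (if s \<le> i then of_nat (i choose s) * fact s * B (i - s) 0 else 0)"
proof -
  have "leibniz X B i 0 = (\<Sum>j\<le>i. if j = s then of_nat (i choose s) * fact s * B (i - s) 0 else 0)"
    unfolding leibniz_def by (intro sum.cong refl) (simp add: D)
  then show ?thesis by simp
qed

text \<open>The product of x^s with a plateau that is nonzero at 0 has vanishing jet below order s.
  Descending from s = n - 1, the higher coefficients are known to be 0, so only \<open>K s\<close>
  survives.\<close>

lemma jets_independent: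
  assumes K: "\<And>Y. testfn (-1) 1 Y \<Longrightarrow> (\<Sum>s<n. K s * Y s 0) = 0" and s: "s < n"
  shows "K s = 0"
proof -
  define B where "B = plateau (- 1 / 2) (1 / 2) 1"
  have B: "testfn (-1) 1 B" unfolding B_def by (rule testfn_plateau) auto
  have B0: "B 0 0 \<noteq> 0" by (simp add: B_def plateau_0 bump_0)
  have step: "K s = 0" if s: "s < n" and IH: "\<And>i. s < i \<Longrightarrow> i < n \<Longrightarrow> K i = 0" for s
  proof -
    define X where "X = polysum (Suc s) (\<lambda>k. if k = s then 1 else 0)"
    have X: "X j 0 = (if j = s then fact s else 0)" for j
    proof (cases "j < Suc s")
      case True
      then show ?thesis by (simp add: X_def polysum_at_0)
    next
      case False
      then show ?thesis by (auto simp: X_def polysum_def intro!: sum.neutral)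
    qed
    have Y: "testfn (-1) 1 (leibniz X B)"
      by (rule testfn_leibniz[OF _ B]) (simp add: X_def derivs_polysum)
    have "(\<Sum>i<n. K i * leibniz X B i 0) = (\<Sum>i<n. if i = s then K s * (fact s * B 0 0) else 0)"
    proof (rule sum.cong[OF refl])
      fix i assume "i \<in> {..<n}"
      then show "K i * leibniz X B i 0 = (if i = s then K s * (fact s * B 0 0) else 0)"
        using IH[of i] by (cases i s rule: linorder_cases) (auto simp: leibniz_monomial_jet[of X s, OF X])
    qed
    then show ?thesis using K[OF Y] s B0 by simp
  qed
  have "\<forall>j. n - j \<le> d \<longrightarrow> j < n \<longrightarrow> K j = 0" for d
  proof (induction d)
    case (Suc d)
    show ?case
    proof (intro allI impI)
      fix j assume j: "n - j \<le> Suc d" "j < n"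
      show "K j = 0" by (rule step[OF j(2)]) (use Suc j in auto)
    qed
  qed auto
  with s show ?thesis by blast
qed

context side_jet
begin

text \<open>The factor of \<open>Q k * Y (m + s) 0\<close> in the boundary form. Since \<open>A i 0 = 0\<close> for \<open>i < p\<close>, this matrix is
  triangular with respect to the antidiagonal \<open>s + k + p = m - 1\<close>.\<close>

definition jump_coeff :: "nat \<Rightarrow> nat \<Rightarrow> complex"
  where "jump_coeff s k = (if s \<le> m - 1 - k then
    (-1) ^ m * (-1) ^ k * of_nat ((m - 1 - k) choose s) * A (m - 1 - k - s) 0 else 0)"

lemma jump_coeff_zero: "k < m \<Longrightarrow> m \<le> s + k + p \<Longrightarrow> jump_coeff s k = 0"
  by (auto simp: jump_coeff_def intro!: A_zero)

lemma jump_coeff_nonzero: "k < m \<Longrightarrow> s + k + p = m - 1 \<Longrightarrow> A p 0 \<noteq> 0 \<Longrightarrow> jump_coeff s k \<noteq> 0"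
proof -
  assume a: "k < m" "s + k + p = m - 1" "A p 0 \<noteq> 0"
  then have "s \<le> m - 1 - k" "m - 1 - k - s = p" by auto
  then show ?thesis using a(3) by (simp add: jump_coeff_def)
qed

text \<open>Regrouped by the derivatives of y at 0: those of order below \<open>m\<close> meet the
  data \<open>P\<close>, those of order \<open>m\<close> and above meet \<open>Q\<close>.\<close>

lemma boundary_expand:
  "boundary P Q Y = (\<Sum>s<m. (-1) ^ (m - 1 - s) * P (m - 1 - s) * Y s 0)
    + (\<Sum>s<m. (\<Sum>k<m. jump_coeff s k * Q k) * Y (m + s) 0)"
proof -
  have l: "leibniz A (\<lambda>k. Y (k + m)) n 0 = (\<Sum>s<m. if s \<le> n then of_nat (n choose s) * A (n - s) 0 * Y (m + s) 0 else 0)"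
    if n: "n < m" for n
  proof -
    have "leibniz A (\<lambda>k. Y (k + m)) n 0 = (\<Sum>s\<le>n. of_nat (n choose s) * A (n - s) 0 * Y (m + s) 0)"
      unfolding leibniz_def
      by (rule sum.reindex_bij_witness[of _ "\<lambda>s. n - s" "\<lambda>s. n - s"])
        (auto simp: binomial_symmetric[symmetric] add.commute)
    also have "\<dots> = (\<Sum>s\<in>{..<m} \<inter> {s. s \<le> n}. of_nat (n choose s) * A (n - s) 0 * Y (m + s) 0)"
      by (rule sum.cong) (use n in auto)
    also have "\<dots> = (\<Sum>s<m. if s \<le> n then of_nat (n choose s) * A (n - s) 0 * Y (m + s) 0 else 0)"
      by (subst sum.inter_restrict) auto
    finally show ?thesis .
  qed
  have "(-1) ^ m * (\<Sum>k<m. (-1) ^ k * leibniz A (\<lambda>k. Y (k + m)) (m - 1 - k) 0 * Q k)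
    = (\<Sum>k<m. \<Sum>s<m. jump_coeff s k * Q k * Y (m + s) 0)"
    unfolding sum_distrib_left
  proof (rule sum.cong[OF refl])
    fix k assume "k \<in> {..<m}"
    then have "m - 1 - k < m" by auto
    from l[OF this] show "(-1) ^ m * ((-1) ^ k * leibniz A (\<lambda>k. Y (k + m)) (m - 1 - k) 0 * Q k)
        = (\<Sum>s<m. jump_coeff s k * Q k * Y (m + s) 0)"
      by (simp add: sum_distrib_left sum_distrib_right jump_coeff_def) (intro sum.cong refl, simp add: mult_ac)
  qed
  also have "\<dots> = (\<Sum>s<m. (\<Sum>k<m. jump_coeff s k * Q k) * Y (m + s) 0)"
    by (subst sum.swap) (simp add: sum_distrib_right)
  finally have 1: "(-1) ^ m * (\<Sum>k<m. (-1) ^ k * leibniz A (\<lambda>k. Y (k + m)) (m - 1 - k) 0 * Q k)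
    = (\<Sum>s<m. (\<Sum>k<m. jump_coeff s k * Q k) * Y (m + s) 0)" .
  have 2: "(\<Sum>j<m. (-1) ^ j * Y (m - 1 - j) 0 * P j) = (\<Sum>s<m. (-1) ^ (m - 1 - s) * P (m - 1 - s) * Y s 0)"
    by (rule sum.reindex_bij_witness[of _ "\<lambda>s. m - 1 - s" "\<lambda>s. m - 1 - s"]) auto
  show ?thesis unfolding boundary_def 1 2 by simp
qed

lemma onesol_cong:
  assumes "onesol P Q f" "\<And>j. j < m \<Longrightarrow> P j = P' j" "\<And>j. j < m \<Longrightarrow> Q j = Q' j"
  shows "onesol P' Q' f"
proof -
  have "chain P' Q' Z V" if "chain P Q Z V" for Z V
    using that assms(2,3) unfolding chain_def by auto
  moreover have "P' j = P j" if "j < p - m" for j using assms(2)[of j] that p by simp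
  ultimately show ?thesis using assms(1) unfolding onesol_def by auto
qed

end

section \<open>Triangular systems and free coordinates\<close>

text \<open>The entries from \<open>m - p\<close> on are free. Row N - 1 - i, with N = m - p, has
  its pivot in column i, and the rows treated before it vanish in that column; so \<open>Q i\<close>
  can be corrected without disturbing them.\<close>

lemma triangular_solution:
  fixes T :: "nat \<Rightarrow> nat \<Rightarrow> complex"
  assumes T0: "\<And>s k. k < m \<Longrightarrow> m \<le> s + k + p \<Longrightarrow> T s k = 0"
    and T1: "\<And>s k. k < m \<Longrightarrow> s + k + p = m - 1 \<Longrightarrow> T s k \<noteq> 0"
  shows "\<exists>Q. (\<forall>k\<ge>m - p. Q k = Q0 k) \<and> (\<forall>s<m - p. (\<Sum>k<m. T s k * Q k) = r s)"
proof -
  define N where "N = m - p"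
  have "i \<le> N \<Longrightarrow> \<exists>Q. (\<forall>k\<ge>N. Q k = Q0 k) \<and> (\<forall>j<i. (\<Sum>k<m. T (N - 1 - j) k * Q k) = r (N - 1 - j))" for i
  proof (induction i)
    case 0
    then show ?case by blast
  next
    case (Suc i)
    then obtain Q where Q: "\<forall>k\<ge>N. Q k = Q0 k" "\<forall>j<i. (\<Sum>k<m. T (N - 1 - j) k * Q k) = r (N - 1 - j)" by auto
    have i: "i < m" "N - 1 - i + i + p = m - 1" using Suc.prems by (auto simp: N_def)
    define Q' where "Q' = Q(i := Q i + (r (N - 1 - i) - (\<Sum>k<m. T (N - 1 - i) k * Q k)) / T (N - 1 - i) i)"
    have upd: "(\<Sum>k<m. T s k * Q' k) = (\<Sum>k<m. T s k * Q k) + T s i * (Q' i - Q i)" for s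
    proof -
      have "(\<Sum>k<m. T s k * Q' k) = (\<Sum>k<m. T s k * Q k + (if k = i then T s i * (Q' i - Q i) else 0))"
        by (intro sum.cong refl) (auto simp: Q'_def algebra_simps)
      then show ?thesis using i by (simp add: sum.distrib)
    qed
    have "(\<Sum>k<m. T (N - 1 - j) k * Q' k) = r (N - 1 - j)" if "j < Suc i" for j
    proof (cases "j = i")
      case True
      show ?thesis unfolding True upd using T1[OF i] by (simp add: Q'_def)
    next
      case False
      then have "j < i" using that by simp
      moreover have "T (N - 1 - j) i = 0"
        by (rule T0) (use \<open>j < i\<close> Suc.prems in \<open>auto simp: N_def\<close>)
      ultimately show ?thesis unfolding upd using Q(2) by simp
    qed
    moreover have "\<forall>k\<ge>N. Q' k = Q0 k" using Q(1) Suc.prems by (auto simp: Q'_def)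
    ultimately show ?case by blast
  qed
  from this[of N] obtain Q where Q: "\<forall>k\<ge>N. Q k = Q0 k" "\<forall>j<N. (\<Sum>k<m. T (N - 1 - j) k * Q k) = r (N - 1 - j)" by auto
  have "(\<Sum>k<m. T s k * Q k) = r s" if "s < N" for s
    using Q(2)[rule_format, of "N - 1 - s"] that by simp
  with Q(1) show ?thesis unfolding N_def by blast
qed

text \<open>In the row whose pivot is in column i, the later columns vanish by the shape of
  \<open>T\<close> and the earlier entries of \<open>Q\<close> by induction.\<close>

lemma triangular_unique:
  fixes T :: "nat \<Rightarrow> nat \<Rightarrow> complex"
  assumes T0: "\<And>s k. k < m \<Longrightarrow> m \<le> s + k + p \<Longrightarrow> T s k = 0"
    and T1: "\<And>s k. k < m \<Longrightarrow> s + k + p = m - 1 \<Longrightarrow> T s k \<noteq> 0"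
    and Q: "\<And>k. m - p \<le> k \<Longrightarrow> k < m \<Longrightarrow> Q k = 0" and eq: "\<And>s. s < m - p \<Longrightarrow> (\<Sum>k<m. T s k * Q k) = 0"
    and k: "k < m"
  shows "Q k = 0"
  using k
proof (induction k rule: less_induct)
  case (less i)
  show ?case
  proof (cases "m - p \<le> i")
    case False
    define s where "s = m - 1 - p - i"
    have s: "s + i + p = m - 1" "s < m - p" using False by (auto simp: s_def)
    have "(\<Sum>k<m. T s k * Q k) = (\<Sum>k<m. if k = i then T s i * Q i else 0)"
    proof (rule sum.cong[OF refl])
      fix k assume k: "k \<in> {..<m}"
      show "T s k * Q k = (if k = i then T s i * Q i else 0)"
        using less.IH[of k] T0[of k s] s(1) k by (cases k i rule: linorder_cases) auto
    qed
    then show ?thesis using eq[OF s(2)] T1[OF less.prems s(1)] less.prems by simp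
  qed (use Q less.prems in simp)
qed

text \<open>The data left once those of the left quasi-derivatives, equal to \<open>P\<close> up to
  sign, are eliminated. The common \<open>P\<close> obeys the conditions of both sides, so
  \<open>R\<close> will be the larger of p - m and q - m.\<close>

definition admissible :: "nat \<Rightarrow> nat \<Rightarrow> (nat \<Rightarrow> nat \<Rightarrow> complex) \<Rightarrow> (nat \<Rightarrow> nat \<Rightarrow> complex) \<Rightarrow>
    (nat \<Rightarrow> complex) \<Rightarrow> (nat \<Rightarrow> complex) \<Rightarrow> (nat \<Rightarrow> complex) \<Rightarrow> bool"
  where "admissible m R T T' P Q Q' \<longleftrightarrow> (\<forall>j<R. P j = 0) \<and>
    (\<forall>s<m. (\<Sum>k<m. T s k * Q k) + (\<Sum>k<m. T' s k * Q' k) = 0)"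

text \<open>Says that \<open>co\<close> induces a linear isomorphism from admissible data, read at
  indices below \<open>m\<close>, onto the functions on \<open>A\<close>, phrased without a quotient
  space.\<close>

definition coordinates :: "nat \<Rightarrow> nat \<Rightarrow> (nat \<Rightarrow> nat \<Rightarrow> complex) \<Rightarrow> (nat \<Rightarrow> nat \<Rightarrow> complex) \<Rightarrow> (nat \<times> nat) set \<Rightarrow>
    ((nat \<Rightarrow> complex) \<Rightarrow> (nat \<Rightarrow> complex) \<Rightarrow> (nat \<Rightarrow> complex) \<Rightarrow> nat \<times> nat \<Rightarrow> complex) \<Rightarrow> bool"
  where "coordinates m R T T' A co \<longleftrightarrow> finite A \<and>
    (\<forall>P Q Q' P1 Q1 Q1' a i. co (\<lambda>j. P j + a * P1 j) (\<lambda>j. Q j + a * Q1 j) (\<lambda>j. Q' j + a * Q1' j) i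
       = co P Q Q' i + a * co P1 Q1 Q1' i) \<and>
    (\<forall>v. \<exists>P Q Q'. admissible m R T T' P Q Q' \<and> (\<forall>i\<in>A. co P Q Q' i = v i)) \<and>
    (\<forall>P Q Q'. admissible m R T T' P Q Q' \<longrightarrow> (\<forall>i\<in>A. co P Q Q' i = 0) \<longrightarrow> (\<forall>j<m. P j = 0 \<and> Q j = 0 \<and> Q' j = 0)) \<and>
    (\<forall>P Q Q'. (\<forall>j<m. P j = 0 \<and> Q j = 0 \<and> Q' j = 0) \<longrightarrow> (\<forall>i\<in>A. co P Q Q' i = 0))"

text \<open>For p \<le> q the rows s < m - p determine the first m - p entries of \<open>Q\<close>
  from everything else, and in the remaining rows both matrices vanish. Free are therefore P from
  \<open>R\<close> on, all of Q', and \<open>Q\<close> from m - p on.\<close>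

lemma coordinates_exist_ordered:
  assumes T0: "\<And>s k. k < m \<Longrightarrow> m \<le> s + k + p \<Longrightarrow> T s k = 0"
    and T1: "\<And>s k. k < m \<Longrightarrow> s + k + p = m - 1 \<Longrightarrow> T s k \<noteq> 0"
    and T0': "\<And>s k. k < m \<Longrightarrow> m \<le> s + k + q \<Longrightarrow> T' s k = 0"
    and pq: "p \<le> q" and R: "R \<le> m"
  shows "\<exists>A co. coordinates m R T T' A co \<and> card A = (m - R) + m + (m - (m - p))"
proof -
  \<comment> \<open>The first components 0, 1 and 2 tag coordinates from \<open>P\<close>, Q' and
    \<open>Q\<close>.\<close>
  define A :: "(nat \<times> nat) set" where "A = {0} \<times> {R..<m} \<union> ({1} \<times> {..<m} \<union> {2} \<times> {m - p..<m})"
  define co :: "(nat \<Rightarrow> complex) \<Rightarrow> (nat \<Rightarrow> complex) \<Rightarrow> (nat \<Rightarrow> complex) \<Rightarrow> nat \<times> nat \<Rightarrow> complex"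
    where "co P Q Q' i = (if fst i = 0 then P (snd i) else if fst i = 1 then Q' (snd i) else Q (snd i))" for P Q Q' i
  have fin: "finite A" by (simp add: A_def)
  have "card A = (m - R) + (m + (m - (m - p)))"
    unfolding A_def by (subst card_Un_disjoint; (subst card_Un_disjoint)?) (auto simp: card_cartesian_product)
  then have card: "card A = (m - R) + m + (m - (m - p))" by simp
  have onto: "\<exists>P Q Q'. admissible m R T T' P Q Q' \<and> (\<forall>i\<in>A. co P Q Q' i = v i)" for v
  proof -
    obtain Q where Q: "\<forall>k\<ge>m - p. Q k = v (2, k)" "\<forall>s<m - p. (\<Sum>k<m. T s k * Q k) = - (\<Sum>k<m. T' s k * v (1, k))"
      using triangular_solution[of m p T "\<lambda>k. v (2, k)" "\<lambda>s. - (\<Sum>k<m. T' s k * v (1, k))", OF T0 T1] by blast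
    have "(\<Sum>k<m. T s k * Q k) + (\<Sum>k<m. T' s k * v (1, k)) = 0" if "s < m" for s
    proof (cases "s < m - p")
      case True
      then show ?thesis using Q(2) by simp
    next
      case False
      then have "(\<Sum>k<m. T s k * Q k) = 0" "(\<Sum>k<m. T' s k * v (1, k)) = 0"
        using pq by (auto intro!: sum.neutral simp: T0 T0')
      then show ?thesis by simp
    qed
    then have "admissible m R T T' (\<lambda>j. if j < R then 0 else v (0, j)) Q (\<lambda>k. v (1, k))"
      by (auto simp: admissible_def)
    moreover have "\<forall>i\<in>A. co (\<lambda>j. if j < R then 0 else v (0, j)) Q (\<lambda>k. v (1, k)) i = v i"
      using Q(1) by (auto simp: A_def co_def)
    ultimately show ?thesis by blast
  qed
  have inj: "P j = 0 \<and> Q j = 0 \<and> Q' j = 0"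
    if adm: "admissible m R T T' P Q Q'" and z: "\<forall>i\<in>A. co P Q Q' i = 0" and j: "j < m" for P Q Q' j
  proof -
    have 1: "P j = 0" if "j < m" for j
      using adm z[rule_format, of "(0, j)"] that by (cases "j < R") (auto simp: admissible_def A_def co_def)
    have 2: "Q' j = 0" if "j < m" for j
      using z[rule_format, of "(1, j)"] that by (auto simp: A_def co_def)
    have 3: "Q k = 0" if "m - p \<le> k" "k < m" for k
      using z[rule_format, of "(2, k)"] that by (auto simp: A_def co_def)
    have "(\<Sum>k<m. T s k * Q k) = 0" if "s < m - p" for s
    proof -
      have "(\<Sum>k<m. T s k * Q k) + (\<Sum>k<m. T' s k * Q' k) = 0"
        using adm that unfolding admissible_def by simp
      moreover have "(\<Sum>k<m. T' s k * Q' k) = 0" by (intro sum.neutral) (simp add: 2)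
      ultimately show ?thesis by simp
    qed
    from triangular_unique[of m p T Q j, OF T0 T1 3 this j] 1[OF j] 2[OF j] show ?thesis by simp
  qed
  have lin: "co (\<lambda>j. P j + a * P1 j) (\<lambda>j. Q j + a * Q1 j) (\<lambda>j. Q' j + a * Q1' j) i
       = co P Q Q' i + a * co P1 Q1 Q1' i" for P Q Q' P1 Q1 Q1' a i
    by (simp add: co_def)
  have zero: "co P Q Q' i = 0" if "\<forall>j<m. P j = 0 \<and> Q j = 0 \<and> Q' j = 0" "i \<in> A" for P Q Q' i
    using that by (auto simp: A_def co_def)
  have "coordinates m R T T' A co"
    unfolding coordinates_def
  proof (intro conjI)
    show "\<forall>P Q Q' P1 Q1 Q1' a i. co (\<lambda>j. P j + a * P1 j) (\<lambda>j. Q j + a * Q1 j) (\<lambda>j. Q' j + a * Q1' j) i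
       = co P Q Q' i + a * co P1 Q1 Q1' i"
      by (intro allI lin)
    show "\<forall>v. \<exists>P Q Q'. admissible m R T T' P Q Q' \<and> (\<forall>i\<in>A. co P Q Q' i = v i)"
      by (intro allI onto)
    show "\<forall>P Q Q'. admissible m R T T' P Q Q' \<longrightarrow> (\<forall>i\<in>A. co P Q Q' i = 0) \<longrightarrow>
        (\<forall>j<m. P j = 0 \<and> Q j = 0 \<and> Q' j = 0)"
      by (intro allI impI) (rule inj)
    show "\<forall>P Q Q'. (\<forall>j<m. P j = 0 \<and> Q j = 0 \<and> Q' j = 0) \<longrightarrow> (\<forall>i\<in>A. co P Q Q' i = 0)"
      by (intro allI impI ballI) (rule zero)
  qed (rule fin)
  with card show ?thesis by blast
qed

lemma coordinates_exist:
  assumes T0: "\<And>s k. k < m \<Longrightarrow> m \<le> s + k + p \<Longrightarrow> T s k = 0"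
    and T1: "\<And>s k. k < m \<Longrightarrow> s + k + p = m - 1 \<Longrightarrow> T s k \<noteq> 0"
    and T0': "\<And>s k. k < m \<Longrightarrow> m \<le> s + k + q \<Longrightarrow> T' s k = 0"
    and T1': "\<And>s k. k < m \<Longrightarrow> s + k + q = m - 1 \<Longrightarrow> T' s k \<noteq> 0"
    and R: "R \<le> m"
  shows "\<exists>A co. coordinates m R T T' A co \<and> card A = (m - R) + m + (m - (m - min p q))"
proof (cases "p \<le> q")
  case True
  show ?thesis
    using coordinates_exist_ordered[of m p T q T' R, OF T0 T1 T0' True R] True by (simp add: min_def)
next
  case False
  then have "q \<le> p" by simp
  from coordinates_exist_ordered[of m q T' p T R, OF T0' T1' T0 this R] obtain A co
    where co: "coordinates m R T' T A co" and card: "card A = (m - R) + m + (m - (m - q))" by auto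
  have adm: "admissible m R T T' P Q Q' = admissible m R T' T P Q' Q" for P Q Q'
    by (simp add: admissible_def add.commute)
  from co have lin: "\<forall>P Q Q' P1 Q1 Q1' a i. co (\<lambda>j. P j + a * P1 j) (\<lambda>j. Q j + a * Q1 j) (\<lambda>j. Q' j + a * Q1' j) i
       = co P Q Q' i + a * co P1 Q1 Q1' i"
    unfolding coordinates_def by (elim conjE)
  from co have onto: "\<forall>v. \<exists>P Q Q'. admissible m R T' T P Q Q' \<and> (\<forall>i\<in>A. co P Q Q' i = v i)"
    unfolding coordinates_def by (elim conjE)
  from co have inj: "\<forall>P Q Q'. admissible m R T' T P Q Q' \<longrightarrow> (\<forall>i\<in>A. co P Q Q' i = 0) \<longrightarrow>
      (\<forall>j<m. P j = 0 \<and> Q j = 0 \<and> Q' j = 0)"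
    unfolding coordinates_def by (elim conjE)
  from co have zero: "\<forall>P Q Q'. (\<forall>j<m. P j = 0 \<and> Q j = 0 \<and> Q' j = 0) \<longrightarrow> (\<forall>i\<in>A. co P Q Q' i = 0)"
    unfolding coordinates_def by (elim conjE)
  have "coordinates m R T T' A (\<lambda>P Q Q'. co P Q' Q)"
    unfolding coordinates_def adm
  proof (intro conjI)
    show "finite A" using co by (simp add: coordinates_def)
    show "\<forall>P Q Q' P1 Q1 Q1' a i. co (\<lambda>j. P j + a * P1 j) (\<lambda>j. Q' j + a * Q1' j) (\<lambda>j. Q j + a * Q1 j) i
       = co P Q' Q i + a * co P1 Q1' Q1 i"
      by (intro allI) (rule lin[rule_format])
    show "\<forall>v. \<exists>P Q Q'. admissible m R T' T P Q' Q \<and> (\<forall>i\<in>A. co P Q' Q i = v i)"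
    proof
      fix v
      from onto[rule_format, of v] obtain P Q Q' where "admissible m R T' T P Q Q'" "\<forall>i\<in>A. co P Q Q' i = v i"
        by (elim exE conjE)
      then show "\<exists>P Q Q'. admissible m R T' T P Q' Q \<and> (\<forall>i\<in>A. co P Q' Q i = v i)"
        by (intro exI conjI)
    qed
    show "\<forall>P Q Q'. admissible m R T' T P Q' Q \<longrightarrow> (\<forall>i\<in>A. co P Q' Q i = 0) \<longrightarrow>
        (\<forall>j<m. P j = 0 \<and> Q j = 0 \<and> Q' j = 0)"
      using inj by simp
    show "\<forall>P Q Q'. (\<forall>j<m. P j = 0 \<and> Q j = 0 \<and> Q' j = 0) \<longrightarrow> (\<forall>i\<in>A. co P Q' Q i = 0)"
      using zero by simp
  qed
  with card \<open>q \<le> p\<close> show ?thesis by (auto simp: min_absorb2)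
qed

text \<open>A linear relation replaces the coordinate map, because neither the data nor the square
  integrable class is given as a function of the other. Elements related to the unit vectors on
  \<open>A\<close> form a basis.\<close>

lemma (in vector_space) dim_eq_card_coordinates:
  fixes Rel :: "('i \<Rightarrow> 'a) \<Rightarrow> 'b \<Rightarrow> bool"
  assumes fin: "finite A"
    and sub: "\<And>v z. Rel v z \<Longrightarrow> z \<in> X"
    and onto: "\<And>z. z \<in> X \<Longrightarrow> \<exists>v. Rel v z"
    and total: "\<And>v. \<exists>v' z. Rel v' z \<and> (\<forall>i\<in>A. v' i = v i)"
    and lin: "\<And>v z v' z' a. Rel v z \<Longrightarrow> Rel v' z' \<Longrightarrow> Rel (\<lambda>i. v i + a * v' i) (z + scale a z')"
    and inj: "\<And>v i. Rel v 0 \<Longrightarrow> i \<in> A \<Longrightarrow> v i = 0"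
    and zero: "\<And>v z. Rel v z \<Longrightarrow> (\<And>i. i \<in> A \<Longrightarrow> v i = 0) \<Longrightarrow> z = 0"
  shows "dim X = card A"
proof -
  have "\<forall>k. \<exists>z. \<exists>v'. Rel v' z \<and> (\<forall>i\<in>A. v' i = (if i = k then 1 else 0))"
  proof
    fix k show "\<exists>z. \<exists>v'. Rel v' z \<and> (\<forall>i\<in>A. v' i = (if i = k then 1 else 0))"
      using total[of "\<lambda>i. if i = k then 1 else 0"] by blast
  qed
  from choice[OF this] obtain e where e: "\<And>k. \<exists>v'. Rel v' (e k) \<and> (\<forall>i\<in>A. v' i = (if i = k then 1 else 0))" by blast
  have comb: "\<exists>v'. Rel v' (\<Sum>k\<in>S. scale (c k) (e k)) \<and> (\<forall>i\<in>A. v' i = (if i \<in> S then c i else 0))"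
    if "finite S" for S c
    using that
  proof (induction S rule: finite_induct)
    case empty
    obtain v z where "Rel v z" using total by blast
    \<comment> \<open>Subtracting a related pair from itself relates the zero vector to 0.\<close>
    from lin[OF this this, of "- 1"] have "Rel (\<lambda>i. 0) 0" by simp
    then show ?case by auto
  next
    case (insert k S)
    from insert.IH obtain v where v: "Rel v (\<Sum>k\<in>S. scale (c k) (e k))" "\<forall>i\<in>A. v i = (if i \<in> S then c i else 0)" by blast
    obtain w where w: "Rel w (e k)" "\<forall>i\<in>A. w i = (if i = k then 1 else 0)" using e by blast
    have "(\<Sum>k\<in>insert k S. scale (c k) (e k)) = (\<Sum>k\<in>S. scale (c k) (e k)) + scale (c k) (e k)"
      using insert.hyps by (simp add: add.commute)
    then have "Rel (\<lambda>i. v i + c k * w i) (\<Sum>k\<in>insert k S. scale (c k) (e k))"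
      using lin[OF v(1) w(1), of "c k"] by simp
    moreover have "\<forall>i\<in>A. v i + c k * w i = (if i \<in> insert k S then c i else 0)"
      using v(2) w(2) insert.hyps by auto
    ultimately show ?case by (intro exI[of _ "\<lambda>i. v i + c k * w i"] conjI)
  qed
  have zero_comb: "c i = 0" if "(\<Sum>k\<in>A. scale (c k) (e k)) = 0" "i \<in> A" for c i
  proof -
    obtain v where v: "Rel v (\<Sum>k\<in>A. scale (c k) (e k))" "\<forall>i\<in>A. v i = (if i \<in> A then c i else 0)"
      using comb[OF fin, of c] by blast
    from inj[of v i] v that show ?thesis by simp
  qed
  have inj_e: "inj_on e A"
  proof (rule inj_onI, rule ccontr)
    fix k l assume kl: "k \<in> A" "l \<in> A" "e k = e l" "k \<noteq> l"
    let ?c = "\<lambda>i. if i = k then 1 else if i = l then - 1 else 0"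
    have "(\<Sum>i\<in>A. scale (?c i) (e i)) = (\<Sum>i\<in>A. (if i = k then e k else 0) + (if i = l then - e l else 0))"
      using kl by (intro sum.cong refl) auto
    also have "\<dots> = 0" using kl fin by (simp add: sum.distrib)
    finally show False using zero_comb[of ?c k] kl(1) by simp
  qed
  have "independent (e ` A)"
  proof (rule independent_if_scalars_zero)
    fix f x assume f: "(\<Sum>x\<in>e ` A. scale (f x) x) = 0" "x \<in> e ` A"
    then obtain i where i: "i \<in> A" "x = e i" by blast
    have "(\<Sum>k\<in>A. scale (f (e k)) (e k)) = 0"
      using f(1) by (simp add: sum.reindex[OF inj_e] o_def)
    from zero_comb[OF this i(1)] show "f x = 0" by (simp add: i(2))
  qed (use fin in simp)
  moreover have "e ` A \<subseteq> X" using e sub by blast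
  moreover have "X \<subseteq> span (e ` A)"
  proof
    fix z assume "z \<in> X"
    from onto[OF this] obtain v where v: "Rel v z" by blast
    obtain w where w: "Rel w (\<Sum>k\<in>A. scale (v k) (e k))" "\<forall>i\<in>A. w i = (if i \<in> A then v i else 0)"
      using comb[OF fin, of v] by blast
    have "z + scale (- 1) (\<Sum>k\<in>A. scale (v k) (e k)) = 0"
      by (rule zero[OF lin[OF v w(1)]]) (use w(2) in simp)
    then have "z = (\<Sum>k\<in>A. scale (v k) (e k))" by simp
    moreover have "(\<Sum>k\<in>A. scale (v k) (e k)) \<in> span (e ` A)"
      by (rule span_sum, rule span_scale, rule span_base) simp
    ultimately show "z \<in> span (e ` A)" by simp
  qed
  moreover have "card (e ` A) = card A" by (rule card_image[OF inj_e])
  ultimately show ?thesis by (intro dim_unique)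
qed

section \<open>Matching at the singular point\<close>

lemma diffs_iterate: "(diffs ^^ n) \<gamma> k = fact (n + k) / fact k * (\<gamma> (n + k) :: real)"
proof (induction n arbitrary: k)
  case (Suc n)
  have "(diffs ^^ Suc n) \<gamma> k = real (Suc k) * (fact (n + Suc k) / fact (Suc k) * \<gamma> (n + Suc k))"
    by (simp add: diffs_def Suc.IH del: fact_Suc of_nat_Suc)
  also have "fact (Suc k) = real (Suc k) * fact k" by simp
  also have "real (Suc k) * (fact (n + Suc k) / (real (Suc k) * fact k) * \<gamma> (n + Suc k))
      = fact (Suc n + k) / fact k * \<gamma> (Suc n + k)"
    by (simp del: fact_Suc of_nat_Suc)
  finally show ?case .
qed simp

lemma power_series_derivs:
  fixes \<gamma> :: "nat \<Rightarrow> real"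
  assumes sums: "\<And>x. \<bar>x\<bar> < 1 \<Longrightarrow> (\<lambda>j. \<gamma> j * x ^ j) sums f x"
  shows "\<exists>A. derivs A {-1<..<1} \<and> (\<forall>x\<in>{-1<..<1}. A 0 x = of_real (f x)) \<and> (\<forall>n. A n 0 = of_real (fact n * \<gamma> n))"
proof -
  define S where "S n x = (\<Sum>k. (diffs ^^ n) \<gamma> k * x ^ k)" for n and x :: real
  have sm: "norm x < 1 \<Longrightarrow> summable (\<lambda>k. (diffs ^^ n) \<gamma> k * x ^ k)" for n x
  proof (induction n arbitrary: x)
    case 0
    then show ?case using sums[of x] by (auto simp: sums_iff)
  next
    case (Suc n)
    show ?case using termdiff_converges[OF Suc.prems Suc.IH] by simp
  qed
  have "(S n has_real_derivative S (Suc n) x) (at x)" if "\<bar>x\<bar> < 1" for n x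
    using termdiffs_strong'[where K=1 and z=x and c="(diffs ^^ n) \<gamma>", OF sm] that unfolding S_def[abs_def] by simp
  then have "((\<lambda>x. complex_of_real (S n x)) has_vector_derivative of_real (S (Suc n) x)) (at x)" if "\<bar>x\<bar> < 1" for n x
    using that by (intro has_vector_derivative_of_real) (simp add: has_real_derivative_iff_has_vector_derivative[symmetric])
  then have "derivs (\<lambda>n x. of_real (S n x)) {-1<..<1}"
    by (auto simp: derivs_def)
  moreover have "S 0 x = f x" if "x \<in> {-1<..<1}" for x
    using sums[of x] that by (auto simp: S_def sums_iff)
  moreover have "S n 0 = fact n * \<gamma> n" for n
  proof -
    have "S n 0 = (diffs ^^ n) \<gamma> 0" unfolding S_def by (rule powser_zero)
    then show ?thesis by (simp add: diffs_iterate)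
  qed
  ultimately show ?thesis by (intro exI[of _ "\<lambda>n x. of_real (S n x)"]) simp
qed

lemma side_jet_of_power_series:
  fixes c a :: "real \<Rightarrow> real"
  assumes m: "1 \<le> m" and p: "1 \<le> p" "p < 2 * m"
    and sums: "\<And>x. \<bar>x\<bar> < 1 \<Longrightarrow> (\<lambda>j. \<alpha> j * x ^ j) sums a x" and \<alpha>0: "\<alpha> 0 \<noteq> 0"
    and a_cont: "continuous_on {0..1} a"
    and c: "\<And>x. x \<in> {0..1} \<Longrightarrow> c x = x ^ p * a x" and nz: "\<And>x. x \<in> {0<..1} \<Longrightarrow> c x \<noteq> 0"
  obtains \<kappa> A where "side_jet m p c \<kappa> A (\<alpha> 0)" "A p 0 \<noteq> 0"
proof -
  \<comment> \<open>The coefficients of x^p a(x), whose first p entries make \<open>A i 0\<close>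
    vanish for i < p.\<close>
  define \<gamma> where "\<gamma> j = (if j < p then 0 else \<alpha> (j - p))" for j
  have "(\<lambda>j. \<gamma> j * x ^ j) sums (x ^ p * a x)" if "\<bar>x\<bar> < 1" for x
  proof -
    have "(\<lambda>j. x ^ p * (\<alpha> j * x ^ j)) sums (x ^ p * a x)" by (intro sums_mult sums that)
    also have "(\<lambda>j. x ^ p * (\<alpha> j * x ^ j)) = (\<lambda>j. \<gamma> (j + p) * x ^ (j + p))"
      by (auto simp: \<gamma>_def power_add)
    finally show ?thesis
      by (subst (asm) sums_iff_shift) (simp add: \<gamma>_def)
  qed
  from power_series_derivs[of \<gamma> "\<lambda>x. x ^ p * a x", OF this]
  obtain A where A: "derivs A {-1<..<1}" "\<And>x. x \<in> {-1<..<1} \<Longrightarrow> A 0 x = of_real (x ^ p * a x)"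
    "\<And>n. A n 0 = of_real (fact n * \<gamma> n)" by blast
  have a0: "a 0 = \<alpha> 0"
    using sums_unique2[OF sums[of 0] powser_sums_zero[of \<alpha>]] by simp
  have a_nz: "a x \<noteq> 0" if "x \<in> {0..1}" for x
  proof (cases "x = 0")
    case False
    then have "c x \<noteq> 0" using that by (intro nz) auto
    then show ?thesis using c[OF that] by auto
  qed (use a0 \<alpha>0 in simp)
  \<comment> \<open>The minimum of |a| on the closed interval serves as the constant \<kappa>; it is
    positive since \<open>a\<close> has no zero there.\<close>
  have "\<exists>x\<in>{0..1}. \<forall>y\<in>{0..1}. \<bar>a x\<bar> \<le> \<bar>a y\<bar>"
    by (rule continuous_attains_inf) (auto intro!: continuous_intros a_cont)
  then obtain x0 where x0: "x0 \<in> {0..1}" "\<And>y. y \<in> {0..1} \<Longrightarrow> \<bar>a x0\<bar> \<le> \<bar>a y\<bar>" by blast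
  have "side_jet m p c \<bar>a x0\<bar> A (\<alpha> 0)"
  proof
    show "0 < \<bar>a x0\<bar>" using a_nz[OF x0(1)] by simp
    fix x :: real assume x: "x \<in> {0<..<1}"
    then have "\<bar>c x\<bar> = x ^ p * \<bar>a x\<bar>" using c[of x] by (simp add: abs_mult)
    then show "\<bar>a x0\<bar> * x ^ p \<le> \<bar>c x\<bar>" using x0(2)[of x] x by (simp add: mult.commute mult_left_mono)
    show "A 0 x = of_real (c x)" using A(2)[of x] c[of x] x by simp
  next
    have "continuous_on {0<..<1} (\<lambda>x. x ^ p * a x)"
      by (intro continuous_intros continuous_on_subset[OF a_cont]) auto
    then show "continuous_on {0<..<1} c" by (rule continuous_on_eq) (use c in auto)
    have "(a \<longlongrightarrow> a 0) (at_right 0)"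
      using a_cont by (auto simp: continuous_on_def at_within_Icc_at_right dest!: bspec[of _ _ 0])
    moreover have "eventually (\<lambda>x. a x = c x / x ^ p) (at_right 0)"
      unfolding eventually_at_right_field using c by (intro exI[of _ 1]) auto
    ultimately show "((\<lambda>x. c x / x ^ p) \<longlongrightarrow> \<alpha> 0) (at_right 0)"
      unfolding a0 by (rule Lim_transform_eventually)
    show "A i 0 = 0" if "i < p" for i using that by (simp add: A(3) \<gamma>_def)
  qed (use m p A(1) \<alpha>0 in auto)
  moreover have "A p 0 \<noteq> 0" using \<alpha>0 by (simp add: A(3) \<gamma>_def)
  ultimately show thesis by (rule that)
qed

lemma (in side_jet) green_integral:
  assumes sol: "onesol P Q g" and Y: "testfn (-1) 1 Y" and h: "h absolutely_integrable_on {0..1}"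
    and N: "negligible N" "\<And>x. x \<in> {0<..<1} - N \<Longrightarrow> h x = g x"
  shows "integral {0..1} (\<lambda>x. (-1) ^ m * leibniz A (\<lambda>k. Y (k + m)) m x * h x)
    = (-1) ^ m * lam * integral {0..1} (\<lambda>x. Y 0 x * h x) - boundary P Q Y"
proof -
  have N': "negligible (N \<union> {0, 1})" by (rule negligible_Un[OF N(1)]) (simp add: negligible_finite)
  have \<theta>: "testfn (-1) 1 (leibniz A (\<lambda>k. Y (k + m)))"
    by (rule testfn_leibniz[OF A testfn_shift[OF Y]])
  have i1: "(\<lambda>x. (-1) ^ m * leibniz A (\<lambda>k. Y (k + m)) m x * h x) integrable_on {0..1}"
  proof -
    have "continuous_on {0..1} (\<lambda>x. (-1) ^ m * leibniz A (\<lambda>k. Y (k + m)) m x)"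
      by (intro continuous_intros testfn_continuous[OF \<theta>])
    from continuous_mult_absolutely_integrable[OF this h] show ?thesis
      by (simp add: absolutely_integrable_on_def)
  qed
  have i2: "(\<lambda>x. Y 0 x * h x) integrable_on {0..1}"
    using continuous_mult_absolutely_integrable[OF testfn_continuous[OF Y] h]
    by (simp add: absolutely_integrable_on_def)
  have "integral {0..1} (\<lambda>x. (-1) ^ m * leibniz A (\<lambda>k. Y (k + m)) m x * h x - (-1) ^ m * lam * (Y 0 x * h x))
    = integral {0..1} (\<lambda>x. (-1) ^ m * leibniz A (\<lambda>k. Y (k + m)) m x * g x - (-1) ^ m * lam * (Y 0 x * g x))"
  proof (rule integral_spike[OF N'])
    fix x assume "x \<in> {0..1} - (N \<union> {0, 1})"
    then have "g x = h x" using N(2)[of x] by auto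
    then show "(-1) ^ m * leibniz A (\<lambda>k. Y (k + m)) m x * g x - (-1) ^ m * lam * (Y 0 x * g x)
      = (-1) ^ m * leibniz A (\<lambda>k. Y (k + m)) m x * h x - (-1) ^ m * lam * (Y 0 x * h x)" by simp
  qed
  also have "\<dots> = - boundary P Q Y"
    by (rule integral_unique[OF green[OF sol Y]])
  finally show ?thesis
    unfolding Henstock_Kurzweil_Integration.integral_diff[OF i1 integrable_on_mult_right[OF i2]] integral_mult_right
    by (simp only: diff_eq_eq uminus_add_conv_diff) simp
qed

lemma sum_lessThan_add: "(\<Sum>s<m + n. f s) = (\<Sum>s<m. f s) + (\<Sum>s<n. f (m + s))" for f :: "nat \<Rightarrow> complex"
  by (induction n) (auto simp: add.assoc)

lemma reflect_reflect: "reflect (reflect Y) = Y"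
  by (auto simp: fun_eq_iff reflect_def power_mult_distrib[symmetric] mult.assoc[symmetric])

text \<open>Both halves share \<open>m\<close> and \<open>lam\<close>: the reflection of the left
  half changes the sign of 2m derivatives in total, which cancels.\<close>

locale two_sided =
  R: side_jet m p c \<kappa> lam A a0 + L: side_jet m q c' \<kappa>' lam A' a0'
  for m p c \<kappa> lam A a0 q c' \<kappa>' A' a0' +
  assumes top: "A p 0 \<noteq> 0" "A' q 0 \<noteq> 0"
begin

text \<open>The adjoint equation split at 0, with the left half reflected: h' stands for the left
  part read at -x, and the test function is reflected accordingly.\<close>

definition weak_pair :: "(real \<Rightarrow> complex) \<Rightarrow> (real \<Rightarrow> complex) \<Rightarrow> bool"
  where "weak_pair h h' \<longleftrightarrow> (\<forall>Y. testfn (-1) 1 Y \<longrightarrow>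
    integral {0..1} (\<lambda>x. (-1) ^ m * leibniz A (\<lambda>k. Y (k + m)) m x * h x)
    + integral {0..1} (\<lambda>x. (-1) ^ m * leibniz A' (\<lambda>k. reflect Y (k + m)) m x * h' x)
    = (-1) ^ m * lam * (integral {0..1} (\<lambda>x. Y 0 x * h x) + integral {0..1} (\<lambda>x. reflect Y 0 x * h' x)))"

text \<open>The sign comes from reflecting the derivative of order m + s of the test
  function.\<close>

definition jump_coeff' :: "nat \<Rightarrow> nat \<Rightarrow> complex"
  where "jump_coeff' s k = (-1) ^ (m + s) * L.jump_coeff s k"

definition compatible :: "(nat \<Rightarrow> complex) \<Rightarrow> (nat \<Rightarrow> complex) \<Rightarrow> (nat \<Rightarrow> complex) \<Rightarrow> (nat \<Rightarrow> complex) \<Rightarrow> bool"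
  where "compatible P Q P' Q' \<longleftrightarrow> (\<forall>j<m. P' j = (-1) ^ (m + j) * P j) \<and>
    (\<forall>s<m. (\<Sum>k<m. R.jump_coeff s k * Q k) + (\<Sum>k<m. jump_coeff' s k * Q' k) = 0)"

text \<open>The sum is a combination of the first 2m derivatives of \<open>Y\<close> at 0, which can
  be prescribed independently, so each coefficient vanishes. For orders below \<open>m\<close> this
  matches P with P', where reflecting the derivative of order m - 1 - j produces the sign (-1)^(m +
  j).\<close>

lemma boundary_sum_zero_iff:
  "(\<forall>Y. testfn (-1) 1 Y \<longrightarrow> R.boundary P Q Y + L.boundary P' Q' (reflect Y) = 0) \<longleftrightarrow> compatible P Q P' Q'"
proof -
  define K where "K s = (if s < m then (-1) ^ (m - 1 - s) * (P (m - 1 - s) + (-1) ^ s * P' (m - 1 - s))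
    else (\<Sum>k<m. R.jump_coeff (s - m) k * Q k) + (\<Sum>k<m. jump_coeff' (s - m) k * Q' k))" for s
  have "R.boundary P Q Y + L.boundary P' Q' (reflect Y) = (\<Sum>s<m + m. K s * Y s 0)" for Y
  proof -
    have "(\<Sum>s<m + m. K s * Y s 0) = (\<Sum>s<m. (-1) ^ (m - 1 - s) * (P (m - 1 - s) + (-1) ^ s * P' (m - 1 - s)) * Y s 0)
      + (\<Sum>s<m. ((\<Sum>k<m. R.jump_coeff s k * Q k) + (\<Sum>k<m. jump_coeff' s k * Q' k)) * Y (m + s) 0)"
      unfolding sum_lessThan_add by (simp add: K_def)
    also have "\<dots> = R.boundary P Q Y + L.boundary P' Q' (reflect Y)"
      unfolding R.boundary_expand L.boundary_expand reflect_def jump_coeff'_def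
      by (simp add: algebra_simps sum.distrib sum_distrib_left sum_distrib_right)
    finally show ?thesis by simp
  qed
  then have "(\<forall>Y. testfn (-1) 1 Y \<longrightarrow> R.boundary P Q Y + L.boundary P' Q' (reflect Y) = 0)
    \<longleftrightarrow> (\<forall>Y. testfn (-1) 1 Y \<longrightarrow> (\<Sum>s<m + m. K s * Y s 0) = 0)" by simp
  also have "\<dots> \<longleftrightarrow> (\<forall>s<m + m. K s = 0)"
    using jets_independent[where K=K and n="m + m"] by auto
  also have "\<dots> \<longleftrightarrow> (\<forall>s<m. K s = 0) \<and> (\<forall>s<m. K (m + s) = 0)"
  proof (intro iffI conjI allI impI)
    fix s assume *: "(\<forall>s<m. K s = 0) \<and> (\<forall>s<m. K (m + s) = 0)" "s < m + m"
    show "K s = 0"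
    proof (cases "s < m")
      case False
      then have "s = m + (s - m)" "s - m < m" using *(2) by auto
      then show ?thesis using *(1) by metis
    qed (use * in simp)
  qed auto
  also have "(\<forall>s<m. K s = 0) \<longleftrightarrow> (\<forall>j<m. P' j = (-1) ^ (m + j) * P j)"
  proof -
    have 1: "K (m - 1 - j) = 0 \<longleftrightarrow> P' j = (-1) ^ (m + j) * P j" if "j < m" for j
    proof -
      define s where "s = m - 1 - j"
      have s: "s < m" "m - 1 - s = j" "m + j = Suc (s + 2 * j)" using that by (auto simp: s_def)
      have "K s = 0 \<longleftrightarrow> P j + (-1) ^ s * P' j = 0"
        using s by (simp add: K_def)
      also have "\<dots> \<longleftrightarrow> (-1) ^ s * (P j + (-1) ^ s * P' j) = 0" by simp
      also have "(-1) ^ s * (P j + (-1) ^ s * P' j) = (-1) ^ s * P j + P' j"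
        by (simp add: distrib_left mult.assoc[symmetric] power_mult_distrib[symmetric])
      also have "\<dots> = 0 \<longleftrightarrow> P' j = (-1) ^ (m + j) * P j"
        unfolding s(3) by (auto simp: power_add power_mult add_eq_0_iff add.commute)
      finally show ?thesis by (simp add: s_def)
    qed
    show ?thesis
    proof (intro iffI allI impI)
      fix j assume "\<forall>s<m. K s = 0" "j < m"
      then show "P' j = (-1) ^ (m + j) * P j" using 1[of j] by simp
    next
      fix s assume "\<forall>j<m. P' j = (-1) ^ (m + j) * P j" "s < m"
      then show "K s = 0" using 1[of "m - 1 - s"] by simp
    qed
  qed
  also have "(\<forall>s<m. K (m + s) = 0) \<longleftrightarrow>
      (\<forall>s<m. (\<Sum>k<m. R.jump_coeff s k * Q k) + (\<Sum>k<m. jump_coeff' s k * Q' k) = 0)"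
    by (simp add: K_def)
  finally show ?thesis unfolding compatible_def .
qed

lemma weak_pair_iff_compatible:
  assumes "R.onesol P Q g" "L.onesol P' Q' g'"
    and h: "h absolutely_integrable_on {0..1}" "h' absolutely_integrable_on {0..1}"
    and N: "negligible N" "\<And>x. x \<in> {0<..<1} - N \<Longrightarrow> h x = g x"
    and N': "negligible N'" "\<And>x. x \<in> {0<..<1} - N' \<Longrightarrow> h' x = g' x"
  shows "weak_pair h h' \<longleftrightarrow> compatible P Q P' Q'"
proof -
  have key: "u - b + (v - b') = u + v \<longleftrightarrow> b + b' = 0" for u v b b' :: complex
  proof -
    have "u - b + (v - b') = u + v - (b + b')" by simp
    then show ?thesis by (auto simp: add_eq_0_iff2)
  qed
  have "weak_pair h h' \<longleftrightarrow> (\<forall>Y. testfn (-1) 1 Y \<longrightarrow> R.boundary P Q Y + L.boundary P' Q' (reflect Y) = 0)"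
    unfolding weak_pair_def
  proof (intro all_cong1 imp_cong refl)
    fix Y assume Y: "testfn (-1) 1 Y"
    then have Y': "testfn (-1) 1 (reflect Y)" using testfn_reflect[OF Y] by simp
    show "(integral {0..1} (\<lambda>x. (-1) ^ m * leibniz A (\<lambda>k. Y (k + m)) m x * h x)
      + integral {0..1} (\<lambda>x. (-1) ^ m * leibniz A' (\<lambda>k. reflect Y (k + m)) m x * h' x)
      = (-1) ^ m * lam * (integral {0..1} (\<lambda>x. Y 0 x * h x) + integral {0..1} (\<lambda>x. reflect Y 0 x * h' x)))
      \<longleftrightarrow> R.boundary P Q Y + L.boundary P' Q' (reflect Y) = 0"
    proof -
      have 1: "integral {0..1} (\<lambda>x. (-1) ^ m * leibniz A (\<lambda>k. Y (k + m)) m x * h x)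
        = (-1) ^ m * lam * integral {0..1} (\<lambda>x. Y 0 x * h x) - R.boundary P Q Y"
        by (rule R.green_integral[OF assms(1) Y h(1) N])
      have 2: "integral {0..1} (\<lambda>x. (-1) ^ m * leibniz A' (\<lambda>k. reflect Y (k + m)) m x * h' x)
        = (-1) ^ m * lam * integral {0..1} (\<lambda>x. reflect Y 0 x * h' x) - L.boundary P' Q' (reflect Y)"
        by (rule L.green_integral[OF assms(2) Y' h(2) N'])
      show ?thesis unfolding 1 2 distrib_left by (rule key)
    qed
  qed
  then show ?thesis unfolding boundary_sum_zero_iff .
qed

text \<open>Test functions supported on one side of 0 decouple the two equations and give the
  one-sided solutions; those crossing 0 then give compatibility.\<close>

theorem weak_pair_solutions:
  assumes h: "h absolutely_integrable_on {0..1}" "h' absolutely_integrable_on {0..1}" and w: "weak_pair h h'"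
  shows "\<exists>P Q P' Q' g g' N N'. R.onesol P Q g \<and> L.onesol P' Q' g' \<and> compatible P Q P' Q' \<and>
    negligible N \<and> (\<forall>x\<in>{0<..<1} - N. h x = g x) \<and> negligible N' \<and> (\<forall>x\<in>{0<..<1} - N'. h' x = g' x)"
proof -
  have zero: "Y k (- x) = 0" if "testfn 0 1 Y" "x \<in> {0..1}" for Y k x
    using testfn_zero_outside[OF that(1), of "- x"] that(2) by auto
  have "\<exists>P Q g N. R.onesol P Q g \<and> negligible N \<and> (\<forall>x\<in>{0<..<1} - N. h x = g x)"
  proof (rule R.weak_solution_imp_onesol[OF h(1)])
    fix Y assume Y: "testfn 0 1 Y"
    have "testfn (-1) 1 Y" by (rule testfn_mono[OF Y]) auto
    note eq = w[unfolded weak_pair_def, rule_format, OF this]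
    have "integral {0..1} (\<lambda>x. (-1) ^ m * leibniz A' (\<lambda>k. reflect Y (k + m)) m x * h' x) = integral {0..1::real} (\<lambda>x. 0)"
      by (rule Henstock_Kurzweil_Integration.integral_cong) (simp add: leibniz_def reflect_def zero[OF Y])
    moreover have "integral {0..1} (\<lambda>x. reflect Y 0 x * h' x) = integral {0..1::real} (\<lambda>x. 0)"
      by (rule Henstock_Kurzweil_Integration.integral_cong) (simp add: reflect_def zero[OF Y])
    ultimately show "integral {0..1} (\<lambda>x. (-1) ^ m * leibniz A (\<lambda>k. Y (k + m)) m x * h x)
      = (-1) ^ m * lam * integral {0..1} (\<lambda>x. Y 0 x * h x)"
      using eq by simp
  qed
  moreover have "\<exists>P Q g N. L.onesol P Q g \<and> negligible N \<and> (\<forall>x\<in>{0<..<1} - N. h' x = g x)"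
  proof (rule L.weak_solution_imp_onesol[OF h(2)])
    fix Y assume Y: "testfn 0 1 Y"
    have "testfn (-1) 1 (reflect Y)" by (rule testfn_mono[OF testfn_reflect[OF Y]]) auto
    note eq = w[unfolded weak_pair_def, rule_format, OF this]
    have "integral {0..1} (\<lambda>x. (-1) ^ m * leibniz A (\<lambda>k. reflect Y (k + m)) m x * h x) = integral {0..1::real} (\<lambda>x. 0)"
      by (rule Henstock_Kurzweil_Integration.integral_cong) (simp add: leibniz_def reflect_def zero[OF Y])
    moreover have "integral {0..1} (\<lambda>x. reflect Y 0 x * h x) = integral {0..1::real} (\<lambda>x. 0)"
      by (rule Henstock_Kurzweil_Integration.integral_cong) (simp add: reflect_def zero[OF Y])
    ultimately show "integral {0..1} (\<lambda>x. (-1) ^ m * leibniz A' (\<lambda>k. Y (k + m)) m x * h' x)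
      = (-1) ^ m * lam * integral {0..1} (\<lambda>x. Y 0 x * h' x)"
      using eq by (simp add: reflect_reflect)
  qed
  ultimately obtain P Q g N P' Q' g' N' where *: "R.onesol P Q g" "negligible N" "\<forall>x\<in>{0<..<1} - N. h x = g x"
    "L.onesol P' Q' g'" "negligible N'" "\<forall>x\<in>{0<..<1} - N'. h' x = g' x" by blast
  then have "compatible P Q P' Q'"
    using weak_pair_iff_compatible[OF *(1,4) h *(2) _ *(5)] w by blast
  with * show ?thesis by blast
qed

end

section \<open>The deficiency number\<close>

lemma AE_I_measure_iff:
  "(AE x in I_measure. P x) \<longleftrightarrow> (\<exists>N. negligible N \<and> (\<forall>x\<in>{-1..1} - N. P x))"
proof -
  have "(AE x in I_measure. P x) \<longleftrightarrow> (AE x in lebesgue. x \<in> {-1..1} \<longrightarrow> P x)"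
    by (rule AE_restrict_space_iff) simp
  also have "\<dots> \<longleftrightarrow> (\<exists>N. negligible N \<and> (\<forall>x\<in>{-1..1} - N. P x))"
  proof
    assume "AE x in lebesgue. x \<in> {-1..1} \<longrightarrow> P x"
    then obtain N where "N \<in> null_sets lebesgue" "{x \<in> space lebesgue. \<not> (x \<in> {-1..1} \<longrightarrow> P x)} \<subseteq> N"
      unfolding eventually_ae_filter by blast
    then show "\<exists>N. negligible N \<and> (\<forall>x\<in>{-1..1} - N. P x)"
      by (intro exI[of _ N]) (auto simp: negligible_iff_null_sets)
  next
    assume "\<exists>N. negligible N \<and> (\<forall>x\<in>{-1..1} - N. P x)"
    then obtain N where "negligible N" "\<forall>x\<in>{-1..1} - N. P x" by blast
    then show "AE x in lebesgue. x \<in> {-1..1} \<longrightarrow> P x"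
      unfolding eventually_ae_filter by (intro bexI[of _ N]) (auto simp: negligible_iff_null_sets)
  qed
  finally show ?thesis .
qed

lemma square_integrable_rep: "square_integrable (L2_rep u)"
  using Quotient3_rep_reflp[OF Quotient3_L2I] by blast

lemma L2_of_rep: "L2_of (L2_rep u) = u"
  by (rule Quotient3_abs_rep[OF Quotient3_L2I])

lemma L2_of_eq_iff:
  assumes "square_integrable f" "square_integrable g"
  shows "L2_of f = L2_of g \<longleftrightarrow> (\<exists>N. negligible N \<and> (\<forall>x\<in>{-1..1} - N. f x = g x))"
  using Quotient3_rel[OF Quotient3_L2I, of f g] assms unfolding AE_I_measure_iff[symmetric] by auto

lemma L2_of_zero: "0 = L2_of (\<lambda>_. 0)"
  by (simp add: zero_L2I_def)

lemma L2_of_lincomb: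
  assumes "square_integrable f" "square_integrable g"
  shows "L2_of f + scaleC a (L2_of g) = L2_of (\<lambda>x. f x + a * g x)"
  using assms by (simp add: scaleC.abs_eq plus_L2I.abs_eq square_integrable_scale)

lemma square_integrable_imp_absolutely_integrable:
  assumes "square_integrable f" shows "f absolutely_integrable_on {-1..1}"
proof -
  have "square_integrable (\<lambda>_. 1)"
    by (simp add: square_integrable_def lmeasurable_iff_integrable[symmetric] integrable_on_const)
  from square_integrable_integrable_mult[OF assms this] have "integrable I_measure f" by simp
  then show ?thesis
    by (simp add: integrable_restrict_space set_integrable_def)
qed

lemma square_integrable_cnj: "square_integrable f \<Longrightarrow> square_integrable (\<lambda>x. cnj (f x))"
  unfolding square_integrable_def
  by (auto intro!: borel_measurable_continuous_on[where f = cnj] continuous_intros)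

lemma cinner_L2_of:
  assumes "square_integrable f" "square_integrable g"
  shows "cinner (L2_of f) (L2_of g) = integral {-1..1} (\<lambda>x. f x * cnj (g x))"
proof -
  have "cinner (L2_of f) (L2_of g) = (\<integral>x. f x * cnj (g x) \<partial>I_measure)"
    using assms by (simp add: cinner.abs_eq)
  then show ?thesis
    using lebesgue_integral_eq_integral[OF square_integrable_integrable_mult[OF assms]] by simp
qed

text \<open>For fixed (z, w) the defining condition is closed in (u, v). Continuity is available for
  the real inner product, so the imaginary part is expressed through it by multiplying z with the
  imaginary unit.\<close>

lemma adjoint_closure: "adjoint (closure T) = adjoint T"
proof -
  have Im: "Im (cinner u z) = inner u (scaleC \<i> z)" and Re: "Re (cinner u z) = inner u z" for u z
  proof -
    have "cinner u (scaleC \<i> z) = - \<i> * cinner u z"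
    proof -
      have "cinner (L2_of f) (scaleC \<i> (L2_of g)) = - \<i> * cinner (L2_of f) (L2_of g)"
        if "square_integrable f" "square_integrable g" for f g
        using that by (simp add: scaleC.abs_eq cinner_L2_of square_integrable_scale mult.left_commute)
      from this[OF square_integrable_rep square_integrable_rep, of u z] show ?thesis
        by (simp add: L2_of_rep)
    qed
    then show "Im (cinner u z) = inner u (scaleC \<i> z)" by (simp add: inner_L2I_def)
  qed (simp add: inner_L2I_def)
  have "closed {(u, v). cinner v z = cinner u w}" for z w
  proof -
    have "{(u, v). cinner v z = cinner u w} = {x. inner (snd x) z = inner (fst x) w \<and>
        inner (snd x) (scaleC \<i> z) = inner (fst x) (scaleC \<i> w)}"
      by (auto simp: complex_eq_iff Re Im)
    also have "closed \<dots>"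
      by (intro closed_Collect_conj closed_Collect_eq continuous_intros)
    finally show ?thesis .
  qed
  then have "closure T \<subseteq> {(u, v). cinner v z = cinner u w} \<longleftrightarrow> T \<subseteq> {(u, v). cinner v z = cinner u w}" for z w
    by (meson closure_minimal closure_subset order_trans)
  moreover have "adjoint S = {(z, w). S \<subseteq> {(u, v). cinner v z = cinner u w}}" for S
    unfolding adjoint_def by auto
  ultimately show ?thesis by simp
qed

definition glue :: "(real \<Rightarrow> complex) \<Rightarrow> (real \<Rightarrow> complex) \<Rightarrow> real \<Rightarrow> complex"
  where "glue g g' x = (if x \<in> {0<..<1} then g x else 0) + (if x \<in> {-1<..<0} then g' (- x) else 0)"

lemma glue_simps: "x \<in> {0<..<1} \<Longrightarrow> glue g g' x = g x" "x \<in> {0<..<1} \<Longrightarrow> glue g g' (- x) = g' x"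
  by (auto simp: glue_def)

text \<open>Squaring x^(-1/4) gives x^(-1/2), which is integrable at 0.\<close>

lemma glue_square_integrable:
  assumes g: "continuous_on {0<..<1} g" "pbd (- 1 / 4) g" and g': "continuous_on {0<..<1} g'" "pbd (- 1 / 4) g'"
  shows "square_integrable (glue g g')"
proof -
  have m1: "(\<lambda>x. if x \<in> {0<..<1} then g x else 0) \<in> borel_measurable lebesgue"
    by (intro borel_measurable_if_I continuous_imp_measurable_on_sets_lebesgue g) auto
  have c': "continuous_on {-1<..<0} (\<lambda>x. g' (- x))"
    by (rule continuous_on_compose2[OF g'(1)]) (auto intro!: continuous_intros)
  have m2: "(\<lambda>x. if x \<in> {-1<..<0} then g' (- x) else 0) \<in> borel_measurable lebesgue"
    by (intro borel_measurable_if_I continuous_imp_measurable_on_sets_lebesgue c') auto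
  have m: "glue g g' \<in> borel_measurable I_measure"
    unfolding glue_def[abs_def] by (intro measurable_restrict_space1 borel_measurable_add m1 m2)
  obtain C where C: "C \<ge> 0" "\<And>x. x \<in> {0<..<1} \<Longrightarrow> norm (g x) \<le> C * x powr (- 1 / 4)"
    using g(2) unfolding pbd_def by auto
  obtain B where B: "B \<ge> 0" "\<And>x. x \<in> {0<..<1} \<Longrightarrow> norm (g' x) \<le> B * x powr (- 1 / 4)"
    using g'(2) unfolding pbd_def by auto
  define M where "M = max C B"
  have bound: "(norm (glue g g' x))\<^sup>2 \<le> M\<^sup>2 * \<bar>x\<bar> powr (- 1 / 2)" for x
  proof -
    have pw: "(t powr (- 1 / 4))\<^sup>2 = t powr (- 1 / 2)" if "t \<ge> 0" for t :: real
      using that by (simp add: power2_eq_square powr_add[symmetric])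
    have "norm (glue g g' x) \<le> M * \<bar>x\<bar> powr (- 1 / 4)"
    proof (cases "x \<in> {0<..<1} \<or> x \<in> {-1<..<0}")
      case True
      then show ?thesis
      proof
        assume x: "x \<in> {0<..<1}"
        have "norm (g x) \<le> C * x powr (- 1 / 4)" by (rule C(2)[OF x])
        also have "\<dots> \<le> M * x powr (- 1 / 4)" by (intro mult_right_mono) (auto simp: M_def)
        finally show ?thesis using x by (simp add: glue_def)
      next
        assume x: "x \<in> {-1<..<0}"
        have "norm (g' (- x)) \<le> B * (- x) powr (- 1 / 4)" using x by (intro B(2)) auto
        also have "\<dots> \<le> M * (- x) powr (- 1 / 4)" by (intro mult_right_mono) (auto simp: M_def)
        finally show ?thesis using x by (simp add: glue_def)
      qed
    next
      case False
      then show ?thesis using C(1) by (auto simp: glue_def M_def)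
    qed
    then have "(norm (glue g g' x))\<^sup>2 \<le> (M * \<bar>x\<bar> powr (- 1 / 4))\<^sup>2" by (rule power_mono) simp
    then show ?thesis unfolding power_mult_distrib pw[OF abs_ge_zero] .
  qed
  have i1: "(\<lambda>x. \<bar>x\<bar> powr (- 1 / 2)) integrable_on {0..1::real}"
  proof -
    have "(\<lambda>x. x powr (- 1 / 2)) integrable_on {0..1::real}" by (rule integrable_on_powr_from_0) auto
    then show ?thesis by (rule integrable_eq) auto
  qed
  then have i2: "(\<lambda>x. \<bar>x\<bar> powr (- 1 / 2)) integrable_on {-1..0::real}"
    using Henstock_Kurzweil_Integration.integrable_reflect_real[of "\<lambda>x. \<bar>x\<bar> powr (- 1 / 2)" 1 0] by simp
  have "(\<lambda>x. \<bar>x\<bar> powr (- 1 / 2)) integrable_on {-1..1::real}"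
    by (rule Henstock_Kurzweil_Integration.integrable_combine[OF _ _ i2 i1]) auto
  then have i3: "(\<lambda>x. M\<^sup>2 * \<bar>x\<bar> powr (- 1 / 2)) integrable_on {-1..1::real}"
    by (rule integrable_on_mult_right)
  have "(\<lambda>x. (norm (glue g g' x))\<^sup>2) absolutely_integrable_on {-1..1}"
    by (rule measurable_bounded_by_integrable_imp_absolutely_integrable[OF _ _ i3]) (use m bound in auto)
  then have "integrable I_measure (\<lambda>x. (norm (glue g g' x))\<^sup>2)"
    by (simp add: integrable_restrict_space set_integrable_def)
  with m show ?thesis by (simp add: square_integrable_def)
qed

lemma square_integrable_cong_finite:
  assumes "square_integrable f" "finite S" "\<And>x. x \<in> {-1..1} - S \<Longrightarrow> g x = f x"
  shows "square_integrable g"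
proof -
  have S: "countable S" using assms(2) by (rule countable_finite)
  have s: "{x} \<in> sets I_measure" if "x \<in> S \<inter> {-1..1}" for x
    using that by (auto simp: sets_restrict_space_iff)
  have m: "g \<in> borel_measurable I_measure"
    by (rule measurable_discrete_difference[of f, where X="S \<inter> {-1..1}"])
      (use assms S s in \<open>auto simp: square_integrable_def intro: countable_subset\<close>)
  have "integrable I_measure (\<lambda>x. (norm (f x))\<^sup>2) \<longleftrightarrow> integrable I_measure (\<lambda>x. (norm (g x))\<^sup>2)"
  proof (rule integrable_cong_AE)
    have "negligible S" using assms(2) by (rule negligible_finite)
    then show "AE x in I_measure. (norm (f x))\<^sup>2 = (norm (g x))\<^sup>2"
      unfolding AE_I_measure_iff using assms(3) by (intro exI[of _ S]) auto
  qed (use m assms(1) in \<open>auto simp: square_integrable_def\<close>)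
  with m assms(1) show ?thesis by (simp add: square_integrable_def)
qed

lemma continuous_zero_off_negligible:
  fixes g :: "real \<Rightarrow> complex"
  assumes "continuous_on {0<..<1} g" "negligible N" "\<And>x. x \<in> {0<..<1} - N \<Longrightarrow> g x = 0" "x \<in> {0<..<1}"
  shows "g x = 0"
proof (rule ccontr)
  assume "g x \<noteq> 0"
  let ?U = "{0<..<1} \<inter> g -` (- {0})"
  have "open ?U" by (rule continuous_open_preimage[OF assms(1)]) auto
  moreover have "?U \<noteq> {}" using \<open>g x \<noteq> 0\<close> assms(4) by auto
  moreover have "negligible ?U" by (rule negligible_subset[OF assms(2)]) (use assms(3) in auto)
  ultimately show False using open_not_negligible by blast
qed

lemma negligible_uminus:
  fixes N :: "real set"
  assumes "negligible N" shows "negligible (uminus ` N)"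
  by (rule negligible_differentiable_image_negligible[OF _ assms]) (auto intro!: derivative_intros simp: differentiable_on_def)

lemma integral_split_at_0:
  fixes F :: "real \<Rightarrow> complex"
  assumes "F integrable_on {-1..1}"
  shows "integral {-1..1} F = integral {0..1} F + integral {0..1} (\<lambda>x. F (- x))"
proof -
  have "integral {-1..0} F = integral {0..1} (\<lambda>x. F (- x))"
    using Henstock_Kurzweil_Integration.integral_reflect_real[of 1 0 "\<lambda>x. F (- x)"] by simp
  moreover have "integral {-1..0} F + integral {0..1} F = integral {-1..1} F"
    by (rule Henstock_Kurzweil_Integration.integral_combine) (use assms in auto)
  ultimately show ?thesis by (simp add: add.commute)
qed

lemma (in side) onesol_continuous: "onesol P Q f \<Longrightarrow> continuous_on {0<..<1} f"
proof -
  assume "onesol P Q f"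
  then obtain Z V where 1: "chain P Q Z V" "\<forall>x\<in>{0<..<1}. Z 0 x = f x" unfolding onesol_def by blast
  have "continuous_on {0<..<1} (Z 0)"
    using chainD(1)[OF 1(1), of 0] m by (intro deriv_imp_continuous_on[of _ _ "Z (Suc 0)"]) auto
  then show ?thesis by (rule continuous_on_eq) (use 1(2) in auto)
qed

lemma (in side) onesol_pbd: "onesol P Q f \<Longrightarrow> pbd (- 1 / 4) f"
  by (simp add: onesol_def)

lemma (in side) onesol_low: "onesol P Q f \<Longrightarrow> j < p - m \<Longrightarrow> P j = 0"
  by (simp add: onesol_def)

section \<open>From the operator to the matching problem\<close>

locale degenerate_operator = two_sided +
  assumes c': "c' = (\<lambda>x. c (- x))"
begin

lemma diff_expr_right:
  assumes Y: "testfn (-1) 1 Y" and x: "x \<in> {0<..<1}"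
  shows "diff_expr m c (Y 0) x = (-1) ^ m * leibniz A (\<lambda>k. Y (k + m)) m x"
proof -
  have "nth_deriv m (\<lambda>t. complex_of_real (c t) * nth_deriv m (Y 0) t) x = leibniz A (\<lambda>k. Y (k + m)) m x"
  proof (rule nth_deriv_eqI[where S="{0<..<1}" and D="leibniz A (\<lambda>k. Y (k + m))", OF _ _ _ x])
    show "derivs (leibniz A (\<lambda>k. Y (k + m))) {0<..<1}"
      by (intro derivs_leibniz derivs_subset[OF R.A] testfn_derivs[OF testfn_shift[OF Y]]) auto
    show "complex_of_real (c t) * nth_deriv m (Y 0) t = leibniz A (\<lambda>k. Y (k + m)) 0 t" if "t \<in> {0<..<1}" for t
      using R.A_c[OF that] testfn_test_functions(2)[OF Y] by simp
  qed simp
  then show ?thesis by (simp add: diff_expr_def)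
qed

text \<open>Reflection contributes (-1)^m for the inner and again for the outer \<open>m\<close>-th
  derivative, and the two signs cancel.\<close>

lemma diff_expr_left:
  assumes Y: "testfn (-1) 1 Y" and x: "x \<in> {0<..<1}"
  shows "diff_expr m c (Y 0) (- x) = (-1) ^ m * leibniz A' (\<lambda>k. reflect Y (k + m)) m x"
proof -
  let ?L = "leibniz A' (\<lambda>k. reflect Y (k + m))"
  have Y': "testfn (-1) 1 (reflect Y)" using testfn_reflect[OF Y] by simp
  have sq: "(-1) ^ m * ((-1) ^ m * z) = z" for z :: complex
    by (simp add: mult.assoc[symmetric] power_mult_distrib[symmetric])
  have "derivs ?L {0<..<1}"
    by (intro derivs_leibniz derivs_subset[OF L.A] testfn_derivs[OF testfn_shift[OF Y']]) auto
  then have "derivs (\<lambda>k x. of_real (-1) ^ k * ?L k (-1 * x + 0)) {-1<..<0}"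
    by (rule derivs_affine) auto
  then have d: "derivs (\<lambda>k x. (-1) ^ m * ((-1) ^ k * ?L k (- x))) {-1<..<0}"
    by (intro derivs_scale) simp
  have "nth_deriv m (\<lambda>t. complex_of_real (c t) * nth_deriv m (Y 0) t) (- x) = (-1) ^ m * ((-1) ^ m * ?L m (- (- x)))"
  proof (rule nth_deriv_eqI[OF d])
    fix t :: real assume "t \<in> {-1<..<0}"
    then have "A' 0 (- t) = of_real (c t)" using L.A_c[of "- t"] by (simp add: c')
    then show "complex_of_real (c t) * nth_deriv m (Y 0) t = (-1) ^ m * ((-1) ^ 0 * ?L 0 (- t))"
      using testfn_test_functions(2)[OF Y] by (simp add: reflect_def mult.left_commute sq)
  qed (use x in auto)
  then show ?thesis by (simp add: diff_expr_def sq)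
qed

lemma square_integrable_testfn:
  assumes Y: "testfn (-1) 1 Y" shows "square_integrable (Y 0)"
proof -
  have "pbd 0 (D j)" "continuous_on {0<..<1} (D j)" if "testfn (-1) 1 D" for D j
    using continuous_imp_pbd[OF testfn_continuous[OF that]] testfn_continuous[OF that] by auto
  then have *: "continuous_on {0<..<1} (D j)" "pbd (- 1 / 4) (D j)" if "testfn (-1) 1 D" for D j
    using that pbd_mono[of 0 "D j" "- 1 / 4"] by auto
  have Y': "testfn (-1) 1 (reflect Y)" using testfn_reflect[OF Y] by simp
  show ?thesis
    by (rule square_integrable_cong_finite[OF glue_square_integrable[OF *[OF Y, where j=0] *[OF Y', where j=0]], of "{-1, 0, 1}"])
      (auto simp: glue_def reflect_def)
qed

text \<open>Off -1, 0 and 1 the expression is glued from two test functions; at 0, where the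
  iterated derivative may be a mere default value, nothing is claimed.\<close>

lemma square_integrable_diff_expr:
  assumes Y: "testfn (-1) 1 Y" shows "square_integrable (diff_expr m c (Y 0))"
proof -
  have *: "continuous_on {0<..<1} (\<lambda>x. (-1) ^ m * D j x)" "pbd (- 1 / 4) (\<lambda>x. (-1) ^ m * D j x)"
    if "testfn (-1) 1 D" for D j
    using pbd_scale[OF pbd_mono[OF continuous_imp_pbd[OF testfn_continuous[OF that]]], of "- 1 / 4"]
    by (auto intro!: continuous_intros testfn_continuous[OF that])
  have Y': "testfn (-1) 1 (reflect Y)" using testfn_reflect[OF Y] by simp
  have t: "testfn (-1) 1 (leibniz A (\<lambda>k. Y (k + m)))" "testfn (-1) 1 (leibniz A' (\<lambda>k. reflect Y (k + m)))"
    by (intro testfn_leibniz R.A L.A testfn_shift Y Y')+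
  show ?thesis
  proof (rule square_integrable_cong_finite[OF glue_square_integrable[OF *[OF t(1)] *[OF t(2)]], of "{-1, 0, 1}"])
    fix x :: real assume "x \<in> {-1..1} - {-1, 0, 1}"
    then consider "x \<in> {0<..<1}" | "- x \<in> {0<..<1}" by force
    then show "diff_expr m c (Y 0) x = glue (\<lambda>x. (-1) ^ m * leibniz A (\<lambda>k. Y (k + m)) m x)
        (\<lambda>x. (-1) ^ m * leibniz A' (\<lambda>k. reflect Y (k + m)) m x) x"
    proof cases
      case 1
      then show ?thesis using diff_expr_right[OF Y 1] by (simp add: glue_simps)
    next
      case 2
      from diff_expr_left[OF Y 2] glue_simps(2)[OF 2] show ?thesis by simp
    qed
  qed simp
qed

text \<open>The inner product is conjugate linear in its second argument, so the weak equation is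
  one for the conjugate of \<open>f\<close>, with the conjugate eigenvalue in
  \<open>lam\<close>.\<close>

lemma adjoint_eigen_iff:
  assumes f: "square_integrable f" and lam: "lam = (-1) ^ m * cnj \<mu>"
  shows "(L2_of f, scaleC \<mu> (L2_of f)) \<in> adjoint (minimal_operator m c) \<longleftrightarrow>
    weak_pair (\<lambda>x. cnj (f x)) (\<lambda>x. cnj (f (- x)))"
proof -
  have nu: "(-1) ^ m * lam = cnj \<mu>"
    unfolding lam by (simp add: mult.assoc[symmetric] power_mult_distrib[symmetric])
  have "(L2_of f, scaleC \<mu> (L2_of f)) \<in> adjoint (minimal_operator m c) \<longleftrightarrow>
    (\<forall>y\<in>test_functions. cinner (L2_of (diff_expr m c y)) (L2_of f) = cinner (L2_of y) (scaleC \<mu> (L2_of f)))"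
    unfolding minimal_operator_def adjoint_closure
    unfolding preminimal_operator_def adjoint_def by auto
  also have "\<dots> \<longleftrightarrow> (\<forall>Y. testfn (-1) 1 Y \<longrightarrow>
    cinner (L2_of (diff_expr m c (Y 0))) (L2_of f) = cinner (L2_of (Y 0)) (scaleC \<mu> (L2_of f)))"
  proof (intro iffI allI ballI impI)
    fix y assume H: "\<forall>Y. testfn (-1) 1 Y \<longrightarrow>
      cinner (L2_of (diff_expr m c (Y 0))) (L2_of f) = cinner (L2_of (Y 0)) (scaleC \<mu> (L2_of f))"
      and y: "y \<in> test_functions"
    from H[rule_format, OF test_functions_testfn[OF y]]
    show "cinner (L2_of (diff_expr m c y)) (L2_of f) = cinner (L2_of y) (scaleC \<mu> (L2_of f))" by simp
  qed (use testfn_test_functions(1) in blast)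
  also have "\<dots> \<longleftrightarrow> weak_pair (\<lambda>x. cnj (f x)) (\<lambda>x. cnj (f (- x)))"
    unfolding weak_pair_def
  proof (intro all_cong1 imp_cong refl)
    fix Y assume Y: "testfn (-1) 1 Y"
    note sq = square_integrable_diff_expr[OF Y] square_integrable_testfn[OF Y]
    have int: "(\<lambda>x. u x * cnj (f x)) integrable_on {-1..1}" if "square_integrable u" for u
      using integrable_on_lebesgue_on[OF square_integrable_integrable_mult[OF that f]] by simp
    have "cinner (L2_of (diff_expr m c (Y 0))) (L2_of f) = integral {-1..1} (\<lambda>x. diff_expr m c (Y 0) x * cnj (f x))"
      by (rule cinner_L2_of[OF sq(1) f])
    also have "\<dots> = integral {0..1} (\<lambda>x. diff_expr m c (Y 0) x * cnj (f x))
        + integral {0..1} (\<lambda>x. diff_expr m c (Y 0) (- x) * cnj (f (- x)))"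
      by (rule integral_split_at_0[OF int[OF sq(1)]])
    also have "integral {0..1} (\<lambda>x. diff_expr m c (Y 0) x * cnj (f x))
        = integral {0..1} (\<lambda>x. (-1) ^ m * leibniz A (\<lambda>k. Y (k + m)) m x * cnj (f x))"
      by (rule integral_spike[of "{0, 1}"]) (auto simp: diff_expr_right[OF Y])
    also have "integral {0..1} (\<lambda>x. diff_expr m c (Y 0) (- x) * cnj (f (- x)))
        = integral {0..1} (\<lambda>x. (-1) ^ m * leibniz A' (\<lambda>k. reflect Y (k + m)) m x * cnj (f (- x)))"
      by (rule integral_spike[of "{0, 1}"]) (auto simp: diff_expr_left[OF Y])
    finally have 1: "cinner (L2_of (diff_expr m c (Y 0))) (L2_of f) =
      integral {0..1} (\<lambda>x. (-1) ^ m * leibniz A (\<lambda>k. Y (k + m)) m x * cnj (f x)) +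
      integral {0..1} (\<lambda>x. (-1) ^ m * leibniz A' (\<lambda>k. reflect Y (k + m)) m x * cnj (f (- x)))" .
    have "cinner (L2_of (Y 0)) (scaleC \<mu> (L2_of f)) = integral {-1..1} (\<lambda>x. Y 0 x * cnj (\<mu> * f x))"
      using f by (simp add: scaleC.abs_eq cinner_L2_of[OF sq(2)] square_integrable_scale)
    also have "\<dots> = cnj \<mu> * integral {-1..1} (\<lambda>x. Y 0 x * cnj (f x))"
      by (simp add: mult.left_commute flip: integral_mult_right)
    also have "integral {-1..1} (\<lambda>x. Y 0 x * cnj (f x)) =
        integral {0..1} (\<lambda>x. Y 0 x * cnj (f x)) + integral {0..1} (\<lambda>x. reflect Y 0 x * cnj (f (- x)))"
      by (subst integral_split_at_0[OF int[OF sq(2)]]) (simp add: reflect_def)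
    finally have 2: "cinner (L2_of (Y 0)) (scaleC \<mu> (L2_of f)) = cnj \<mu> *
      (integral {0..1} (\<lambda>x. Y 0 x * cnj (f x)) + integral {0..1} (\<lambda>x. reflect Y 0 x * cnj (f (- x))))" .
    show "(cinner (L2_of (diff_expr m c (Y 0))) (L2_of f) = cinner (L2_of (Y 0)) (scaleC \<mu> (L2_of f))) \<longleftrightarrow>
      (integral {0..1} (\<lambda>x. (-1) ^ m * leibniz A (\<lambda>k. Y (k + m)) m x * cnj (f x)) +
      integral {0..1} (\<lambda>x. (-1) ^ m * leibniz A' (\<lambda>k. reflect Y (k + m)) m x * cnj (f (- x)))
      = (-1) ^ m * lam * (integral {0..1} (\<lambda>x. Y 0 x * cnj (f x)) + integral {0..1} (\<lambda>x. reflect Y 0 x * cnj (f (- x)))))"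
      unfolding 1 2 nu ..
  qed
  finally show ?thesis .
qed

text \<open>The summands count the free entries of the common \<open>P\<close>, all entries of one
  of \<open>Q\<close> and Q', and the free entries of the other.\<close>

theorem deficiency_number_eq:
  assumes lam: "lam = (-1) ^ m * cnj \<mu>"
  shows "deficiency_number (minimal_operator m c) \<mu> = (m - max (p - m) (q - m)) + m + (m - (m - min p q))"
proof -
  \<comment> \<open>P and P' vanish together, so the integrability conditions of both sides bear on
    \<open>P\<close>, and the stronger one decides.\<close>
  define r where "r = max (p - m) (q - m)"
  have r: "r < m" using R.p L.p by (auto simp: r_def)
  have T0': "jump_coeff' s k = 0" if "k < m" "m \<le> s + k + q" for s k
    using L.jump_coeff_zero[OF that] by (simp add: jump_coeff'_def)
  have T1': "jump_coeff' s k \<noteq> 0" if "k < m" "s + k + q = m - 1" for s k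
    using L.jump_coeff_nonzero[OF that top(2)] by (simp add: jump_coeff'_def)
  have T1: "R.jump_coeff s k \<noteq> 0" if "k < m" "s + k + p = m - 1" for s k
    using R.jump_coeff_nonzero[OF that top(1)] .
  obtain B co where B: "coordinates m r R.jump_coeff jump_coeff' B co"
    and card: "card B = (m - r) + m + (m - (m - min p q))"
    using coordinates_exist[of m p R.jump_coeff q jump_coeff' r, OF R.jump_coeff_zero T1 T0' T1'] r by auto
  have finB: "finite B" using B by (simp add: coordinates_def)
  from B have co_lin: "\<forall>P Q Q' P1 Q1 Q1' a i. co (\<lambda>j. P j + a * P1 j) (\<lambda>j. Q j + a * Q1 j) (\<lambda>j. Q' j + a * Q1' j) i
       = co P Q Q' i + a * co P1 Q1 Q1' i"
    unfolding coordinates_def by (elim conjE)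
  from B have co_onto: "\<forall>v. \<exists>P Q Q'. admissible m r R.jump_coeff jump_coeff' P Q Q' \<and> (\<forall>i\<in>B. co P Q Q' i = v i)"
    unfolding coordinates_def by (elim conjE)
  from B have co_inj: "\<forall>P Q Q'. admissible m r R.jump_coeff jump_coeff' P Q Q' \<longrightarrow> (\<forall>i\<in>B. co P Q Q' i = 0) \<longrightarrow>
      (\<forall>j<m. P j = 0 \<and> Q j = 0 \<and> Q' j = 0)"
    unfolding coordinates_def by (elim conjE)
  from B have co_zero: "\<forall>P Q Q'. (\<forall>j<m. P j = 0 \<and> Q j = 0 \<and> Q' j = 0) \<longrightarrow> (\<forall>i\<in>B. co P Q Q' i = 0)"
    unfolding coordinates_def by (elim conjE)
  define sol where "sol P Q P' Q' g g' \<longleftrightarrow> R.onesol P Q g \<and> L.onesol P' Q' g' \<and> compatible P Q P' Q'" for P Q P' Q' g g'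
  \<comment> \<open>Elements of the kernel are conjugates of glued solutions, so the coordinates are
    conjugated as well to keep the relation complex linear.\<close>
  define Rel where "Rel v z \<longleftrightarrow> (\<exists>P Q P' Q' g g'. sol P Q P' Q' g g' \<and> (\<forall>i. v i = cnj (co P Q Q' i)) \<and>
    z = L2_of (\<lambda>x. cnj (glue g g' x)))" for v z
  have glue_sq: "square_integrable (\<lambda>x. cnj (glue g g' x))" "square_integrable (glue g g')" if "sol P Q P' Q' g g'" for P Q P' Q' g g'
  proof -
    show "square_integrable (glue g g')"
      using that unfolding sol_def
      by (elim conjE) (rule glue_square_integrable[OF R.onesol_continuous R.onesol_pbd L.onesol_continuous L.onesol_pbd])
    then show "square_integrable (\<lambda>x. cnj (glue g g' x))" by (rule square_integrable_cnj)
  qed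
  have abs_int: "h absolutely_integrable_on {0..1}" "(\<lambda>x. h (- x)) absolutely_integrable_on {0..1}"
    if "square_integrable h" for h
  proof -
    note a = square_integrable_imp_absolutely_integrable[OF that]
    show "h absolutely_integrable_on {0..1}"
      by (rule absolutely_integrable_on_subinterval[OF a]) auto
    have "h absolutely_integrable_on {-1..0}"
      by (rule absolutely_integrable_on_subinterval[OF a]) auto
    then show "(\<lambda>x. h (- x)) absolutely_integrable_on {0..1}"
      using absolutely_integrable_reflect_real[where f=h and a="-1" and b=0] by simp
  qed
  have comp_zero: "P' j = 0 \<longleftrightarrow> P j = 0" if "compatible P Q P' Q'" "j < m" for P Q P' Q' j
    using that by (simp add: compatible_def)
  have "L2.dim {z. (z, scaleC \<mu> z) \<in> adjoint (minimal_operator m c)} = card B"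
  proof (rule L2.dim_eq_card_coordinates[OF finB, where Rel=Rel])
    fix v z assume "Rel v z"
    then obtain P Q P' Q' g g' where *: "sol P Q P' Q' g g'" "z = L2_of (\<lambda>x. cnj (glue g g' x))"
      unfolding Rel_def by blast
    note sq = glue_sq[OF *(1)]
    have "weak_pair (glue g g') (\<lambda>x. glue g g' (- x)) \<longleftrightarrow> compatible P Q P' Q'"
      using *(1) unfolding sol_def
      by (intro weak_pair_iff_compatible[where N="{}" and N'="{}"] abs_int[OF sq(2)])
        (auto simp: glue_simps)
    then have "weak_pair (\<lambda>x. cnj (cnj (glue g g' x))) (\<lambda>x. cnj (cnj (glue g g' (- x))))"
      using *(1) by (simp add: sol_def)
    then show "z \<in> {z. (z, scaleC \<mu> z) \<in> adjoint (minimal_operator m c)}"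
      unfolding *(2) mem_Collect_eq adjoint_eigen_iff[OF sq(1) lam] .
  next
    fix z assume "z \<in> {z. (z, scaleC \<mu> z) \<in> adjoint (minimal_operator m c)}"
    then have "(L2_of (L2_rep z), scaleC \<mu> (L2_of (L2_rep z))) \<in> adjoint (minimal_operator m c)"
      by (simp add: L2_of_rep)
    then have w: "weak_pair (\<lambda>x. cnj (L2_rep z x)) (\<lambda>x. cnj (L2_rep z (- x)))"
      unfolding adjoint_eigen_iff[OF square_integrable_rep lam] .
    note ai = abs_int[OF square_integrable_cnj[OF square_integrable_rep[of z]]]
    from weak_pair_solutions[OF ai w] obtain P Q P' Q' g g' N N' where *: "sol P Q P' Q' g g'"
      "negligible N" "\<forall>x\<in>{0<..<1} - N. cnj (L2_rep z x) = g x"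
      "negligible N'" "\<forall>x\<in>{0<..<1} - N'. cnj (L2_rep z (- x)) = g' x"
      unfolding sol_def by blast
    have "L2_of (L2_rep z) = L2_of (\<lambda>x. cnj (glue g g' x))"
    proof (subst L2_of_eq_iff[OF square_integrable_rep glue_sq(1)[OF *(1)]], intro exI conjI ballI)
      have "negligible (uminus ` N')" by (rule negligible_uminus[OF *(4)])
      then show "negligible ((N \<union> uminus ` N') \<union> {-1, 0, 1})"
        using *(2) by (intro negligible_Un) (auto intro: negligible_finite)
      fix x :: real assume x: "x \<in> {-1..1} - ((N \<union> uminus ` N') \<union> {-1, 0, 1})"
      then consider "x \<in> {0<..<1}" | "- x \<in> {0<..<1}" by force
      then have "cnj (L2_rep z x) = glue g g' x"
      proof cases
        case 1
        then show ?thesis using *(3) x by (simp add: glue_simps)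
      next
        case 2
        have "- x \<notin> N'" using x by (metis DiffD2 UnCI image_eqI minus_minus)
        then have "cnj (L2_rep z (- (- x))) = g' (- x)" using *(5) 2 by blast
        moreover have "glue g g' (- (- x)) = g' (- x)" by (rule glue_simps(2)[OF 2])
        ultimately show ?thesis by simp
      qed
      then show "L2_rep z x = cnj (glue g g' x)" by (metis complex_cnj_cnj)
    qed
    then have "Rel (\<lambda>i. cnj (co P Q Q' i)) z"
      unfolding Rel_def L2_of_rep using *(1) by blast
    then show "\<exists>v. Rel v z" by blast
  next
    fix v :: "nat \<times> nat \<Rightarrow> complex"
    obtain P Q Q' where adm: "admissible m r R.jump_coeff jump_coeff' P Q Q'" and eq: "\<forall>i\<in>B. co P Q Q' i = cnj (v i)"
      using co_onto[rule_format, of "\<lambda>i. cnj (v i)"] by blast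
    define P' where "P' j = (-1) ^ (m + j) * P j" for j
    have "\<exists>g. R.onesol P Q g" by (rule R.onesol_exists) (use adm in \<open>auto simp: admissible_def r_def\<close>)
    moreover have "\<exists>g'. L.onesol P' Q' g'" by (rule L.onesol_exists) (use adm in \<open>auto simp: admissible_def r_def P'_def\<close>)
    moreover have "compatible P Q P' Q'" using adm by (simp add: compatible_def admissible_def P'_def)
    ultimately obtain g g' where "sol P Q P' Q' g g'" by (auto simp: sol_def)
    then have "Rel (\<lambda>i. cnj (co P Q Q' i)) (L2_of (\<lambda>x. cnj (glue g g' x)))"
      unfolding Rel_def by blast
    moreover have "\<forall>i\<in>B. cnj (co P Q Q' i) = v i" using eq by simp
    ultimately show "\<exists>v' z. Rel v' z \<and> (\<forall>i\<in>B. v' i = v i)" by blast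
  next
    fix v z w y a assume "Rel v z" "Rel w y"
    then obtain P Q P' Q' g g' P1 Q1 P1' Q1' g1 g1' where
      1: "sol P Q P' Q' g g'" "\<forall>i. v i = cnj (co P Q Q' i)" "z = L2_of (\<lambda>x. cnj (glue g g' x))" and
      2: "sol P1 Q1 P1' Q1' g1 g1'" "\<forall>i. w i = cnj (co P1 Q1 Q1' i)" "y = L2_of (\<lambda>x. cnj (glue g1 g1' x))"
      unfolding Rel_def by blast
    let ?a = "cnj a"
    have comp: "compatible (\<lambda>j. P j + ?a * P1 j) (\<lambda>j. Q j + ?a * Q1 j) (\<lambda>j. P' j + ?a * P1' j) (\<lambda>j. Q' j + ?a * Q1' j)"
    proof -
      have lin: "(\<Sum>k<m. t k * (u k + ?a * w k)) = (\<Sum>k<m. t k * u k) + ?a * (\<Sum>k<m. t k * w k)"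
        for t u w :: "nat \<Rightarrow> complex"
        by (simp add: algebra_simps sum.distrib sum_distrib_left)
      have "(\<Sum>k<m. R.jump_coeff s k * (Q k + ?a * Q1 k)) + (\<Sum>k<m. jump_coeff' s k * (Q' k + ?a * Q1' k)) = 0"
        if "s < m" for s
      proof -
        have "(\<Sum>k<m. R.jump_coeff s k * (Q k + ?a * Q1 k)) + (\<Sum>k<m. jump_coeff' s k * (Q' k + ?a * Q1' k)) =
          ((\<Sum>k<m. R.jump_coeff s k * Q k) + (\<Sum>k<m. jump_coeff' s k * Q' k)) +
          ?a * ((\<Sum>k<m. R.jump_coeff s k * Q1 k) + (\<Sum>k<m. jump_coeff' s k * Q1' k))"
          unfolding lin by (simp add: distrib_left)
        then show ?thesis using 1(1) 2(1) that by (simp add: sol_def compatible_def)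
      qed
      then show ?thesis
        using 1(1) 2(1) by (simp add: sol_def compatible_def distrib_left mult.left_commute)
    qed
    have s: "sol (\<lambda>j. P j + ?a * P1 j) (\<lambda>j. Q j + ?a * Q1 j) (\<lambda>j. P' j + ?a * P1' j) (\<lambda>j. Q' j + ?a * Q1' j)
        (\<lambda>x. g x + ?a * g1 x) (\<lambda>x. g' x + ?a * g1' x)"
      using 1(1) 2(1) comp R.onesol_linear L.onesol_linear unfolding sol_def by blast
    have "z + scaleC a y = L2_of (\<lambda>x. cnj (glue g g' x) + a * cnj (glue g1 g1' x))"
      unfolding 1(3) 2(3) by (rule L2_of_lincomb[OF glue_sq(1)[OF 1(1)] glue_sq(1)[OF 2(1)]])
    also have "(\<lambda>x. cnj (glue g g' x) + a * cnj (glue g1 g1' x))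
        = (\<lambda>x. cnj (glue (\<lambda>x. g x + ?a * g1 x) (\<lambda>x. g' x + ?a * g1' x) x))"
      by (auto simp: glue_def)
    finally have "z + scaleC a y = L2_of (\<lambda>x. cnj (glue (\<lambda>x. g x + ?a * g1 x) (\<lambda>x. g' x + ?a * g1' x) x))" .
    moreover have "\<forall>i. v i + a * w i = cnj (co (\<lambda>j. P j + ?a * P1 j) (\<lambda>j. Q j + ?a * Q1 j) (\<lambda>j. Q' j + ?a * Q1' j) i)"
      using 1(2) 2(2) co_lin by simp
    ultimately show "Rel (\<lambda>i. v i + a * w i) (z + scaleC a y)"
      unfolding Rel_def using s by blast
  next
    fix v i assume "Rel v 0" and i: "i \<in> B"
    then obtain P Q P' Q' g g' where *: "sol P Q P' Q' g g'" "\<forall>i. v i = cnj (co P Q Q' i)"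
      "L2_of (\<lambda>_. 0) = L2_of (\<lambda>x. cnj (glue g g' x))"
      unfolding Rel_def L2_of_zero by blast
    obtain N where N: "negligible N" "\<And>x. x \<in> {-1..1} - N \<Longrightarrow> glue g g' x = 0"
      using *(3) L2_of_eq_iff[OF square_integrable_zero glue_sq(1)[OF *(1)]] by auto
    \<comment> \<open>The class being 0 gives this almost everywhere, and continuity of solutions
      gives it everywhere.\<close>
    have "g x = 0" if "x \<in> {0<..<1}" for x
    proof (rule continuous_zero_off_negligible[OF _ N(1) _ that])
      show "continuous_on {0<..<1} g" using *(1) R.onesol_continuous by (auto simp: sol_def)
      show "g x = 0" if "x \<in> {0<..<1} - N" for x using N(2)[of x] that by (simp add: glue_simps)
    qed
    then have "P j = 0 \<and> Q j = 0" if "j < m" for j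
      using R.onesol_data_unique[of P Q g j] *(1) that by (simp add: sol_def)
    moreover have "g' x = 0" if "x \<in> {0<..<1}" for x
    proof (rule continuous_zero_off_negligible[of _ "uminus ` N", OF _ _ _ that])
      show "continuous_on {0<..<1} g'" using *(1) L.onesol_continuous by (auto simp: sol_def)
      show "negligible (uminus ` N)" by (rule negligible_uminus[OF N(1)])
      show "g' x = 0" if x: "x \<in> {0<..<1} - uminus ` N" for x
      proof -
        have "- x \<notin> N" using x by (metis DiffD2 image_eqI minus_minus)
        then show ?thesis using N(2)[of "- x"] x by (simp add: glue_simps)
      qed
    qed
    then have "Q' j = 0" if "j < m" for j
      using L.onesol_data_unique[of P' Q' g' j] *(1) that by (simp add: sol_def)
    ultimately have "co P Q Q' i = 0" using co_zero i by blast
    then show "v i = 0" using *(2)[rule_format, of i] by simp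
  next
    fix v z assume "Rel v z" and v: "\<And>i. i \<in> B \<Longrightarrow> v i = 0"
    then obtain P Q P' Q' g g' where *: "sol P Q P' Q' g g'" "\<forall>i. v i = cnj (co P Q Q' i)"
      "z = L2_of (\<lambda>x. cnj (glue g g' x))"
      unfolding Rel_def by blast
    have comp: "compatible P Q P' Q'" and R1: "R.onesol P Q g" and L1: "L.onesol P' Q' g'"
      using *(1) by (auto simp: sol_def)
    have "P j = 0" if "j < r" for j
      using R.onesol_low[OF R1, of j] L.onesol_low[OF L1, of j] comp_zero[OF comp, of j] that r
      by (auto simp: r_def less_max_iff_disj)
    then have "admissible m r R.jump_coeff jump_coeff' P Q Q'"
      using comp by (simp add: admissible_def compatible_def)
    moreover have "\<forall>i\<in>B. co P Q Q' i = 0" using *(2) v by (metis complex_cnj_zero_iff)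
    ultimately have z: "\<And>j. j < m \<Longrightarrow> P j = 0 \<and> Q j = 0 \<and> Q' j = 0" using co_inj by blast
    then have z': "\<And>j. j < m \<Longrightarrow> P' j = 0" using comp_zero[OF comp] by simp
    have "R.onesol (\<lambda>_. 0) (\<lambda>_. 0) g" by (rule R.onesol_cong[OF R1]) (use z in auto)
    then have g: "\<And>x. x \<in> {0<..<1} \<Longrightarrow> g x = 0" by (rule R.onesol_unique)
    have "L.onesol (\<lambda>_. 0) (\<lambda>_. 0) g'" by (rule L.onesol_cong[OF L1]) (use z z' in auto)
    then have g': "\<And>x. x \<in> {0<..<1} \<Longrightarrow> g' x = 0" by (rule L.onesol_unique)
    have "(\<lambda>x. cnj (glue g g' x)) = (\<lambda>_. 0)"
      using g g' by (auto simp: glue_def fun_eq_iff)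
    then show "z = 0" unfolding *(3) L2_of_zero by simp
  qed
  then show ?thesis by (simp add: deficiency_number_def card r_def)
qed

end

theorem theorem3p1:
  fixes m p q :: nat and c :: "real \<Rightarrow> real" and \<mu> :: complex
  assumes "m \<ge> 1"
    and "p \<in> {1..2 * m - 1}" and "q \<in> {1..2 * m - 1}"
    and "coefficient p q c"
    and "Im \<mu> \<noteq> 0"
  shows "(p \<in> {m + 1..2 * m - 1} \<and> q \<in> {m + 1..2 * m - 1} \<longrightarrow>
            deficiency_number (minimal_operator m c) \<mu> = 4 * m - max p q) \<and>
         (p \<in> {1..m} \<and> q \<in> {1..m} \<longrightarrow>
            deficiency_number (minimal_operator m c) \<mu> = 2 * m + min p q) \<and>
         (p \<in> {1..m} \<and> q \<in> {m + 1..2 * m - 1} \<longrightarrow>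
            deficiency_number (minimal_operator m c) \<mu> = 3 * m + p - q)"
proof -
  obtain a b \<alpha> \<beta> where nz: "\<And>x. x \<in> {-1..1} \<Longrightarrow> c x = 0 \<longleftrightarrow> x = 0"
    and \<alpha>0: "\<alpha> 0 \<noteq> 0" and \<beta>0: "\<beta> 0 \<noteq> 0"
    and a: "\<And>x. \<bar>x\<bar> < 1 \<Longrightarrow> (\<lambda>j. \<alpha> j * x ^ j) sums a x"
    and b: "\<And>x. \<bar>x\<bar> < 1 \<Longrightarrow> (\<lambda>j. \<beta> j * x ^ j) sums b x"
    and cont: "continuous_on {0..1} a" "continuous_on {-1..0} b"
    and ca: "\<And>x. x \<in> {0..1} \<Longrightarrow> c x = x ^ p * a x" and cb: "\<And>x. x \<in> {-1..0} \<Longrightarrow> c x = (- x) ^ q * b x"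
    using assms(4) unfolding coefficient_def by blast
  have pq: "1 \<le> p" "p < 2 * m" "1 \<le> q" "q < 2 * m" using assms by auto
  define lam where "lam = (-1) ^ m * cnj \<mu>"
  obtain \<kappa> A where R: "side_jet m p c \<kappa> A (\<alpha> 0)" "A p 0 \<noteq> 0"
    by (rule side_jet_of_power_series[OF assms(1) pq(1,2) a \<alpha>0 cont(1) ca]) (use nz in auto)
  have b_refl: "(\<lambda>j. ((-1) ^ j * \<beta> j) * x ^ j) sums b (- x)" if "\<bar>x\<bar> < 1" for x
  proof -
    have "(\<lambda>j. \<beta> j * (- x) ^ j) sums b (- x)" by (rule b) (use that in simp)
    moreover have "\<beta> j * (- x) ^ j = ((-1) ^ j * \<beta> j) * x ^ j" for j
      by (subst power_minus) simp
    ultimately show ?thesis by simp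
  qed
  have b_cont: "continuous_on {0..1} (\<lambda>x. b (- x))"
    by (rule continuous_on_compose2[OF cont(2)]) (auto intro!: continuous_intros)
  have c_refl: "c (- x) = x ^ q * b (- x)" if "x \<in> {0..1}" for x using cb[of "- x"] that by simp
  obtain \<kappa>' A' where L: "side_jet m q (\<lambda>x. c (- x)) \<kappa>' A' ((-1) ^ 0 * \<beta> 0)" "A' q 0 \<noteq> 0"
    by (rule side_jet_of_power_series[OF assms(1) pq(3,4) b_refl _ b_cont c_refl]) (use nz \<beta>0 in auto)
  interpret degenerate_operator m p c \<kappa> lam A "\<alpha> 0" q "\<lambda>x. c (- x)" \<kappa>' A' "(-1) ^ 0 * \<beta> 0"
    by (intro degenerate_operator.intro two_sided.intro two_sided_axioms.intro degenerate_operator_axioms.intro R L refl)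
  \<comment> \<open>With truncated subtraction the last summand is min m (min p q), and the first is
    m or 2m - max p q according to whether max p q exceeds m; the three cases follow by
    arithmetic.\<close>
  show ?thesis
    using deficiency_number_eq[OF lam_def] pq by (auto simp: max_def min_def)
qed

end
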